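(* Work in the holomorphic or in the real analytic category. (i) Let $Q,u,v$ be three functions of local coordinates $(x,y,z)$ on a $3$-dimensional manifold, and put $$f=Q'_x-u\,v'_x,\qquad g=Q'_y-u\,v'_y,\qquad h=Q'_z-u\,v'_z,$$ where $Q'_x,v'_x$, etc. denote partial derivatives. Assume that three of the four $2$-forms $df\wedge dx$, $dg\wedge dy$, $dh\wedge dz$, $du\wedge dv$ are linearly independent at every point. Let $W$ be the $4$-web of curves formed by the four foliations admitting respectively $(f,x)$, $(g,y)$, $(h,z)$ and $(u,v)$ as systems of basic functions. Then $W$ is flat. (ii) Conversely, every germ of flat $4$-web of curves in a $3$-dimensional manifold is isomorphic to (the germ of) a web constructed as in (i) from three functions $Q,u,v$.
   Context: Everything is holomorphic, or everything is real analytic. A $4$-web of curves on a $3$-dimensional manifold is given locally by four one-dimensional foliations $\mathcal F_1,\dots,\mathcal F_4$ in general position: if $V_\lambda$ generates $T(\mathcal F_\lambda)$, any three of the four vector fields $V_\lambda$ are linearly independent at every point. That a pair of functions $(a,b)$ is a system of basic functions for a one-dimensional foliation means that $da\wedge db$ is nowhere zero and the leaves are the connected components of the common level curves of $a$ and $b$. A $2$-form $\eta$ is $\mathcal F$-basic if $\iota_w\eta=0$ and $L_w\eta=0$ for every vector field $w$ tangent to $\mathcal F$. An abelian relation of the web near a point is a family $(\eta_1,\eta_2,\eta_3,\eta_4)$ of $2$-forms with $\eta_1+\eta_2+\eta_3+\eta_4=0$ and each $\eta_\lambda$ being $\mathcal F_\lambda$-basic. The rank of the web is the (maximal) dimension of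 the space of germs of abelian relations at a point; it is always $0$ or $1$. The web is called flat when its curvature vanishes, i.e. when it has rank $1$. Two germs of webs are isomorphic if there is a germ of biholomorphism (resp. real analytic diffeomorphism) mapping the foliations of one onto the foliations of the other. *)

theory Defs
  imports "HOL-Analysis.Analysis"
begin

text \<open>
  The real analytic and the holomorphic category are treated uniformly over a complete normed
  field \<open>'k\<close>: a function is analytic if it is locally the sum of a convergent power series
  with coefficients in \<open>'k\<close>. For \<open>'k = real\<close> this is real analyticity, for
  \<open>'k = complex\<close> it is holomorphy in several variables. (As the norm of a
  \<^class>\<open>real_normed_field\<close> is multiplicative, these are the only two cases.)
\<close>

class analytic_scalar = real_normed_field + euclidean_space

instance real :: analytic_scalar ..
instance complex :: analytic_scalar ..

definition kanalytic_at :: "('k::analytic_scalar ^ 'n \<Rightarrow> 'k) \<Rightarrow> 'k ^ 'n \<Rightarrow> bool" where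
  "kanalytic_at f p \<longleftrightarrow>
     (\<exists>(c :: ('n \<Rightarrow> nat) \<Rightarrow> 'k) (r :: real). 0 < r \<and>
        (\<forall>q. (\<forall>i. norm (q $ i - p $ i) < r) \<longrightarrow>
             ((\<lambda>m. c m * (\<Prod>i\<in>UNIV. (q $ i - p $ i) ^ m i)) has_sum f q) UNIV))"

definition kanalytic_on :: "('k::analytic_scalar ^ 'n) set \<Rightarrow> ('k ^ 'n \<Rightarrow> 'k) \<Rightarrow> bool" where
  "kanalytic_on N f \<longleftrightarrow> (\<forall>p\<in>N. kanalytic_at f p)"

definition kanalytic_map_on ::
    "('k::analytic_scalar ^ 'n) set \<Rightarrow> ('k ^ 'n \<Rightarrow> 'k ^ 'l) \<Rightarrow> bool" where
  "kanalytic_map_on N \<phi> \<longleftrightarrow> (\<forall>i. kanalytic_on N (\<lambda>q. \<phi> q $ i))"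

definition pd :: "'n \<Rightarrow> ('k::analytic_scalar ^ 'n \<Rightarrow> 'k) \<Rightarrow> 'k ^ 'n \<Rightarrow> 'k" where
  "pd i f q = deriv (\<lambda>t. f (q + axis i t)) 0"

definition differential :: "('k::analytic_scalar ^ 'n \<Rightarrow> 'k) \<Rightarrow> 'k ^ 'n \<Rightarrow> 'k ^ 'n \<Rightarrow> 'k" where
  "differential f q w = (\<Sum>i\<in>UNIV. pd i f q * w $ i)"


text \<open>
  A 2-form is given by its antisymmetric matrix of components
  \<open>\<eta> $ i $ j = \<eta>(\<partial>\<^sub>i, \<partial>\<^sub>j)\<close>.
\<close>

definition two_form_on :: "('k::analytic_scalar ^ 3) set \<Rightarrow> ('k ^ 3 \<Rightarrow> 'k ^ 3 ^ 3) \<Rightarrow> bool" where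
  "two_form_on N \<eta> \<longleftrightarrow>
     (\<forall>i j. kanalytic_on N (\<lambda>q. \<eta> q $ i $ j)) \<and> (\<forall>q\<in>N. \<forall>i j. \<eta> q $ i $ j = - \<eta> q $ j $ i)"

definition wedge_d ::
    "('k::analytic_scalar ^ 3 \<Rightarrow> 'k) \<Rightarrow> ('k ^ 3 \<Rightarrow> 'k) \<Rightarrow> 'k ^ 3 \<Rightarrow> 'k ^ 3 ^ 3" where
  "wedge_d a b q = (\<chi> i j. pd i a q * pd j b q - pd j a q * pd i b q)"

definition form_scale :: "'k::analytic_scalar \<Rightarrow> 'k ^ 3 ^ 3 \<Rightarrow> 'k ^ 3 ^ 3" where
  "form_scale c \<eta> = (\<chi> i j. c * \<eta> $ i $ j)"

definition interior_product ::
    "('k::analytic_scalar ^ 3 \<Rightarrow> 'k ^ 3) \<Rightarrow> ('k ^ 3 \<Rightarrow> 'k ^ 3 ^ 3) \<Rightarrow> 'k ^ 3 \<Rightarrow> 'k ^ 3" where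
  "interior_product w \<eta> q = (\<chi> j. \<Sum>i\<in>UNIV. w q $ i * \<eta> q $ i $ j)"

definition lie_derivative ::
    "('k::analytic_scalar ^ 3 \<Rightarrow> 'k ^ 3) \<Rightarrow> ('k ^ 3 \<Rightarrow> 'k ^ 3 ^ 3) \<Rightarrow> 'k ^ 3 \<Rightarrow> 'k ^ 3 ^ 3" where
  "lie_derivative w \<eta> q = (\<chi> i j. \<Sum>k\<in>UNIV.
       w q $ k * pd k (\<lambda>x. \<eta> x $ i $ j) q
     + pd i (\<lambda>x. w x $ k) q * \<eta> q $ k $ j
     + pd j (\<lambda>x. w x $ k) q * \<eta> q $ i $ k)"

definition lin_indep ::
    "('k::zero \<Rightarrow> 'v \<Rightarrow> 'v::comm_monoid_add) \<Rightarrow> 'i set \<Rightarrow> ('i \<Rightarrow> 'v) \<Rightarrow> bool" where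
  "lin_indep smul S V \<longleftrightarrow> (\<forall>c. (\<Sum>i\<in>S. smul (c i) (V i)) = 0 \<longrightarrow> (\<forall>i\<in>S. c i = 0))"


text \<open>
  A foliation is represented by the set of its leaves. In the restriction of a foliation to a
  smaller open set a leaf falls apart into its path components; path components rather than
  connected components, because a leaf may accumulate on itself, and then its topology as an
  immersed curve is finer than the subspace topology.
\<close>

definition restrict_leaves :: "'m::topological_space set set \<Rightarrow> 'm set \<Rightarrow> 'm set set" where
  "restrict_leaves \<L> N = {path_component_set (L \<inter> N) q | L q. L \<in> \<L> \<and> q \<in> L \<inter> N}"

definition level_curves ::
    "'m::topological_space set \<Rightarrow> ('m \<Rightarrow> 'k) \<Rightarrow> ('m \<Rightarrow> 'k) \<Rightarrow> 'm set set" where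
  "level_curves N a b = (\<Union>c d. components {q \<in> N. a q = c \<and> b q = d})"

definition basic_functions ::
    "('k::analytic_scalar ^ 3) set \<Rightarrow> ('k ^ 3 \<Rightarrow> 'k) \<Rightarrow> ('k ^ 3 \<Rightarrow> 'k) \<Rightarrow> ('k ^ 3) set set \<Rightarrow> bool" where
  "basic_functions N a b \<L> \<longleftrightarrow>
     kanalytic_on N a \<and> kanalytic_on N b \<and> (\<forall>q\<in>N. wedge_d a b q \<noteq> 0) \<and> \<L> = level_curves N a b"

definition tangent_space :: "('k::analytic_scalar ^ 3) set set \<Rightarrow> 'k ^ 3 \<Rightarrow> ('k ^ 3) set" where
  "tangent_space \<L> p =
     {w. \<exists>N a b. open N \<and> p \<in> N \<and> basic_functions N a b (restrict_leaves \<L> N) \<and>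
                 differential a p w = 0 \<and> differential b p w = 0}"

definition tangent_field ::
    "('k::analytic_scalar ^ 3) set \<Rightarrow> ('k ^ 3) set set \<Rightarrow> ('k ^ 3 \<Rightarrow> 'k ^ 3) \<Rightarrow> bool" where
  "tangent_field N \<L> w \<longleftrightarrow> kanalytic_map_on N w \<and> (\<forall>q\<in>N. w q \<in> tangent_space \<L> q)"

definition basic_form ::
    "('k::analytic_scalar ^ 3) set \<Rightarrow> ('k ^ 3) set set \<Rightarrow> ('k ^ 3 \<Rightarrow> 'k ^ 3 ^ 3) \<Rightarrow> bool" where
  "basic_form N \<L> \<eta> \<longleftrightarrow>
     (\<forall>N' w. open N' \<and> N' \<subseteq> N \<and> tangent_field N' \<L> w \<longrightarrow>
        (\<forall>q\<in>N'. interior_product w \<eta> q = 0 \<and> lie_derivative w \<eta> q = 0))"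

definition abelian_relation ::
    "('k::analytic_scalar ^ 3) set \<Rightarrow> (4 \<Rightarrow> ('k ^ 3) set set) \<Rightarrow> (4 \<Rightarrow> 'k ^ 3 \<Rightarrow> 'k ^ 3 ^ 3) \<Rightarrow> bool"
  where
  "abelian_relation N F \<eta> \<longleftrightarrow>
     (\<forall>l. two_form_on N (\<eta> l) \<and> basic_form N (F l) (\<eta> l)) \<and> (\<forall>q\<in>N. (\<Sum>l\<in>UNIV. \<eta> l q) = 0)"

definition abelian_relations_near ::
    "(4 \<Rightarrow> ('k::analytic_scalar ^ 3) set set) \<Rightarrow> 'k ^ 3 \<Rightarrow> (4 \<Rightarrow> 'k ^ 3 \<Rightarrow> 'k ^ 3 ^ 3) set" where
  "abelian_relations_near F p = {\<eta>. \<exists>N. open N \<and> p \<in> N \<and> abelian_relation N F \<eta>}"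

text \<open>
  The dimension of the space of germs at \<open>p\<close> of abelian relations, as the supremum of the
  lengths of families of relations near \<open>p\<close> whose germs are linearly independent over
  \<open>'k\<close>.
\<close>

definition web_rank ::
    "(4 \<Rightarrow> ('k::analytic_scalar ^ 3) set set) \<Rightarrow> 'k ^ 3 \<Rightarrow> enat" where
  "web_rank F p = Sup {enat r | r.
     \<exists>\<eta> :: nat \<Rightarrow> 4 \<Rightarrow> 'k ^ 3 \<Rightarrow> 'k ^ 3 ^ 3.
       (\<forall>i<r. \<eta> i \<in> abelian_relations_near F p) \<and>
       (\<forall>c. (\<forall>\<^sub>F q in nhds p. \<forall>l. (\<Sum>i<r. form_scale (c i) (\<eta> i l q)) = 0) \<longrightarrow> (\<forall>i<r. c i = 0))}"


type_synonym ('m, 'k) atlas = "('m set \<times> ('m \<Rightarrow> 'k ^ 3)) set"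

definition analytic_manifold ::
    "'m::topological_space set \<Rightarrow> ('m, 'k::analytic_scalar) atlas \<Rightarrow> bool" where
  "analytic_manifold M A \<longleftrightarrow>
     M = (\<Union>(D, \<kappa>)\<in>A. D) \<and>
     (\<forall>(D, \<kappa>)\<in>A. open D \<and> open (\<kappa> ` D) \<and> homeomorphism D (\<kappa> ` D) \<kappa> (inv_into D \<kappa>)) \<and>
     (\<forall>(D, \<kappa>)\<in>A. \<forall>(E, \<tau>)\<in>A. kanalytic_map_on (\<kappa> ` (D \<inter> E)) (\<tau> \<circ> inv_into D \<kappa>))"

text \<open>The coordinate expression of a foliation.\<close>

definition chart_leaves ::
    "'m::topological_space set \<Rightarrow> ('m \<Rightarrow> 'k::analytic_scalar ^ 3) \<Rightarrow> 'm set set \<Rightarrow> ('k ^ 3) set set" where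
  "chart_leaves D \<kappa> \<L> = (\<lambda>L. \<kappa> ` L) ` restrict_leaves \<L> D"

text \<open>
  One-dimensional foliations are given by distinguished charts: locally the leaves are the level
  curves of a system of basic functions.
\<close>

definition foliation_on ::
    "('m::topological_space, 'k::analytic_scalar) atlas \<Rightarrow> 'm set \<Rightarrow> 'm set set \<Rightarrow> bool" where
  "foliation_on A U \<L> \<longleftrightarrow>
     open U \<and> partition_on U \<L> \<and> (\<forall>L\<in>\<L>. path_connected L) \<and>
     (\<forall>(D, \<kappa>)\<in>A. \<forall>p\<in>D \<inter> U. \<exists>N a b. open N \<and> \<kappa> p \<in> N \<and> N \<subseteq> \<kappa> ` (D \<inter> U) \<and>
        basic_functions N a b (restrict_leaves (chart_leaves D \<kappa> \<L>) N))"

definition four_web_on ::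
    "('m::topological_space, 'k::analytic_scalar) atlas \<Rightarrow> 'm set \<Rightarrow> (4 \<Rightarrow> 'm set set) \<Rightarrow> bool" where
  "four_web_on A U F \<longleftrightarrow>
     (\<forall>l. foliation_on A U (F l)) \<and>
     (\<forall>(D, \<kappa>)\<in>A. \<forall>p\<in>D \<inter> U. \<forall>V.
        (\<forall>l. tangent_space (chart_leaves D \<kappa> (F l)) (\<kappa> p) = vec.span {V l}) \<longrightarrow>
        (\<forall>S. card S = 3 \<longrightarrow> lin_indep (*s) S V))"

text \<open>A web is flat at a point if its rank there is 1; the rank is computed in charts.\<close>

definition flat_at ::
    "('m::topological_space, 'k::analytic_scalar) atlas \<Rightarrow> (4 \<Rightarrow> 'm set set) \<Rightarrow> 'm \<Rightarrow> bool" where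
  "flat_at A F p \<longleftrightarrow>
     (\<forall>(D, \<kappa>)\<in>A. p \<in> D \<longrightarrow> web_rank (\<lambda>l. chart_leaves D \<kappa> (F l)) (\<kappa> p) = 1)"

definition bianalytic_on ::
    "('m::topological_space, 'k::analytic_scalar) atlas \<Rightarrow> ('n::topological_space, 'k) atlas \<Rightarrow>
     'm set \<Rightarrow> ('m \<Rightarrow> 'n) \<Rightarrow> bool" where
  "bianalytic_on A B N \<phi> \<longleftrightarrow>
     homeomorphism N (\<phi> ` N) \<phi> (inv_into N \<phi>) \<and>
     (\<forall>(D, \<kappa>)\<in>A. \<forall>(E, \<tau>)\<in>B.
        kanalytic_map_on (\<kappa> ` {q \<in> N \<inter> D. \<phi> q \<in> E}) (\<tau> \<circ> \<phi> \<circ> inv_into D \<kappa>) \<and>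
        kanalytic_map_on (\<tau> ` \<phi> ` {q \<in> N \<inter> D. \<phi> q \<in> E}) (\<kappa> \<circ> inv_into N \<phi> \<circ> inv_into E \<tau>))"

definition web_germs_isomorphic ::
    "('m::topological_space, 'k::analytic_scalar) atlas \<Rightarrow> 'm set \<Rightarrow> (4 \<Rightarrow> 'm set set) \<Rightarrow> 'm \<Rightarrow>
     ('n::topological_space, 'k) atlas \<Rightarrow> 'n set \<Rightarrow> (4 \<Rightarrow> 'n set set) \<Rightarrow> 'n \<Rightarrow> bool" where
  "web_germs_isomorphic A U F p B V G p' \<longleftrightarrow>
     (\<exists>N \<phi>. open N \<and> p \<in> N \<and> N \<subseteq> U \<and> open (\<phi> ` N) \<and> \<phi> ` N \<subseteq> V \<and> \<phi> p = p' \<and>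
        bianalytic_on A B N \<phi> \<and>
        (\<forall>l. (\<lambda>L. \<phi> ` L) ` restrict_leaves (F l) N = restrict_leaves (G l) (\<phi> ` N)))"


text \<open>
  The pairs \<open>(f,x)\<close>, \<open>(g,y)\<close>, \<open>(h,z)\<close>, \<open>(u,v)\<close>, in the coordinates
  \<open>x = q $ 1\<close>, \<open>y = q $ 2\<close>, \<open>z = q $ 3\<close>.
\<close>

definition quv_first ::
    "('k::analytic_scalar ^ 3 \<Rightarrow> 'k) \<Rightarrow> ('k ^ 3 \<Rightarrow> 'k) \<Rightarrow> ('k ^ 3 \<Rightarrow> 'k) \<Rightarrow> 4 \<Rightarrow> 'k ^ 3 \<Rightarrow> 'k" where
  "quv_first Q u v l =
     (if l = 1 then (\<lambda>q. pd 1 Q q - u q * pd 1 v q)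
      else if l = 2 then (\<lambda>q. pd 2 Q q - u q * pd 2 v q)
      else if l = 3 then (\<lambda>q. pd 3 Q q - u q * pd 3 v q)
      else u)"

definition quv_second :: "('k::analytic_scalar ^ 3 \<Rightarrow> 'k) \<Rightarrow> 4 \<Rightarrow> 'k ^ 3 \<Rightarrow> 'k" where
  "quv_second v l =
     (if l = 1 then (\<lambda>q. q $ 1) else if l = 2 then (\<lambda>q. q $ 2) else if l = 3 then (\<lambda>q. q $ 3)
      else v)"

definition quv_data ::
    "('k::analytic_scalar ^ 3) set \<Rightarrow> ('k ^ 3 \<Rightarrow> 'k) \<Rightarrow> ('k ^ 3 \<Rightarrow> 'k) \<Rightarrow> ('k ^ 3 \<Rightarrow> 'k) \<Rightarrow> bool" where
  "quv_data V Q u v \<longleftrightarrow>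
     open V \<and> kanalytic_on V Q \<and> kanalytic_on V u \<and> kanalytic_on V v \<and>
     (\<forall>q\<in>V. \<exists>S. card S = 3 \<and>
        lin_indep form_scale S (\<lambda>l. wedge_d (quv_first Q u v l) (quv_second v l) q))"

text \<open>The web on the domain \<open>D\<close> of the local coordinates \<open>\<kappa> = (x, y, z)\<close>.\<close>

definition quv_web ::
    "'m::topological_space set \<Rightarrow> ('m \<Rightarrow> 'k::analytic_scalar ^ 3) \<Rightarrow>
     ('k ^ 3 \<Rightarrow> 'k) \<Rightarrow> ('k ^ 3 \<Rightarrow> 'k) \<Rightarrow> ('k ^ 3 \<Rightarrow> 'k) \<Rightarrow> 4 \<Rightarrow> 'm set set" where
  "quv_web D \<kappa> Q u v l = level_curves D (quv_first Q u v l \<circ> \<kappa>) (quv_second v l \<circ> \<kappa>)"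

end

theory Submission
  imports Defs
begin

text \<open>
  In dimension three a 2-form is the contraction of the volume form with a vector field. A form
  that is basic for a foliation by curves corresponds to a field tangent to the leaves, and it is
  closed, so that the field has divergence zero. An abelian relation therefore is a family of four
  divergence-free fields \<open>E\<^sub>l\<close>, tangent to the four foliations, with sum zero
  (\<open>abelian_relation_fields\<close>). Since any three of the four directions are independent, linear algebra
  determines the \<open>E\<^sub>l\<close> up to a common factor \<open>\<mu>\<close>, and the vanishing of the divergences gives
  \<open>d\<mu> = \<mu> \<Theta>\<close> with a known 1-form \<open>\<Theta>\<close>. Hence a relation that vanishes at a point vanishes
  nearby (\<open>relation_vanishes_near\<close>), and the rank is at most one.

  For the web of \<open>Q, u, v\<close> one has \<open>f dx + g dy + h dz + u dv = dQ\<close>. Taking exterior derivatives,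
  \<open>df \<and> dx + dg \<and> dy + dh \<and> dz + du \<and> dv = 0\<close> is an abelian relation
  (\<open>quv_relation\<close>), and the rank is one (\<open>web_rank_one\<close>). The forms and the foliations are
  transported to the other charts of the manifold.

  Conversely, a flat web has a relation with nonzero germ, which then has no zero at the point, and by
  general position none of its four components has one. Basic functions \<open>x, y, z\<close> of
  the first three foliations with independent differentials serve as coordinates. A closed
  basic form is \<open>df \<and> dx\<close> for some function \<open>f\<close> as soon as \<open>x\<close> is a basic function with nonzero
  differential (\<open>closed_form_potential\<close>), so that the relation has the form above with functions
  \<open>f, g, h, u, v\<close>. It says that \<open>f dx + g dy + h dz + u dv\<close> is closed, and a primitive \<open>Q\<close> exists
  by the lemma of Poincare (\<open>flat_normal_form\<close>).

  The leaves are handled through flow boxes (\<open>level_set_chart\<close>): level sets of basic functions are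
  locally arcs or discs, so their components are path components, and functions with the same
  differential kernels have the same level curves.

  Analyticity over both scalar fields at once is treated by majorants: \<open>majorized r C f\<close> says that
  \<open>f\<close> has a power series on the polydisc of radius \<open>r\<close> whose coefficients, weighted by powers of
  \<open>r\<close>, have absolute sum at most \<open>C\<close>. This bound behaves like a submultiplicative norm that is
  complete, so that composition, reciprocals and the inverse function theorem are obtained from
  convergent sums and from a contracting iteration.
\<close>


section \<open>Majorized power series in several variables\<close>

definition mpow :: "'k::analytic_scalar ^ 'n \<Rightarrow> ('n \<Rightarrow> nat) \<Rightarrow> 'k" where
  "mpow x m = (\<Prod>i\<in>UNIV. (x $ i) ^ m i)"

definition mdeg :: "('n::finite \<Rightarrow> nat) \<Rightarrow> nat" where
  "mdeg m = (\<Sum>i\<in>UNIV. m i)"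

definition polydisc :: "real \<Rightarrow> ('k::analytic_scalar ^ 'n) set" where
  "polydisc r = {x. \<forall>i. norm (x $ i) \<le> r}"

text \<open>
  The absolute sum of the coefficients with weights \<open>r\<close> to the degree: a bound for all partial sums
  on the polydisc of radius \<open>r\<close>, additive and submultiplicative in the series.
\<close>

definition wsum :: "real \<Rightarrow> (('n::finite \<Rightarrow> nat) \<Rightarrow> 'k::analytic_scalar) \<Rightarrow> real" where
  "wsum r c = (\<Sum>\<^sub>\<infinity>m. norm (c m) * r ^ mdeg m)"

definition power_series ::
    "real \<Rightarrow> (('n::finite \<Rightarrow> nat) \<Rightarrow> 'k::analytic_scalar) \<Rightarrow> ('k ^ 'n \<Rightarrow> 'k) \<Rightarrow> bool" where
  "power_series r c f \<longleftrightarrow>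
     (\<lambda>m. norm (c m) * r ^ mdeg m) summable_on UNIV \<and>
     (\<forall>x\<in>polydisc r. ((\<lambda>m. c m * mpow x m) has_sum f x) UNIV)"

definition majorized :: "real \<Rightarrow> real \<Rightarrow> ('k::analytic_scalar ^ 'n \<Rightarrow> 'k) \<Rightarrow> bool" where
  "majorized r C f \<longleftrightarrow> (\<exists>c. power_series r c f \<and> wsum r c \<le> C)"

lemma mpow_add: "mpow x (\<lambda>i. m i + n i) = mpow x m * mpow x n"
  by (simp add: mpow_def power_add prod.distrib)

lemma mdeg_add: "mdeg (\<lambda>i. m i + n i) = mdeg m + mdeg n"
  by (simp add: mdeg_def sum.distrib)

lemma norm_mpow_le:
  assumes "x \<in> polydisc r"
  shows "norm (mpow x m) \<le> r ^ mdeg m"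
proof -
  have "norm (mpow x m) = (\<Prod>i\<in>UNIV. norm (x $ i) ^ m i)"
    by (simp add: mpow_def prod_norm[symmetric] norm_power)
  also have "\<dots> \<le> (\<Prod>i\<in>UNIV. r ^ m i)"
    using assms by (intro prod_mono) (auto simp: polydisc_def intro!: power_mono)
  also have "\<dots> = r ^ mdeg m" by (simp add: mdeg_def power_sum)
  finally show ?thesis .
qed

lemma polydisc_mono: "r \<le> s \<Longrightarrow> polydisc r \<subseteq> polydisc s"
  unfolding polydisc_def by (auto intro: order_trans)

lemma abs_summable_terms:
  assumes "(\<lambda>i. norm (e i) * r ^ mdeg (\<mu> i)) summable_on I" "x \<in> polydisc r"
  shows "(\<lambda>i. norm (e i * mpow x (\<mu> i))) summable_on I"
  by (rule Infinite_Sum.abs_summable_on_comparison_test'[OF assms(1)])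
     (simp add: norm_mult mult_left_mono norm_mpow_le assms(2))

lemma infsum_abs_terms_le:
  assumes "(\<lambda>i. norm (e i) * r ^ mdeg (\<mu> i)) summable_on I" "x \<in> polydisc r"
  shows "norm (\<Sum>\<^sub>\<infinity>i\<in>I. e i * mpow x (\<mu> i)) \<le> (\<Sum>\<^sub>\<infinity>i\<in>I. norm (e i) * r ^ mdeg (\<mu> i))"
proof -
  have "norm (\<Sum>\<^sub>\<infinity>i\<in>I. e i * mpow x (\<mu> i)) \<le> (\<Sum>\<^sub>\<infinity>i\<in>I. norm (e i * mpow x (\<mu> i)))"
    by (rule norm_infsum_bound) (rule abs_summable_terms[OF assms])
  also have "\<dots> \<le> (\<Sum>\<^sub>\<infinity>i\<in>I. norm (e i) * r ^ mdeg (\<mu> i))"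
    by (rule infsum_mono[OF abs_summable_terms[OF assms] assms(1)])
       (simp add: norm_mult mult_left_mono norm_mpow_le assms(2))
  finally show ?thesis .
qed

lemma power_series_norm_le:
  assumes "power_series r c f" "x \<in> polydisc r"
  shows "norm (f x) \<le> wsum r c"
  using infsum_abs_terms_le[of c r "\<lambda>m. m" UNIV x] assms
  by (auto simp: power_series_def wsum_def dest!: infsumI)

lemma majorized_norm_le:
  assumes "majorized r C f" "x \<in> polydisc r"
  shows "norm (f x) \<le> C"
  using power_series_norm_le[OF _ assms(2)] assms(1) unfolding majorized_def by force

lemma wsum_nonneg: "0 \<le> r \<Longrightarrow> 0 \<le> wsum r c"
  unfolding wsum_def by (rule infsum_nonneg) simp

lemma majorized_nonneg: "0 \<le> r \<Longrightarrow> majorized r C f \<Longrightarrow> 0 \<le> C"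
  unfolding majorized_def using wsum_nonneg order_trans by blast

text \<open>
  Terms with the same exponent are collected by Fubini's theorem for absolutely convergent sums.
  Infinite sums and products of power series are instances, with pairs as indices.
\<close>

lemma majorized_regroup:
  fixes e :: "'i \<Rightarrow> 'k::analytic_scalar" and \<mu> :: "'i \<Rightarrow> 'n::finite \<Rightarrow> nat"
  assumes r: "0 \<le> r"
    and sm: "(\<lambda>i. norm (e i) * r ^ mdeg (\<mu> i)) summable_on I"
    and le: "(\<Sum>\<^sub>\<infinity>i\<in>I. norm (e i) * r ^ mdeg (\<mu> i)) \<le> C"
    and f: "\<And>x. x \<in> polydisc r \<Longrightarrow> f x = (\<Sum>\<^sub>\<infinity>i\<in>I. e i * mpow x (\<mu> i))"
  shows "majorized r C f"
proof -
  define B where "B m = {i \<in> I. \<mu> i = m}" for m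
  \<comment> \<open>For \<open>r = 0\<close> the coefficients of positive degree need not be summable, but their monomials vanish on the polydisc; they are set to zero.\<close>
  define c where "c m = (\<Sum>\<^sub>\<infinity>i\<in>B m. if r = 0 \<and> mdeg m > 0 then 0 else e i)" for m
  have bij: "bij_betw snd (Sigma UNIV B) I"
    by (rule bij_betwI[where g = "\<lambda>i. (\<mu> i, i)"]) (auto simp: B_def)
  have smS: "(\<lambda>p. norm (e (snd p)) * r ^ mdeg (\<mu> (snd p))) summable_on Sigma UNIV B"
    using sm summable_on_reindex_bij_betw[OF bij, of "\<lambda>i. norm (e i) * r ^ mdeg (\<mu> i)"] by simp
  have smB: "(\<lambda>i. norm (e i) * r ^ mdeg m) summable_on B m" for m
  proof -
    have "(\<lambda>i. norm (e i) * r ^ mdeg (\<mu> i)) summable_on B m"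
      by (rule summable_on_subset_banach[OF sm]) (auto simp: B_def)
    then show ?thesis by (rule summable_on_cong[THEN iffD1, rotated]) (auto simp: B_def)
  qed
  have c_le: "norm (c m) * r ^ mdeg m \<le> (\<Sum>\<^sub>\<infinity>i\<in>B m. norm (e i) * r ^ mdeg m)" for m
  proof (cases "r = 0 \<and> mdeg m > 0")
    case True then show ?thesis by (auto simp: c_def intro!: infsum_nonneg)
  next
    case False
    then have pos: "r ^ mdeg m > 0" using r by (cases "r = 0") auto
    have "(\<lambda>i. norm (e i)) summable_on B m"
      using smB[of m] pos by (metis less_irrefl summable_on_cmult_left')
    then have "norm (c m) \<le> (\<Sum>\<^sub>\<infinity>i\<in>B m. norm (e i))"
      using False norm_infsum_bound[of e "B m"] by (auto simp: c_def)
    then show ?thesis using pos by (simp add: infsum_cmult_left')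
  qed
  have hs1: "((\<lambda>m. \<Sum>\<^sub>\<infinity>i\<in>B m. norm (e i) * r ^ mdeg m) has_sum
                (\<Sum>\<^sub>\<infinity>i\<in>I. norm (e i) * r ^ mdeg (\<mu> i))) UNIV"
  proof (rule has_sum_SigmaD)
    show "((\<lambda>p. norm (e (snd p)) * r ^ mdeg (\<mu> (snd p))) has_sum
            (\<Sum>\<^sub>\<infinity>i\<in>I. norm (e i) * r ^ mdeg (\<mu> i))) (Sigma UNIV B)"
      using has_sum_reindex_bij_betw[OF bij, of "\<lambda>i. norm (e i) * r ^ mdeg (\<mu> i)"] sm by simp
    show "((\<lambda>y. norm (e (snd (m, y))) * r ^ mdeg (\<mu> (snd (m, y)))) has_sum
            (\<Sum>\<^sub>\<infinity>i\<in>B m. norm (e i) * r ^ mdeg m)) (B m)" for m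
      using smB[of m] by (subst has_sum_cong[where g = "\<lambda>i. norm (e i) * r ^ mdeg m"])
         (auto simp: B_def)
  qed
  have smc: "(\<lambda>m. norm (c m) * r ^ mdeg m) summable_on UNIV"
    by (rule summable_on_comparison_test[OF has_sum_imp_summable[OF hs1]])
       (use c_le r in auto)
  have "wsum r c \<le> C"
    unfolding wsum_def
    by (rule order_trans[OF infsum_mono[OF smc has_sum_imp_summable[OF hs1] c_le]])
       (use le hs1 infsumI in force)
  moreover have "((\<lambda>m. c m * mpow x m) has_sum f x) UNIV" if x: "x \<in> polydisc r" for x
  proof (rule has_sum_SigmaD)
    have "(\<lambda>i. e i * mpow x (\<mu> i)) summable_on I"
      by (rule abs_summable_summable[OF abs_summable_terms[OF sm x]])
    then show "((\<lambda>p. e (snd p) * mpow x (\<mu> (snd p))) has_sum f x) (Sigma UNIV B)"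
      using has_sum_reindex_bij_betw[OF bij, of "\<lambda>i. e i * mpow x (\<mu> i)"] f[OF x] by simp
    show "((\<lambda>y. e (snd (m, y)) * mpow x (\<mu> (snd (m, y)))) has_sum c m * mpow x m) (B m)" for m
    proof (cases "r = 0 \<and> mdeg m > 0")
      case True
      then have "mpow x m = 0" using norm_mpow_le[OF x, of m] by (simp add: power_0_left)
      then show ?thesis by (auto simp: B_def intro!: has_sum_0)
    next
      case False
      then have pos: "r ^ mdeg m > 0" using r by (cases "r = 0") auto
      have "(\<lambda>i. norm (e i)) summable_on B m"
        using smB[of m] pos by (metis less_irrefl summable_on_cmult_left')
      then have "e summable_on B m" by (rule abs_summable_summable)
      then have "((\<lambda>i. e i * mpow x m) has_sum c m * mpow x m) (B m)"
        using False by (intro has_sum_cmult_left) (auto simp: c_def)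
      then show ?thesis by (rule has_sum_cong[THEN iffD1, rotated]) (auto simp: B_def)
    qed
  qed
  ultimately show ?thesis using smc unfolding majorized_def power_series_def by blast
qed

lemma majorized_cong:
  assumes "majorized r C f" "\<And>x. x \<in> polydisc r \<Longrightarrow> f x = g x"
  shows "majorized r C g"
  using assms unfolding majorized_def power_series_def by fastforce

lemma majorized_weaken: "majorized r C f \<Longrightarrow> C \<le> D \<Longrightarrow> majorized r D f"
  unfolding majorized_def by force

lemma majorized_monom:
  assumes "0 \<le> r"
  shows "majorized r (norm a * r ^ mdeg m) (\<lambda>x. a * mpow x m)"
  by (rule majorized_regroup[where I = "{()}" and e = "\<lambda>_. a" and \<mu> = "\<lambda>_. m"]) (use assms in auto)

lemma majorized_const: "0 \<le> r \<Longrightarrow> majorized r (norm a) (\<lambda>x. a)"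
  using majorized_monom[of r a "\<lambda>_. 0"] by (simp add: mpow_def mdeg_def)

lemma majorized_coord: "0 \<le> r \<Longrightarrow> majorized r r (\<lambda>x. x $ i)"
  using majorized_monom[of r 1 "\<lambda>j. if j = i then 1 else 0"]
  by (simp add: mpow_def mdeg_def if_distrib[of "\<lambda>n. _ ^ n"] prod.delta cong: if_cong)

lemma majorized_infsum:
  fixes f :: "'i \<Rightarrow> 'k::analytic_scalar ^ 'n \<Rightarrow> 'k"
  assumes r: "0 \<le> r" and f: "\<And>j. j \<in> J \<Longrightarrow> majorized r (C j) (f j)" and C: "C summable_on J"
  shows "majorized r (infsum C J) (\<lambda>x. \<Sum>\<^sub>\<infinity>j\<in>J. f j x)"
proof -
  obtain c where c: "\<And>j. j \<in> J \<Longrightarrow> power_series r (c j) (f j) \<and> wsum r (c j) \<le> C j"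
    using f unfolding majorized_def by metis
  define e where "e = (\<lambda>(j, m). c j m)"
  have cs: "(\<lambda>m. norm (c j m) * r ^ mdeg m) summable_on UNIV" if "j \<in> J" for j
    using c[OF that] unfolding power_series_def by blast
  have wC: "(\<lambda>j. wsum r (c j)) summable_on J"
    by (rule summable_on_comparison_test[OF C]) (use c wsum_nonneg[OF r] in auto)
  have sm: "(\<lambda>p. norm (e p) * r ^ mdeg (snd p)) summable_on (J \<times> UNIV)"
    by (rule summable_on_SigmaI[where g = "\<lambda>j. wsum r (c j)"])
       (use cs wC r in \<open>auto simp: e_def wsum_def\<close>)
  show ?thesis
  proof (rule majorized_regroup[OF r sm])
    have "(\<Sum>\<^sub>\<infinity>p\<in>J \<times> UNIV. norm (e p) * r ^ mdeg (snd p)) = (\<Sum>\<^sub>\<infinity>j\<in>J. wsum r (c j))"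
      using infsum_Sigma_banach[OF sm] by (simp add: e_def wsum_def)
    also have "\<dots> \<le> infsum C J"
      by (rule infsum_mono[OF wC C]) (use c in auto)
    finally show "(\<Sum>\<^sub>\<infinity>p\<in>J \<times> UNIV. norm (e p) * r ^ mdeg (snd p)) \<le> infsum C J" .
    fix x :: "'k ^ 'n" assume x: "x \<in> polydisc r"
    have "(\<Sum>\<^sub>\<infinity>p\<in>J \<times> UNIV. e p * mpow x (snd p)) = (\<Sum>\<^sub>\<infinity>j\<in>J. \<Sum>\<^sub>\<infinity>m. e (j, m) * mpow x m)"
      using infsum_Sigma_banach[OF abs_summable_summable[OF abs_summable_terms[OF sm x]]] by simp
    also have "\<dots> = (\<Sum>\<^sub>\<infinity>j\<in>J. f j x)"
      by (rule infsum_cong) (use c x in \<open>auto simp: e_def power_series_def dest!: infsumI\<close>)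
    finally show "(\<Sum>\<^sub>\<infinity>j\<in>J. f j x) = (\<Sum>\<^sub>\<infinity>p\<in>J \<times> UNIV. e p * mpow x (snd p))" by simp
  qed
qed

lemma majorized_sum:
  assumes "0 \<le> r" "finite J" "\<And>j. j \<in> J \<Longrightarrow> majorized r (C j) (f j)"
  shows "majorized r (sum C J) (\<lambda>x. \<Sum>j\<in>J. f j x)"
  using majorized_infsum[of r J C f] assms by simp

lemma majorized_add:
  assumes "0 \<le> r" "majorized r C f" "majorized r D g"
  shows "majorized r (C + D) (\<lambda>x. f x + g x)"
  using majorized_sum[of r "UNIV::bool set" "\<lambda>b. if b then C else D" "\<lambda>b. if b then f else g"] assms
  by (simp add: UNIV_bool add.commute)

lemma majorized_mult:
  fixes f g :: "'k::analytic_scalar ^ 'n \<Rightarrow> 'k"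
  assumes r: "0 \<le> r" and f: "majorized r C f" and g: "majorized r D g"
  shows "majorized r (C * D) (\<lambda>x. f x * g x)"
proof -
  obtain c d where c: "power_series r c f" "wsum r c \<le> C" and d: "power_series r d g" "wsum r d \<le> D"
    using f g unfolding majorized_def by blast
  define e where "e = (\<lambda>(m, n). c m * d n)"
  define \<mu> :: "('n \<Rightarrow> nat) \<times> ('n \<Rightarrow> nat) \<Rightarrow> 'n \<Rightarrow> nat" where "\<mu> = (\<lambda>(m, n) i. m i + n i)"
  have eq: "norm (e (m, n)) * r ^ mdeg (\<mu> (m, n)) = (norm (c m) * r ^ mdeg m) * (norm (d n) * r ^ mdeg n)" for m n
    by (simp add: e_def \<mu>_def mdeg_add norm_mult power_add)
  have cs: "(\<lambda>m. norm (c m) * r ^ mdeg m) summable_on UNIV" "(\<lambda>m. norm (d m) * r ^ mdeg m) summable_on UNIV"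
    using c d unfolding power_series_def by auto
  have sm: "(\<lambda>p. norm (e p) * r ^ mdeg (\<mu> p)) summable_on (UNIV \<times> UNIV)"
    by (rule summable_on_SigmaI[where g = "\<lambda>m. (norm (c m) * r ^ mdeg m) * wsum r d"])
       (use cs r in \<open>auto simp: eq wsum_def intro!: has_sum_cmult_right summable_on_cmult_left\<close>)
  show ?thesis
  proof (rule majorized_regroup[OF r sm])
    have "(\<Sum>\<^sub>\<infinity>p\<in>UNIV \<times> UNIV. norm (e p) * r ^ mdeg (\<mu> p)) = wsum r c * wsum r d"
      using infsum_Sigma_banach[OF sm, symmetric]
      by (simp add: eq wsum_def infsum_cmult_left' infsum_cmult_right')
    also have "\<dots> \<le> C * D"
      by (rule mult_mono) (use c d wsum_nonneg[OF r] order_trans in \<open>blast+\<close>)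
    finally show "(\<Sum>\<^sub>\<infinity>p\<in>UNIV \<times> UNIV. norm (e p) * r ^ mdeg (\<mu> p)) \<le> C * D" .
    fix x :: "'k ^ 'n" assume x: "x \<in> polydisc r"
    have "(\<Sum>\<^sub>\<infinity>p\<in>UNIV \<times> UNIV. e p * mpow x (\<mu> p)) = (\<Sum>\<^sub>\<infinity>m. \<Sum>\<^sub>\<infinity>n. (c m * mpow x m) * (d n * mpow x n))"
      using infsum_Sigma_banach[OF abs_summable_summable[OF abs_summable_terms[OF sm x]], symmetric]
      by (simp add: e_def \<mu>_def mpow_add mult_ac)
    also have "\<dots> = f x * g x"
      using c d x by (auto simp: power_series_def infsum_cmult_left' infsum_cmult_right' dest!: bspec infsumI)
    finally show "f x * g x = (\<Sum>\<^sub>\<infinity>p\<in>UNIV \<times> UNIV. e p * mpow x (\<mu> p))" by simp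
  qed
qed

lemma majorized_cmult: "0 \<le> r \<Longrightarrow> majorized r C f \<Longrightarrow> majorized r (norm a * C) (\<lambda>x. a * f x)"
  by (rule majorized_mult[OF _ majorized_const])

lemma majorized_diff:
  assumes "0 \<le> r" "majorized r C f" "majorized r D g"
  shows "majorized r (C + D) (\<lambda>x. f x - g x)"
  using majorized_add[OF assms(1,2) majorized_cmult[OF assms(1,3), of "-1"]] by simp

lemma majorized_power:
  assumes "0 \<le> r" "majorized r C f"
  shows "majorized r (C ^ k) (\<lambda>x. f x ^ k)"
proof (induction k)
  case 0
  show ?case using majorized_const[OF assms(1), of 1] by simp
next
  case (Suc k)
  show ?case using majorized_mult[OF assms Suc] by simp
qed

lemma majorized_prod:
  assumes "0 \<le> r" "finite J" "\<And>j. j \<in> J \<Longrightarrow> majorized r (C j) (f j)"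
  shows "majorized r (prod C J) (\<lambda>x. \<Prod>j\<in>J. f j x)"
  using assms(2,3)
proof (induction J)
  case empty
  show ?case using majorized_const[OF assms(1), of 1] by simp
next
  case (insert j J)
  then show ?case using majorized_mult[OF assms(1), of "C j" "f j" "prod C J"] by simp
qed

lemma majorized_mpow:
  assumes "0 \<le> r" "\<And>i. majorized r R (\<lambda>x. \<phi> x $ i)"
  shows "majorized r (R ^ mdeg m) (\<lambda>x. mpow (\<phi> x) m)"
  using majorized_prod[OF assms(1) _ majorized_power[OF assms(1) assms(2)], of UNIV m "\<lambda>i. i"]
  by (simp add: mpow_def mdeg_def power_sum)

lemma majorized_compose_polydisc:
  "0 \<le> r \<Longrightarrow> (\<And>i. majorized r R (\<lambda>x. \<phi> x $ i)) \<Longrightarrow> x \<in> polydisc r \<Longrightarrow> \<phi> x \<in> polydisc R"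
  using majorized_norm_le unfolding polydisc_def[of R] by blast

text \<open>
  Substitution is termwise: each monomial of the outer series becomes a product of the inner
  series, with majorant the corresponding power of the outer radius.
\<close>

lemma majorized_compose:
  assumes r: "0 \<le> r" and f: "majorized R C f" and \<phi>: "\<And>i. majorized r R (\<lambda>x. \<phi> x $ i)"
  shows "majorized r C (\<lambda>x. f (\<phi> x))"
proof -
  obtain c where c: "power_series R c f" "wsum R c \<le> C" using f unfolding majorized_def by blast
  have "majorized r (infsum (\<lambda>m. norm (c m) * R ^ mdeg m) UNIV) (\<lambda>x. \<Sum>\<^sub>\<infinity>m. c m * mpow (\<phi> x) m)"
    by (rule majorized_infsum[OF r majorized_cmult[OF r majorized_mpow[OF r \<phi>]]])
       (use c in \<open>auto simp: power_series_def\<close>)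
  then have "majorized r C (\<lambda>x. \<Sum>\<^sub>\<infinity>m. c m * mpow (\<phi> x) m)"
    by (rule majorized_weaken) (use c in \<open>simp add: wsum_def\<close>)
  then show ?thesis
    by (rule majorized_cong)
       (use c majorized_compose_polydisc[OF r \<phi>] in \<open>auto simp: power_series_def infsumI\<close>)
qed

lemma power_series_smaller:
  assumes "power_series R c f" "0 \<le> r" "r \<le> R"
  shows "power_series r c f" "wsum r c \<le> wsum R c"
proof -
  have R: "(\<lambda>m. norm (c m) * R ^ mdeg m) summable_on UNIV" using assms unfolding power_series_def by blast
  have le: "norm (c m) * r ^ mdeg m \<le> norm (c m) * R ^ mdeg m" for m
    using assms by (simp add: mult_left_mono power_mono)
  have sm: "(\<lambda>m. norm (c m) * r ^ mdeg m) summable_on UNIV"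
    by (rule summable_on_comparison_test[OF R]) (use le assms in auto)
  then show "power_series r c f"
    using assms polydisc_mono[OF assms(3)] unfolding power_series_def by blast
  show "wsum r c \<le> wsum R c" unfolding wsum_def by (rule infsum_mono[OF sm R le])
qed

text \<open>
  Every remaining term gains at least the factor \<open>(r / R)\<^sup>k\<close>. The case \<open>k = 1\<close> makes series
  without constant term small, the case \<open>k = 2\<close> bounds the remainder of the linear approximation.
\<close>

lemma majorized_shrink:
  assumes f: "power_series R c f" and r: "0 \<le> r" "r \<le> R" "0 < R"
    and c: "\<And>m. mdeg m < k \<Longrightarrow> c m = 0"
  shows "majorized r ((r / R) ^ k * wsum R c) f"
proof -
  have le: "norm (c m) * r ^ mdeg m \<le> (r / R) ^ k * (norm (c m) * R ^ mdeg m)" for m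
  proof (cases "mdeg m < k")
    case False
    have "r ^ mdeg m = (r / R) ^ mdeg m * R ^ mdeg m" using r by (simp add: power_divide)
    also have "\<dots> \<le> (r / R) ^ k * R ^ mdeg m"
      using r False by (intro mult_right_mono power_decreasing) auto
    finally show ?thesis by (metis mult.left_commute mult_left_mono norm_ge_zero)
  qed (simp add: c)
  have R: "(\<lambda>m. norm (c m) * R ^ mdeg m) summable_on UNIV" using f unfolding power_series_def by blast
  have "wsum r c \<le> (\<Sum>\<^sub>\<infinity>m. (r / R) ^ k * (norm (c m) * R ^ mdeg m))"
    unfolding wsum_def
    by (rule infsum_mono[OF _ summable_on_cmult_right[OF R] le])
       (use power_series_smaller[OF f r(1,2)] in \<open>auto simp: power_series_def\<close>)
  then show ?thesis
    using power_series_smaller[OF f r(1,2)] by (auto simp: majorized_def infsum_cmult_right' wsum_def)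
qed

section \<open>Derivatives and primitives of power series\<close>

definition pd_coeffs :: "'n \<Rightarrow> (('n \<Rightarrow> nat) \<Rightarrow> 'k::analytic_scalar) \<Rightarrow> ('n \<Rightarrow> nat) \<Rightarrow> 'k" where
  "pd_coeffs i c m = of_nat (m i + 1) * c (m(i := m i + 1))"

definition primitive_coeffs :: "'n \<Rightarrow> (('n \<Rightarrow> nat) \<Rightarrow> 'k::analytic_scalar) \<Rightarrow> ('n \<Rightarrow> nat) \<Rightarrow> 'k" where
  "primitive_coeffs i c m = (if m i = 0 then 0 else c (m(i := m i - 1)) / of_nat (m i))"

lemma pd_coeffs_commute: "pd_coeffs i (pd_coeffs j c) = pd_coeffs j (pd_coeffs i c)"
  by (cases "i = j") (auto simp: pd_coeffs_def fun_eq_iff fun_upd_twist)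

lemma pd_coeffs_primitive: "pd_coeffs i (primitive_coeffs i c) = (c :: _ \<Rightarrow> 'k::analytic_scalar)"
proof -
  have "of_nat (n + 1) \<noteq> (0::'k)" for n by (metis Suc_eq_plus1 of_nat_neq_0)
  then show ?thesis by (auto simp: pd_coeffs_def primitive_coeffs_def fun_eq_iff simp del: of_nat_add)
qed

lemma mpow_remove: "mpow x m = (x $ i) ^ m i * (\<Prod>j\<in>UNIV - {i}. (x $ j) ^ m j)"
  unfolding mpow_def by (rule prod.remove) auto

lemma mdeg_remove: "mdeg m = m i + (\<Sum>j\<in>UNIV - {i}. m j)"
  unfolding mdeg_def by (rule sum.remove) auto

lemma has_sum_shift:
  fixes F :: "('n \<Rightarrow> nat) \<Rightarrow> 'a::{comm_monoid_add,topological_space}"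
  assumes "\<And>m. m i = 0 \<Longrightarrow> F m = 0"
  shows "((\<lambda>m. F (m(i := m i + 1))) has_sum s) UNIV \<longleftrightarrow> (F has_sum s) UNIV"
proof -
  have "((\<lambda>m. F (m(i := m i + 1))) has_sum s) UNIV \<longleftrightarrow> (F has_sum s) {m. m i > 0}"
    by (rule has_sum_reindex_bij_witness[where i = "\<lambda>m. m(i := m i - 1)" and j = "\<lambda>m. m(i := m i + 1)"])
       (auto simp: fun_eq_iff)
  also have "\<dots> \<longleftrightarrow> (F has_sum s) UNIV"
    by (rule has_sum_cong_neutral) (use assms in auto)
  finally show ?thesis .
qed

lemma square_power_bound:
  fixes S R :: real
  assumes "0 < S" "S < R"
  obtains K where "K > 0" "\<And>n. real n ^ 2 * S ^ n \<le> K * R ^ n" "\<And>n. real n * S ^ n \<le> K * R ^ n"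
proof -
  define q where "q = sqrt (R / S)"
  have q: "q > 1" "q ^ 2 = R / S" using assms by (auto simp: q_def)
  define \<delta> where "\<delta> = q - 1"
  have \<delta>: "\<delta> > 0" using q by (simp add: \<delta>_def)
  have n: "real n \<le> q ^ n / \<delta>" for n
    using Bernoulli_inequality[of \<delta> n] \<delta> by (simp add: \<delta>_def field_simps)
  have *: "real n ^ 2 * S ^ n \<le> 1 / \<delta> ^ 2 * R ^ n" for n
  proof -
    have "real n ^ 2 * S ^ n \<le> (q ^ n / \<delta>) ^ 2 * S ^ n"
      using n[of n] assms by (intro mult_right_mono power_mono) auto
    also have "\<dots> = 1 / \<delta> ^ 2 * ((q ^ 2) ^ n * S ^ n)"
      by (simp add: power_divide power_mult[symmetric] mult.commute)
    also have "(q ^ 2) ^ n * S ^ n = R ^ n"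
      using assms q by (simp add: power_mult_distrib[symmetric])
    finally show ?thesis .
  qed
  moreover have "real n * S ^ n \<le> 1 / \<delta> ^ 2 * R ^ n" for n
  proof -
    have "real n \<le> real n ^ 2" by (cases n) (auto simp: power2_eq_square)
    then have "real n * S ^ n \<le> real n ^ 2 * S ^ n" using assms by (intro mult_right_mono) auto
    then show ?thesis using *[of n] by linarith
  qed
  ultimately show ?thesis using that[of "1 / \<delta> ^ 2"] \<delta> by simp
qed

lemma monom_difference_bound:
  fixes x :: "'k::analytic_scalar ^ 'n"
  assumes S: "x \<in> polydisc S" "x + axis i h \<in> polydisc S" "0 < S" "S \<le> R" and h: "h \<noteq> 0"
    and K: "\<And>n. real n ^ 2 * S ^ n \<le> K * R ^ n"
  shows "norm ((mpow (x + axis i h) m - mpow x m) / h - of_nat (m i) * mpow x (m(i := m i - 1)))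
           \<le> norm h * (K / S ^ 2 * R ^ mdeg m)"
proof -
  define P where "P = (\<Prod>j\<in>UNIV - {i}. (x $ j) ^ m j)"
  define d where "d = (\<Sum>j\<in>UNIV - {i}. m j)"
  define n where "n = m i"
  have "norm P \<le> (\<Prod>j\<in>UNIV - {i}. R ^ m j)"
    unfolding P_def prod_norm[symmetric] norm_power
    by (rule prod_mono) (use S in \<open>auto simp: polydisc_def intro!: power_mono order_trans[of _ S R]\<close>)
  then have P: "norm P \<le> R ^ d" by (simp add: d_def power_sum)
  have 1: "mpow (x + axis i h) m = (x $ i + h) ^ n * P"
    unfolding mpow_remove[of _ m i] P_def n_def
    by (auto simp: axis_def intro!: prod.cong)
  have 2: "mpow x m = (x $ i) ^ n * P" unfolding mpow_remove[of _ m i] P_def n_def ..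
  have 3: "mpow x (m(i := m i - 1)) = (x $ i) ^ (n - 1) * P"
    unfolding mpow_remove[of _ _ i] P_def n_def by (auto intro!: prod.cong)
  have "norm (x $ i) \<le> S" "norm (x $ i + h) \<le> S"
    using S(1,2) by (auto simp: polydisc_def axis_def dest: spec[of _ i])
  then have "norm (((x $ i + h) ^ n - (x $ i) ^ n) / h - of_nat n * (x $ i) ^ (n - Suc 0))
         \<le> real n * real (n - Suc 0) * S ^ (n - 2) * norm h"
    using lemma_termdiff3[OF h, of "x $ i" S n] by simp
  also have "real n * real (n - Suc 0) * S ^ (n - 2) \<le> K / S ^ 2 * R ^ n"
  proof (cases "n \<ge> 2")
    case True
    have "real n * real (n - Suc 0) * S ^ (n - 2) \<le> real n ^ 2 * S ^ (n - 2)"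
      using S by (intro mult_right_mono) (auto simp: power2_eq_square intro!: mult_left_mono)
    also have "\<dots> = real n ^ 2 * S ^ n / S ^ 2"
      using True S by (simp add: power_diff)
    also have "\<dots> \<le> K * R ^ n / S ^ 2" using K S by (intro divide_right_mono) auto
    finally show ?thesis by simp
  next
    case False
    then have "n = 0 \<or> n = 1" by auto
    moreover have "0 \<le> K * R ^ n" using K[of n] S by (meson mult_nonneg_nonneg less_imp_le order_trans zero_le_power zero_le_power2)
    ultimately show ?thesis using S by (auto simp: divide_simps)
  qed
  finally have *: "norm (((x $ i + h) ^ n - (x $ i) ^ n) / h - of_nat n * (x $ i) ^ (n - Suc 0))
         \<le> K / S ^ 2 * R ^ n * norm h" using h by (simp add: mult_right_mono)
  have "(mpow (x + axis i h) m - mpow x m) / h - of_nat (m i) * mpow x (m(i := m i - 1))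
      = (((x $ i + h) ^ n - (x $ i) ^ n) / h - of_nat n * (x $ i) ^ (n - Suc 0)) * P"
    unfolding 1 2 3 by (simp add: n_def field_simps)
  then have "norm ((mpow (x + axis i h) m - mpow x m) / h - of_nat (m i) * mpow x (m(i := m i - 1)))
      \<le> K / S ^ 2 * R ^ n * norm h * R ^ d"
    using mult_mono[OF * P order_trans[OF norm_ge_zero *] norm_ge_zero] by (simp only: norm_mult)
  then show ?thesis by (simp add: mdeg_remove[of m i] n_def d_def power_add mult_ac)
qed

lemma pd_coeffs_summable:
  fixes c :: "('n::finite \<Rightarrow> nat) \<Rightarrow> 'k::analytic_scalar"
  assumes c: "(\<lambda>m. norm (c m) * R ^ mdeg m) summable_on UNIV" and r: "0 < r" "r < R"
  shows "(\<lambda>m. norm (pd_coeffs i c m) * r ^ mdeg m) summable_on UNIV"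
proof -
  obtain K where K: "K > 0" "\<And>n. real n * r ^ n \<le> K * R ^ n" using square_power_bound[OF r] by metis
  define F where "F m = norm (c m) * (real (m i) * r ^ mdeg m / r)" for m
  have le: "F m \<le> K / r * (norm (c m) * R ^ mdeg m)" for m
  proof -
    have "real (m i) * r ^ mdeg m = (real (m i) * r ^ m i) * r ^ (\<Sum>j\<in>UNIV - {i}. m j)"
      by (simp add: mdeg_remove[of m i] power_add)
    also have "\<dots> \<le> (K * R ^ m i) * R ^ (\<Sum>j\<in>UNIV - {i}. m j)"
      using K r by (intro mult_mono power_mono K(2)) auto
    also have "\<dots> = K * R ^ mdeg m" by (simp add: mdeg_remove[of m i] power_add)
    finally have "real (m i) * r ^ mdeg m / r \<le> K * R ^ mdeg m / r" using r by (simp add: divide_right_mono)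
    then have "F m \<le> norm (c m) * (K * R ^ mdeg m / r)" unfolding F_def by (rule mult_left_mono) simp
    then show ?thesis by (simp add: mult_ac)
  qed
  have "F summable_on UNIV"
    by (rule summable_on_comparison_test[OF summable_on_cmult_right[OF c, of "K / r"]])
       (use le r in \<open>auto simp: F_def\<close>)
  then obtain s where "(F has_sum s) UNIV" by (auto simp: summable_on_def)
  then have "((\<lambda>m. F (m(i := m i + 1))) has_sum s) UNIV"
    by (subst has_sum_shift) (auto simp: F_def)
  moreover have "F (m(i := m i + 1)) = norm (pd_coeffs i c m) * r ^ mdeg m" for m
  proof -
    have "mdeg (m(i := m i + 1)) = Suc (mdeg m)"
      by (simp add: mdeg_remove[of _ i] cong: sum.cong_simp)
    moreover have "norm (of_nat (m i + 1) :: 'k) = real (m i + 1)" by (rule norm_of_nat)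
    ultimately show ?thesis using r by (simp add: F_def pd_coeffs_def norm_mult del: of_nat_add)
  qed
  ultimately show ?thesis by (auto simp: summable_on_def)
qed

text \<open>
  Termwise differentiation: the difference quotients of the monomials differ from the formal
  derivatives by an amount that is summable against the coefficients and of order \<open>h\<close>.
\<close>

lemma power_series_has_field_derivative:
  fixes f :: "'k::analytic_scalar ^ 'n \<Rightarrow> 'k"
  assumes f: "power_series R c f" and r: "0 < r" "r < R" and x: "x \<in> polydisc r"
  shows "((\<lambda>t. f (x + axis i t)) has_field_derivative (\<Sum>\<^sub>\<infinity>m. pd_coeffs i c m * mpow x m)) (at 0)"
proof -
  define S where "S = (r + R) / 2"
  have S: "0 < S" "r < S" "S < R" using r by (auto simp: S_def)
  obtain K where K: "K > 0" "\<And>n. real n ^ 2 * S ^ n \<le> K * R ^ n"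
    using square_power_bound[OF S(1,3)] by metis
  have sc: "(\<lambda>m. norm (c m) * R ^ mdeg m) summable_on UNIV" using f unfolding power_series_def by blast
  define D where "D = (\<Sum>\<^sub>\<infinity>m. pd_coeffs i c m * mpow x m)"
  define G where "G m = c m * (of_nat (m i) * mpow x (m(i := m i - 1)))" for m
  have "((\<lambda>m. pd_coeffs i c m * mpow x m) has_sum D) UNIV"
    unfolding D_def
    by (rule has_sum_infsum, rule abs_summable_summable, rule abs_summable_terms[OF pd_coeffs_summable[OF sc r] x])
  then have D: "(G has_sum D) UNIV"
    using has_sum_shift[of i G D] by (simp add: G_def pd_coeffs_def mult_ac)
  define M where "M = K / S ^ 2 * wsum R c"
  have bound: "norm ((f (x + axis i h) - f x) / h - D) \<le> norm h * M" if h: "h \<noteq> 0" "norm h < S - r" for h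
  proof -
    have xS: "x \<in> polydisc S" using x S polydisc_mono[of r S] by auto
    have "norm ((x + axis i h) $ j) \<le> S" for j
    proof -
      have "norm ((x + axis i h) $ j) \<le> norm (x $ j) + norm (axis i h $ j)"
        by (simp add: norm_triangle_ineq)
      also have "norm (axis i h $ j) \<le> norm h" by (simp add: axis_def)
      finally show ?thesis using h x by (auto simp: polydisc_def dest!: spec[of _ j])
    qed
    then have xh: "x + axis i h \<in> polydisc S" by (simp add: polydisc_def)
    have hs: "((\<lambda>m. c m * mpow y m) has_sum f y) UNIV" if "y \<in> polydisc S" for y
      using f that polydisc_mono[of S R] S unfolding power_series_def by auto
    have "((\<lambda>m. (c m * mpow (x + axis i h) m + (-1) * (c m * mpow x m)) * (1 / h) + (-1) * G m)
             has_sum (f (x + axis i h) + (-1) * f x) * (1 / h) + (-1) * D) UNIV"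
      by (intro has_sum_add has_sum_cmult_left has_sum_cmult_right hs[OF xh] hs[OF xS] D)
    then have e: "((\<lambda>m. c m * ((mpow (x + axis i h) m - mpow x m) / h - of_nat (m i) * mpow x (m(i := m i - 1))))
             has_sum (f (x + axis i h) - f x) / h - D) UNIV" (is "(?E has_sum _) _")
      by (simp add: G_def algebra_simps diff_divide_distrib)
    have le: "norm (?E m) \<le> norm h * (K / S ^ 2) * (norm (c m) * R ^ mdeg m)" for m
      using mult_left_mono[OF monom_difference_bound[OF xS xh S(1) less_imp_le[OF S(3)] h(1) K(2), of m], of "norm (c m)"]
      by (simp add: norm_mult mult_ac)
    have sE: "(\<lambda>m. norm (?E m)) summable_on UNIV"
      by (rule Infinite_Sum.abs_summable_on_comparison_test'[OF summable_on_cmult_right[OF sc, of "norm h * (K / S ^ 2)"]])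
         (use le in auto)
    have "norm ((f (x + axis i h) - f x) / h - D) \<le> (\<Sum>\<^sub>\<infinity>m. norm (?E m))"
      using norm_infsum_bound[OF sE] infsumI[OF e] by simp
    also have "\<dots> \<le> (\<Sum>\<^sub>\<infinity>m. norm h * (K / S ^ 2) * (norm (c m) * R ^ mdeg m))"
      by (rule infsum_mono[OF sE summable_on_cmult_right[OF sc] le])
    also have "\<dots> = norm h * M" by (subst infsum_cmult_right') (simp add: M_def wsum_def)
    finally show ?thesis .
  qed
  have "((\<lambda>h. (f (x + axis i h) - f x) / h - D) \<longlongrightarrow> 0) (at 0)"
  proof (rule Lim_null_comparison)
    show "((\<lambda>h. norm h * M) \<longlongrightarrow> 0) (at (0::'k))"
      by (rule tendsto_mult_left_zero) (rule tendsto_norm_zero, rule tendsto_ident_at)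
    show "eventually (\<lambda>h. norm ((f (x + axis i h) - f x) / h - D) \<le> norm h * M) (at (0::'k))"
      unfolding eventually_at using bound S by (intro exI[of _ "S - r"]) (auto simp: dist_norm)
  qed
  then have "((\<lambda>h. (f (x + axis i h) - f x) / h) \<longlongrightarrow> D) (at 0)" by (rule LIM_zero_cancel)
  then show ?thesis by (simp add: has_field_derivative_iff D_def axis_def[of i 0] zero_vec_def[symmetric])
qed

lemma pd_eqI: "((\<lambda>t. f (q + axis i t)) has_field_derivative d) (at 0) \<Longrightarrow> pd i f q = d"
  unfolding pd_def by (rule DERIV_imp_deriv)

lemma power_series_pd:
  assumes f: "power_series R c f" and r: "0 < r" "r < R"
  shows "power_series r (pd_coeffs i c) (pd i f)"
proof -
  have sm: "(\<lambda>m. norm (pd_coeffs i c m) * r ^ mdeg m) summable_on UNIV"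
    using f unfolding power_series_def by (intro pd_coeffs_summable[OF _ r]) auto
  have "((\<lambda>m. pd_coeffs i c m * mpow x m) has_sum pd i f x) UNIV" if x: "x \<in> polydisc r" for x
    unfolding pd_eqI[OF power_series_has_field_derivative[OF f r x]]
    by (rule has_sum_infsum, rule abs_summable_summable, rule abs_summable_terms[OF sm x])
  then show ?thesis unfolding power_series_def using sm by blast
qed

lemma power_series_unique:
  "power_series r c f \<Longrightarrow> power_series r c g \<Longrightarrow> x \<in> polydisc r \<Longrightarrow> f x = g x"
  unfolding power_series_def using has_sum_unique by blast

text \<open>Every monomial of the primitive contains the variable of integration, whence the normalization.\<close>

lemma power_series_primitive:
  fixes f :: "'k::analytic_scalar ^ 'n \<Rightarrow> 'k"
  assumes f: "power_series R c f" and R: "0 \<le> R"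
  obtains P where "power_series R (primitive_coeffs i c) P" "\<And>x. x $ i = 0 \<Longrightarrow> P x = 0"
proof -
  have sc: "(\<lambda>m. norm (c m) * R ^ mdeg m) summable_on UNIV" using f unfolding power_series_def by blast
  define F where "F m = norm (primitive_coeffs i c m) * R ^ mdeg m" for m
  have F: "norm (F (m(i := m i + 1))) \<le> R * (norm (c m) * R ^ mdeg m)" for m
  proof -
    have deg: "mdeg (m(i := Suc (m i))) = Suc (mdeg m)"
      by (simp add: mdeg_remove[of _ i] cong: sum.cong_simp)
    have "norm (of_nat (m i + 1) :: 'k) = real (m i + 1)" by (rule norm_of_nat)
    then have "norm (c m / of_nat (m i + 1)) \<le> norm (c m)"
      by (simp add: norm_divide divide_simps mult_le_cancel_left1 del: of_nat_add)
    then show ?thesis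
      using R mult_right_mono[of "norm (c m / of_nat (m i + 1))" "norm (c m)" "R * R ^ mdeg m"]
      by (simp add: F_def deg primitive_coeffs_def mult_ac)
  qed
  have "(\<lambda>m. F (m(i := m i + 1))) summable_on UNIV"
    using Infinite_Sum.abs_summable_on_comparison_test'[OF summable_on_cmult_right[OF sc] F] R
    by (simp add: F_def)
  then obtain s where "((\<lambda>m. F (m(i := m i + 1))) has_sum s) UNIV" by (auto simp: summable_on_def)
  then have "F summable_on UNIV"
    by (subst (asm) has_sum_shift) (auto simp: F_def primitive_coeffs_def summable_on_def)
  then have sm: "(\<lambda>m. norm (primitive_coeffs i c m) * R ^ mdeg m) summable_on UNIV" by (simp add: F_def[abs_def])
  define P where "P x = (\<Sum>\<^sub>\<infinity>m. primitive_coeffs i c m * mpow x m)" for x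
  have "power_series R (primitive_coeffs i c) P"
    unfolding power_series_def P_def
    using sm abs_summable_summable[OF abs_summable_terms[OF sm]] by auto
  moreover have "P x = 0" if "x $ i = 0" for x
    unfolding P_def by (rule infsum_0) (use that in \<open>auto simp: primitive_coeffs_def mpow_remove[of _ _ i]\<close>)
  ultimately show ?thesis using that by blast
qed

section \<open>The calculus of analytic functions\<close>

lemma summable_on_norm_euclidean:
  fixes f :: "'i \<Rightarrow> 'a::euclidean_space"
  assumes "f summable_on A"
  shows "(\<lambda>i. norm (f i)) summable_on A"
proof -
  have "(\<lambda>i. \<bar>f i \<bullet> b\<bar>) summable_on A" for b
    using summable_on_bounded_linear[OF bounded_linear_inner_left[of b] assms]
      summable_on_iff_abs_summable_on_real[of "\<lambda>i. f i \<bullet> b" A] by simp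
  then have "(\<lambda>i. \<Sum>b\<in>B. \<bar>f i \<bullet> b\<bar>) summable_on A" for B
  proof (induction B rule: infinite_finite_induct)
    case (insert b B)
    then show ?case by (simp add: summable_on_add)
  qed simp_all
  then show ?thesis
    by (rule Infinite_Sum.abs_summable_on_comparison_test') (rule norm_le_l1)
qed

lemma kanalytic_at_iff_power_series:
  fixes f :: "'k::analytic_scalar ^ 'n \<Rightarrow> 'k"
  shows "kanalytic_at f p \<longleftrightarrow> (\<exists>r>0. \<exists>c. power_series r c (\<lambda>x. f (p + x)))"
proof
  assume "kanalytic_at f p"
  then obtain c r where r: "0 < r" and
    c: "\<And>q. \<forall>i. norm (q $ i - p $ i) < r \<Longrightarrow>
      ((\<lambda>m. c m * (\<Prod>i\<in>UNIV. (q $ i - p $ i) ^ m i)) has_sum f q) UNIV"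
    unfolding kanalytic_at_def by blast
  have hs: "((\<lambda>m. c m * mpow x m) has_sum f (p + x)) UNIV" if "\<forall>i. norm (x $ i) < r" for x
    using c[of "p + x"] that by (simp add: mpow_def)
  define x0 :: "'k ^ 'n" where "x0 = (\<chi> i. of_real (r / 2))"
  have "(\<lambda>m. c m * mpow x0 m) summable_on UNIV"
    by (rule has_sum_imp_summable, rule hs) (use r in \<open>simp add: x0_def\<close>)
  then have "(\<lambda>m. norm (c m * mpow x0 m)) summable_on UNIV" by (rule summable_on_norm_euclidean)
  moreover have "mpow x0 m = of_real ((r / 2) ^ mdeg m)" for m
    by (simp add: mpow_def x0_def mdeg_def power_sum)
  then have "norm (mpow x0 m) = \<bar>(r / 2) ^ mdeg m\<bar>" for m by (simp only: norm_of_real)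
  then have "norm (mpow x0 m) = (r / 2) ^ mdeg m" for m using r by (simp del: abs_divide)
  ultimately have "(\<lambda>m. norm (c m) * (r / 2) ^ mdeg m) summable_on UNIV" by (simp add: norm_mult)
  moreover have "((\<lambda>m. c m * mpow x m) has_sum f (p + x)) UNIV" if "x \<in> polydisc (r / 2)" for x
  proof (rule hs, rule allI)
    show "norm (x $ i) < r" for i using that r by (auto simp: polydisc_def dest!: spec[of _ i])
  qed
  ultimately have "power_series (r / 2) c (\<lambda>x. f (p + x))" unfolding power_series_def by blast
  then show "\<exists>r>0. \<exists>c. power_series r c (\<lambda>x. f (p + x))" using r by (intro exI[of _ "r / 2"]) auto
next
  assume "\<exists>r>0. \<exists>c. power_series r c (\<lambda>x. f (p + x))"
  then obtain r c where r: "r > 0" and c: "power_series r c (\<lambda>x. f (p + x))" by blast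
  have "((\<lambda>m. c m * (\<Prod>i\<in>UNIV. (q $ i - p $ i) ^ m i)) has_sum f q) UNIV"
    if "\<forall>i. norm (q $ i - p $ i) < r" for q
  proof -
    have "q - p \<in> polydisc r" using that by (auto simp: polydisc_def less_imp_le)
    then have "((\<lambda>m. c m * mpow (q - p) m) has_sum f (p + (q - p))) UNIV"
      using c unfolding power_series_def by blast
    then show ?thesis by (simp add: mpow_def)
  qed
  then show "kanalytic_at f p" unfolding kanalytic_at_def using r by blast
qed

lemma kanalytic_atI: "0 < r \<Longrightarrow> majorized r C (\<lambda>x. f (p + x)) \<Longrightarrow> kanalytic_at f p"
  unfolding kanalytic_at_iff_power_series majorized_def by blast

lemma kanalytic_at_majorized:
  assumes "kanalytic_at f p"
  obtains C where "eventually (\<lambda>r. majorized r C (\<lambda>x. f (p + x))) (at_right 0)"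
proof -
  obtain r c where r: "0 < r" "power_series r c (\<lambda>x. f (p + x))"
    using assms kanalytic_at_iff_power_series by blast
  have "majorized s (wsum r c) (\<lambda>x. f (p + x))" if "0 < s" "s < r" for s
    using that r power_series_smaller[OF r(2), of s] unfolding majorized_def by auto
  then show ?thesis using that[of "wsum r c"] r(1) by (force simp: eventually_at_right_field)
qed

lemma eventually_positive_radius:
  assumes "eventually P (at_right (0::real))"
  obtains r where "0 < r" "P r"
proof -
  obtain b where "b > 0" "\<And>y. 0 < y \<Longrightarrow> y < b \<Longrightarrow> P y"
    using assms unfolding eventually_at_right_field by auto
  then show ?thesis using that[of "b / 2"] by auto
qed

lemma mpow_0: "mpow 0 m = (if mdeg m = 0 then 1 else 0)"
  by (auto simp: mpow_def mdeg_def)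

lemma zero_in_polydisc: "0 \<le> r \<Longrightarrow> 0 \<in> polydisc r"
  by (simp add: polydisc_def)

lemma power_series_at_0:
  assumes "power_series r c f" "0 \<le> r"
  shows "f 0 = c (\<lambda>_. 0)"
proof -
  have "((\<lambda>m. c m * mpow 0 m) has_sum f 0) UNIV"
    using assms zero_in_polydisc unfolding power_series_def by blast
  moreover have "((\<lambda>m. c m * mpow 0 m) has_sum c (\<lambda>_. 0)) UNIV"
    by (rule has_sum_finite_neutralI[where B = "{\<lambda>_. 0}"]) (auto simp: mpow_0 mdeg_def fun_eq_iff)
  ultimately show ?thesis by (rule has_sum_unique)
qed

text \<open>
  This is what allows an analytic map to be substituted into a series that converges only on some
  polydisc, and the geometric series for reciprocals to be summed.
\<close>

lemma kanalytic_at_majorized_small: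
  assumes "kanalytic_at f p" "e > 0"
  shows "eventually (\<lambda>r. majorized r e (\<lambda>x. f (p + x) - f p)) (at_right 0)"
proof -
  obtain R c where R: "0 < R" and c: "power_series R c (\<lambda>x. f (p + x))"
    using assms kanalytic_at_iff_power_series by blast
  define g where "g x = f (p + x) - f p" for x
  define d where "d m = (if mdeg m = 0 then 0 else c m)" for m
  have z: "(\<lambda>m. norm (d m) * R ^ mdeg m) summable_on UNIV"
    by (rule summable_on_comparison_test[of "\<lambda>m. norm (c m) * R ^ mdeg m"])
       (use c R in \<open>auto simp: power_series_def d_def\<close>)
  have "((\<lambda>m. d m * mpow x m) has_sum g x) UNIV" if "x \<in> polydisc R" for x
  proof -
    have "((\<lambda>m. (if mdeg m = 0 then c m else 0)) has_sum c (\<lambda>_. 0)) UNIV"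
      by (rule has_sum_finite_neutralI[where B = "{\<lambda>_. 0}"]) (auto simp: mdeg_def fun_eq_iff)
    then have "((\<lambda>m. c m * mpow x m + (-1) * (if mdeg m = 0 then c m else 0)) has_sum
        f (p + x) + (-1) * c (\<lambda>_. 0)) UNIV"
      using c that unfolding power_series_def by (intro has_sum_add has_sum_cmult_right) auto
    moreover have "c m * mpow x m + (-1) * (if mdeg m = 0 then c m else 0) = d m * mpow x m" for m
      by (auto simp: d_def mpow_def mdeg_def)
    moreover have "f p = c (\<lambda>_. 0)" using power_series_at_0[OF c] R by simp
    ultimately show ?thesis by (simp add: g_def)
  qed
  then have g: "power_series R d g" using z unfolding power_series_def by blast
  have "((\<lambda>r. (r / R) ^ 1 * wsum R d) \<longlongrightarrow> (0 / R) ^ 1 * wsum R d) (at_right 0)"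
    using R by (intro tendsto_intros) auto
  then have "eventually (\<lambda>r. (r / R) ^ 1 * wsum R d < e) (at_right 0)"
    using assms(2) by (intro order_tendstoD(2)) auto
  moreover have "eventually (\<lambda>r. 0 < r \<and> r < R) (at_right 0)"
    using R by (auto simp: eventually_at_right_field)
  ultimately show ?thesis
  proof eventually_elim
    case (elim r)
    have "majorized r ((r / R) ^ 1 * wsum R d) g"
      by (rule majorized_shrink[OF g]) (use elim in \<open>auto simp: d_def\<close>)
    then have "majorized r e g" by (rule majorized_weaken) (use elim in simp)
    then show ?case by (simp add: g_def[abs_def])
  qed
qed

lemma kanalytic_at_const: "kanalytic_at (\<lambda>q. a) p"
  by (rule kanalytic_atI[of 1 "norm a"]) (auto intro: majorized_const)

lemma kanalytic_at_coord: "kanalytic_at (\<lambda>q. q $ i) p"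
  using majorized_add[OF _ majorized_const majorized_coord, of 1 "p $ i" i]
  by (intro kanalytic_atI[of 1]) auto

lemma kanalytic_at_add:
  assumes "kanalytic_at f p" "kanalytic_at g p"
  shows "kanalytic_at (\<lambda>q. f q + g q) p"
proof -
  obtain C D where "eventually (\<lambda>r. majorized r C (\<lambda>x. f (p + x))) (at_right 0)"
    "eventually (\<lambda>r. majorized r D (\<lambda>x. g (p + x))) (at_right 0)"
    using assms kanalytic_at_majorized by metis
  then have "eventually (\<lambda>r. majorized r C (\<lambda>x. f (p + x)) \<and> majorized r D (\<lambda>x. g (p + x))) (at_right 0)"
    by (rule eventually_conj)
  then obtain r where "0 < r" "majorized r C (\<lambda>x. f (p + x))" "majorized r D (\<lambda>x. g (p + x))"
    by (rule eventually_positive_radius) auto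
  then show ?thesis using majorized_add[of r C _ D] by (intro kanalytic_atI[of r "C + D"]) (simp_all add: less_imp_le)
qed

lemma kanalytic_at_mult:
  assumes "kanalytic_at f p" "kanalytic_at g p"
  shows "kanalytic_at (\<lambda>q. f q * g q) p"
proof -
  obtain C D where "eventually (\<lambda>r. majorized r C (\<lambda>x. f (p + x))) (at_right 0)"
    "eventually (\<lambda>r. majorized r D (\<lambda>x. g (p + x))) (at_right 0)"
    using assms kanalytic_at_majorized by metis
  then have "eventually (\<lambda>r. majorized r C (\<lambda>x. f (p + x)) \<and> majorized r D (\<lambda>x. g (p + x))) (at_right 0)"
    by (rule eventually_conj)
  then obtain r where "0 < r" "majorized r C (\<lambda>x. f (p + x))" "majorized r D (\<lambda>x. g (p + x))"
    by (rule eventually_positive_radius) auto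
  then show ?thesis using majorized_mult[of r C _ D] by (intro kanalytic_atI[of r "C * D"]) (simp_all add: less_imp_le)
qed

lemma kanalytic_at_minus: "kanalytic_at f p \<Longrightarrow> kanalytic_at (\<lambda>q. - f q) p"
  using kanalytic_at_mult[OF kanalytic_at_const[of "-1"]] by simp

lemma kanalytic_at_diff:
  "kanalytic_at f p \<Longrightarrow> kanalytic_at g p \<Longrightarrow> kanalytic_at (\<lambda>q. f q - g q) p"
  using kanalytic_at_add[OF _ kanalytic_at_minus, of f p g] by simp

lemma kanalytic_at_sum:
  "(\<And>j. j \<in> J \<Longrightarrow> kanalytic_at (f j) p) \<Longrightarrow> kanalytic_at (\<lambda>q. \<Sum>j\<in>J. f j q) p"
proof (induction J rule: infinite_finite_induct)
  case (insert j J)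
  then show ?case using kanalytic_at_add[of "f j" p "\<lambda>q. \<Sum>j\<in>J. f j q"] by simp
qed (auto intro: kanalytic_at_const)

lemma kanalytic_at_cong:
  assumes "kanalytic_at f p" "eventually (\<lambda>q. f q = g q) (nhds p)"
  shows "kanalytic_at g p"
proof -
  obtain e where e: "e > 0" "\<And>q. dist q p < e \<Longrightarrow> f q = g q"
    using assms(2) unfolding eventually_nhds_metric by blast
  obtain r c where r: "0 < r" and c: "power_series r c (\<lambda>x. f (p + x))"
    using assms(1) kanalytic_at_iff_power_series by blast
  define s where "s = min r (e / (2 * CARD('b)))"
  have s: "0 < s" "s \<le> r" "s \<le> e / (2 * CARD('b))" using r e by (auto simp: s_def)
  have eq: "f (p + x) = g (p + x)" if "x \<in> polydisc s" for x
  proof (rule e(2))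
    have "norm x \<le> (\<Sum>i\<in>UNIV. norm (x $ i))" unfolding norm_vec_def by (rule L2_set_le_sum) simp
    also have "\<dots> \<le> (\<Sum>i\<in>(UNIV::'b set). e / (2 * CARD('b)))"
      by (rule sum_mono) (use that s in \<open>auto simp: polydisc_def intro: order_trans\<close>)
    also have "\<dots> < e" using e by simp
    finally show "dist (p + x) p < e" by (simp add: dist_norm)
  qed
  have "majorized s (wsum r c) (\<lambda>x. f (p + x))"
    using power_series_smaller[OF c, of s] s unfolding majorized_def by auto
  then have "majorized s (wsum r c) (\<lambda>x. g (p + x))" by (rule majorized_cong) (rule eq)
  then show ?thesis by (rule kanalytic_atI[OF s(1)])
qed

lemma kanalytic_at_inverse:
  fixes f :: "'k::analytic_scalar ^ 'n \<Rightarrow> 'k"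
  assumes f: "kanalytic_at f p" and nz: "f p \<noteq> 0"
  shows "kanalytic_at (\<lambda>q. inverse (f q)) p"
proof -
  have "kanalytic_at (\<lambda>q. - inverse (f p) * f q) p"
    by (intro kanalytic_at_mult kanalytic_at_const f)
  from kanalytic_at_majorized_small[OF this, of "1/2"]
  obtain r where r: "0 < r" and
    h: "majorized r (1/2) (\<lambda>x. - inverse (f p) * f (p + x) - (- inverse (f p) * f p))"
    by (auto elim!: eventually_positive_radius)
  define h where "h = (\<lambda>x. 1 - f (p + x) / f p)"
  have h: "majorized r (1/2) h" by (rule majorized_cong[OF h]) (simp add: h_def nz field_simps)
  have "majorized r (infsum (\<lambda>k. (1/2) ^ k) UNIV) (\<lambda>x. \<Sum>\<^sub>\<infinity>k. h x ^ k)"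
  proof (rule majorized_infsum)
    show "(\<lambda>k::nat. (1/2::real) ^ k) summable_on UNIV"
      by (subst summable_on_UNIV_nonneg_real_iff) (auto intro: summable_geometric)
  qed (use r majorized_power[OF _ h] in auto)
  then have *: "majorized r (norm (inverse (f p)) * infsum (\<lambda>k. (1/2) ^ k) UNIV)
                (\<lambda>x. inverse (f p) * (\<Sum>\<^sub>\<infinity>k. h x ^ k))"
    using r by (intro majorized_cmult) auto
  have "majorized r (norm (inverse (f p)) * infsum (\<lambda>k. (1/2) ^ k) UNIV) (\<lambda>x. inverse (f (p + x)))"
  proof (rule majorized_cong[OF *])
    fix x :: "'k ^ 'n" assume "x \<in> polydisc r"
    then have hx: "norm (h x) \<le> 1/2" by (rule majorized_norm_le[OF h])
    have "((\<lambda>k. h x ^ k) has_sum (1 / (1 - h x))) UNIV"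
      by (rule norm_summable_imp_has_sum)
         (use hx in \<open>auto simp: norm_power intro!: summable_geometric geometric_sums\<close>)
    then have "(\<Sum>\<^sub>\<infinity>k. h x ^ k) = 1 / (1 - h x)" by (rule infsumI)
    also have "1 - h x = f (p + x) / f p" by (simp add: h_def)
    finally show "inverse (f p) * (\<Sum>\<^sub>\<infinity>k. h x ^ k) = inverse (f (p + x))"
      using nz by (simp add: field_simps)
  qed
  then show ?thesis by (rule kanalytic_atI[OF r])
qed

lemma kanalytic_at_divide:
  "kanalytic_at f p \<Longrightarrow> kanalytic_at g p \<Longrightarrow> g p \<noteq> 0 \<Longrightarrow> kanalytic_at (\<lambda>q. f q / g q) p"
  using kanalytic_at_mult[OF _ kanalytic_at_inverse, of f p g] by (simp add: divide_inverse)

lemma eventually_all_finite_type: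
  "(\<And>i::'i::finite. eventually (P i) F) \<Longrightarrow> eventually (\<lambda>x. \<forall>i. P i x) F"
  using eventually_ball_finite[of "UNIV :: 'i set" "\<lambda>x i. P i x" F] by simp

lemma kanalytic_at_compose:
  assumes f: "kanalytic_at f (\<phi> p)" and \<phi>: "\<And>i. kanalytic_at (\<lambda>q. \<phi> q $ i) p"
  shows "kanalytic_at (\<lambda>q. f (\<phi> q)) p"
proof -
  obtain R c where R: "0 < R" and c: "power_series R c (\<lambda>x. f (\<phi> p + x))"
    using f kanalytic_at_iff_power_series by blast
  have "eventually (\<lambda>r. \<forall>i. majorized r R (\<lambda>x. \<phi> (p + x) $ i - \<phi> p $ i)) (at_right 0)"
    by (rule eventually_all_finite_type) (rule kanalytic_at_majorized_small[OF \<phi> R])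
  then obtain r where r: "0 < r" and m: "\<And>i. majorized r R (\<lambda>x. (\<phi> (p + x) - \<phi> p) $ i)"
    by (rule eventually_positive_radius) auto
  have "majorized r (wsum R c) (\<lambda>x. f (\<phi> p + (\<phi> (p + x) - \<phi> p)))"
    by (rule majorized_compose[OF _ _ m]) (use r c in \<open>auto simp: majorized_def\<close>)
  then show ?thesis by (intro kanalytic_atI[OF r]) simp
qed

lemma power_series_kanalytic_at:
  assumes f: "power_series R c (\<lambda>x. f (p + x))" and q: "\<And>i. norm (q $ i - p $ i) < R"
  shows "kanalytic_at f q"
proof -
  have "eventually (\<lambda>r. \<forall>i. r < R - norm (q $ i - p $ i)) (at_right (0::real))"
  proof (rule eventually_all_finite_type)
    fix i
    show "eventually (\<lambda>r. r < R - norm (q $ i - p $ i)) (at_right 0)"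
      unfolding eventually_at_right_field using q[of i]
      by (intro exI[of _ "R - norm (q $ i - p $ i)"]) simp
  qed
  then obtain r where r: "0 < r" "\<And>i. r < R - norm (q $ i - p $ i)"
    by (rule eventually_positive_radius) auto
  have "majorized r R (\<lambda>x. ((q - p) + x) $ i)" for i
    using majorized_weaken[OF majorized_add[OF _ majorized_const majorized_coord, of r "q $ i - p $ i" i]]
      r(1) r(2)[of i] by simp
  then have "majorized r (wsum R c) (\<lambda>x. f (p + ((q - p) + x)))"
    using f r by (intro majorized_compose[of r R _ "\<lambda>x. f (p + x)"]) (auto simp: majorized_def)
  then show ?thesis by (intro kanalytic_atI[OF r(1)]) (simp add: algebra_simps)
qed

lemma eventually_polydisc: "0 < r \<Longrightarrow> eventually (\<lambda>q. \<forall>i. norm (q $ i - p $ i) < r) (nhds p)"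
proof (rule eventually_all_finite_type)
  fix i assume "0 < r"
  then have "eventually (\<lambda>q. dist q p < r) (nhds p)" by (auto simp: eventually_nhds_metric)
  then show "eventually (\<lambda>q. norm (q $ i - p $ i) < r) (nhds p)"
  proof eventually_elim
    case (elim q)
    then show ?case using dist_vec_nth_le[of q i p] by (simp add: dist_norm)
  qed
qed

lemma eventually_kanalytic_at: "kanalytic_at f p \<Longrightarrow> eventually (kanalytic_at f) (nhds p)"
proof -
  assume "kanalytic_at f p"
  then obtain r c where r: "0 < r" and c: "power_series r c (\<lambda>x. f (p + x))"
    using kanalytic_at_iff_power_series by blast
  show ?thesis
    using eventually_polydisc[OF r, of p] by eventually_elim (auto intro: power_series_kanalytic_at[OF c])
qed

lemma pd_translate: "pd i (\<lambda>x. f (p + x)) x = pd i f (p + x)"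
  by (simp add: pd_def add.assoc)

lemma kanalytic_at_pd_DERIV:
  assumes "kanalytic_at f p"
  shows "((\<lambda>t. f (p + axis i t)) has_field_derivative pd i f p) (at 0)"
proof -
  obtain r c where r: "0 < r" and c: "power_series r c (\<lambda>x. f (p + x))"
    using assms kanalytic_at_iff_power_series by blast
  have "((\<lambda>t. f (p + (0 + axis i t))) has_field_derivative (\<Sum>\<^sub>\<infinity>m. pd_coeffs i c m * mpow 0 m)) (at 0)"
    by (rule power_series_has_field_derivative[OF c, of "r / 2"]) (use r in \<open>auto simp: polydisc_def\<close>)
  then show ?thesis using pd_eqI[of f p i] by simp
qed

lemma kanalytic_at_pd: "kanalytic_at f p \<Longrightarrow> kanalytic_at (pd i f) p"
proof -
  assume "kanalytic_at f p"
  then obtain r c where r: "0 < r" and c: "power_series r c (\<lambda>x. f (p + x))"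
    using kanalytic_at_iff_power_series by blast
  have "power_series (r / 2) (pd_coeffs i c) (pd i (\<lambda>x. f (p + x)))"
    by (rule power_series_pd[OF c]) (use r in auto)
  then show ?thesis unfolding kanalytic_at_iff_power_series using r
    by (intro exI[of _ "r / 2"]) (auto simp: pd_translate[abs_def])
qed

lemma pd_commute:
  assumes "kanalytic_at f p"
  shows "pd i (pd j f) p = pd j (pd i f) p"
proof -
  obtain r c where r: "0 < r" and c: "power_series r c (\<lambda>x. f (p + x))"
    using assms kanalytic_at_iff_power_series by blast
  define F where "F = (\<lambda>x. f (p + x))"
  have "power_series (r/4) (pd_coeffs i (pd_coeffs j c)) (pd i (pd j F))" for i j
    using r c by (intro power_series_pd[of "r/2"] power_series_pd[of r]) (auto simp: F_def)
  from power_series_unique[OF this[of i j] this[of j i, folded pd_coeffs_commute[of i j c]], of 0]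
  have "pd i (pd j F) 0 = pd j (pd i F) 0" using r by (simp add: zero_in_polydisc)
  moreover have "pd j F = (\<lambda>x. pd j f (p + x))" for j by (simp add: F_def pd_translate fun_eq_iff)
  ultimately show ?thesis by (simp add: pd_translate)
qed

lemma pd_cong:
  assumes "eventually (\<lambda>q. f q = g q) (nhds p)"
  shows "pd i f p = pd i g p"
proof -
  have "((\<lambda>t. p + (\<chi> j. if j = i then t else 0)) \<longlongrightarrow> p + (\<chi> j. if j = i then 0 else 0)) (nhds 0)"
  proof (intro tendsto_add tendsto_const tendsto_vec_lambda)
    show "((\<lambda>t. if j = i then t else 0) \<longlongrightarrow> (if j = i then 0 else 0)) (nhds (0::'a))" for j
      by (cases "j = i") (auto intro: filterlim_ident)
  qed
  then have "filterlim (\<lambda>t. p + axis i t) (nhds p) (nhds 0)" by (simp add: axis_def zero_vec_def[symmetric])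
  then have "eventually (\<lambda>t. f (p + axis i t) = g (p + axis i t)) (nhds 0)"
    using assms by (rule eventually_compose_filterlim[rotated])
  then show ?thesis unfolding pd_def by (rule deriv_cong_ev) simp
qed

lemma pd_const: "pd i (\<lambda>q. a) p = 0"
  by (simp add: pd_def)

lemma pd_coord: "pd i (\<lambda>q. q $ j) p = (if i = j then 1 else 0)"
  by (rule pd_eqI) (auto simp: axis_def intro!: derivative_eq_intros)

lemma pd_add:
  "kanalytic_at f p \<Longrightarrow> kanalytic_at g p \<Longrightarrow> pd i (\<lambda>q. f q + g q) p = pd i f p + pd i g p"
  by (rule pd_eqI) (intro DERIV_add kanalytic_at_pd_DERIV)

lemma pd_mult:
  assumes "kanalytic_at f p" "kanalytic_at g p"
  shows "pd i (\<lambda>q. f q * g q) p = pd i f p * g p + f p * pd i g p"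
  using DERIV_mult[OF kanalytic_at_pd_DERIV[OF assms(1), of i] kanalytic_at_pd_DERIV[OF assms(2), of i]]
  by (intro pd_eqI) (simp add: axis_def zero_vec_def[symmetric] algebra_simps)

lemma pd_cmult: "kanalytic_at f p \<Longrightarrow> pd i (\<lambda>q. a * f q) p = a * pd i f p"
  by (simp add: pd_mult kanalytic_at_const pd_const)

lemma pd_diff:
  "kanalytic_at f p \<Longrightarrow> kanalytic_at g p \<Longrightarrow> pd i (\<lambda>q. f q - g q) p = pd i f p - pd i g p"
  by (rule pd_eqI) (intro DERIV_diff kanalytic_at_pd_DERIV)

lemma pd_minus: "kanalytic_at f p \<Longrightarrow> pd i (\<lambda>q. - f q) p = - pd i f p"
  by (rule pd_eqI) (intro DERIV_minus kanalytic_at_pd_DERIV)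

lemma pd_sum:
  "(\<And>j. j \<in> J \<Longrightarrow> kanalytic_at (f j) p) \<Longrightarrow> pd i (\<lambda>q. \<Sum>j\<in>J. f j q) p = (\<Sum>j\<in>J. pd i (f j) p)"
  by (rule pd_eqI) (intro DERIV_sum kanalytic_at_pd_DERIV)

definition open_polydisc :: "'k::analytic_scalar ^ 'n \<Rightarrow> real \<Rightarrow> ('k ^ 'n) set" where
  "open_polydisc p r = {q. \<forall>i. norm (q $ i - p $ i) < r}"

lemma open_open_polydisc: "open (open_polydisc p r)"
proof -
  have "open_polydisc p r = (\<Inter>i\<in>UNIV. {q. norm (q $ i - p $ i) < r})"
    by (auto simp: open_polydisc_def)
  moreover have "open {q. norm (q $ i - p $ i) < r}" for i
    by (intro open_Collect_less continuous_intros)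
  ultimately show ?thesis by auto
qed

lemma convex_open_polydisc: "convex (open_polydisc p r)"
proof -
  have "open_polydisc p r = (\<Inter>i\<in>UNIV. (\<lambda>q. q $ i) -` ball (p $ i) r)"
    by (auto simp: open_polydisc_def dist_norm norm_minus_commute)
  moreover have "convex ((\<lambda>q. q $ i) -` ball (p $ i) r)" for i
    by (rule convex_linear_vimage) (auto intro: linearI)
  ultimately show ?thesis by (auto intro!: convex_INT)
qed

lemma open_polydisc_center: "0 < r \<Longrightarrow> p \<in> open_polydisc p r"
  by (simp add: open_polydisc_def)

lemma open_polydisc_mono: "r \<le> s \<Longrightarrow> open_polydisc p r \<subseteq> open_polydisc p s"
  by (auto simp: open_polydisc_def intro: less_le_trans)

lemma eventually_nhds_open_polydisc:
  fixes p :: "'k::analytic_scalar ^ 'n"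
  assumes "eventually P (nhds p)"
  obtains r where "0 < r" "\<And>q. q \<in> open_polydisc p r \<Longrightarrow> P q"
proof -
  obtain e where e: "e > 0" "\<And>q. dist q p < e \<Longrightarrow> P q"
    using assms unfolding eventually_nhds_metric by blast
  define s where "s = e / (2 * CARD('n))"
  have s: "0 < s" using e by (simp add: s_def)
  have "dist q p < e" if "q \<in> open_polydisc p s" for q
  proof -
    have "norm (q - p) \<le> (\<Sum>i\<in>UNIV. norm ((q - p) $ i))" unfolding norm_vec_def by (rule L2_set_le_sum) simp
    also have "\<dots> \<le> (\<Sum>i\<in>(UNIV::'n set). s)"
      by (rule sum_mono) (use that in \<open>auto simp: open_polydisc_def intro: less_imp_le\<close>)
    also have "\<dots> < e" using e by (simp add: s_def)
    finally show ?thesis by (simp add: dist_norm)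
  qed
  then show ?thesis using that s e by blast
qed

lemma linear_differential: "linear (differential f p)"
  by (rule linearI) (auto simp: differential_def algebra_simps sum.distrib scaleR_sum_right)

text \<open>
  The remainder \<open>g\<close> of the linear approximation has vanishing value and first derivatives, so its
  series starts in degree two.
\<close>

lemma kanalytic_at_has_derivative:
  fixes f :: "'k::analytic_scalar ^ 'n \<Rightarrow> 'k"
  assumes f: "kanalytic_at f p"
  shows "(f has_derivative differential f p) (at p)"
proof -
  define g where "g q = f q - f p - (\<Sum>i\<in>UNIV. pd i f p * (q $ i - p $ i))" for q
  have an: "kanalytic_at (\<lambda>q. f q - f p) p" "kanalytic_at (\<lambda>q. \<Sum>i\<in>UNIV. pd i f p * (q $ i - p $ i)) p"
    by (intro kanalytic_at_diff kanalytic_at_sum kanalytic_at_mult kanalytic_at_const kanalytic_at_coord f)+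
  have g: "kanalytic_at g p" unfolding g_def by (rule kanalytic_at_diff[OF an])
  then obtain R c where R: "0 < R" and c: "power_series R c (\<lambda>x. g (p + x))"
    using kanalytic_at_iff_power_series by blast
  have pd0: "pd j g p = 0" for j
  proof -
    have "pd j g p = pd j f p - (\<Sum>i\<in>UNIV. pd i f p * (if j = i then 1 else 0))"
      unfolding g_def
      by (simp add: pd_diff[OF an] pd_diff[OF f kanalytic_at_const] pd_const pd_sum pd_cmult pd_coord
            kanalytic_at_mult kanalytic_at_diff kanalytic_at_const kanalytic_at_coord pd_diff)
    then show ?thesis by (simp add: if_distrib[of "\<lambda>x. _ * x"] cong: if_cong)
  qed
  have c0: "c m = 0" if "mdeg m < 2" for m
  proof (cases "mdeg m = 0")
    case True
    then have "m = (\<lambda>_. 0)" by (auto simp: mdeg_def fun_eq_iff)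
    then show ?thesis using power_series_at_0[OF c] R by (simp add: g_def)
  next
    case False
    then obtain i where i: "m i > 0" by (auto simp: mdeg_def)
    have "m i + (\<Sum>j\<in>UNIV - {i}. m j) < 2" using that by (simp add: mdeg_remove[of m i])
    then have "m i = 1 \<and> (\<Sum>j\<in>UNIV - {i}. m j) = 0" using i by linarith
    then have m: "m = (\<lambda>_. 0)(i := 1)" by (auto simp: fun_eq_iff)
    have "power_series (R/2) (pd_coeffs i c) (pd i (\<lambda>x. g (p + x)))" by (rule power_series_pd[OF c]) (use R in auto)
    then have "pd i (\<lambda>x. g (p + x)) 0 = pd_coeffs i c (\<lambda>_. 0)" by (rule power_series_at_0) (use R in auto)
    then have "pd_coeffs i c (\<lambda>_. 0) = 0" using pd0[of i] by (simp add: pd_translate)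
    then show ?thesis by (simp add: pd_coeffs_def m)
  qed
  define K where "K = wsum R c / R ^ 2"
  have gK: "norm (g (p + x)) \<le> K * norm x ^ 2" if "norm x < R" for x
  proof -
    have x: "x \<in> polydisc (norm x)" by (simp add: polydisc_def Finite_Cartesian_Product.norm_nth_le)
    have "majorized (norm x) ((norm x / R) ^ 2 * wsum R c) (\<lambda>x. g (p + x))"
      by (rule majorized_shrink[OF c]) (use that R c0 in auto)
    from majorized_norm_le[OF this x] show ?thesis by (simp add: K_def power_divide mult_ac)
  qed
  show ?thesis
  proof (rule has_derivativeI_sandwich[OF R, where H = "\<lambda>q. K * norm (q - p)"])
    show "bounded_linear (differential f p)" using linear_differential linear_conv_bounded_linear by blast
    show "((\<lambda>q. K * norm (q - p)) \<longlongrightarrow> 0) (at p)"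
      by (rule tendsto_eq_intros refl | simp)+
    fix q assume q: "q \<noteq> p" "dist q p < R"
    have "f q - f p - differential f p (q - p) = g (p + (q - p))" by (simp add: g_def differential_def)
    moreover have "norm (g (p + (q - p))) \<le> K * norm (q - p) ^ 2" using q by (intro gK) (simp add: dist_norm)
    ultimately show "norm (f q - f p - differential f p (q - p)) / norm (q - p) \<le> K * norm (q - p)"
      using q by (simp add: divide_le_eq power2_eq_square mult_ac)
  qed
qed

lemma kanalytic_at_isCont: "kanalytic_at f p \<Longrightarrow> isCont f p"
  using kanalytic_at_has_derivative has_derivative_continuous by blast

lemma bounded_linear_axis: "bounded_linear (axis i :: 'k::analytic_scalar \<Rightarrow> 'k ^ 'n)"
  unfolding linear_conv_bounded_linear[symmetric]
  by (rule linearI) (auto simp: axis_def vec_eq_iff)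

lemma has_derivative_components:
  fixes \<phi> :: "'a::real_normed_vector \<Rightarrow> 'k::analytic_scalar ^ 'n"
  assumes "\<And>j. ((\<lambda>q. \<phi> q $ j) has_derivative (\<lambda>w. D w $ j)) (at p)"
  shows "(\<phi> has_derivative D) (at p)"
proof -
  have e: "(\<Sum>j\<in>UNIV. axis j (v $ j)) = v" for v :: "'k ^ 'n"
    by (simp add: vec_eq_iff axis_def)
  have "((\<lambda>q. \<Sum>j\<in>UNIV. axis j (\<phi> q $ j)) has_derivative (\<lambda>w. \<Sum>j\<in>UNIV. axis j (D w $ j))) (at p)"
    by (rule has_derivative_sum) (rule bounded_linear.has_derivative[OF bounded_linear_axis assms])
  then show ?thesis by (simp add: e)
qed

lemma kanalytic_map_has_derivative:
  assumes "\<And>j. kanalytic_at (\<lambda>q. \<phi> q $ j) p"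
  shows "(\<phi> has_derivative (\<lambda>w. \<chi> j. differential (\<lambda>q. \<phi> q $ j) p w)) (at p)"
  by (rule has_derivative_components) (simp add: kanalytic_at_has_derivative assms)

lemma kanalytic_map_isCont: "(\<And>j. kanalytic_at (\<lambda>q. \<phi> q $ j) p) \<Longrightarrow> isCont \<phi> p"
  using kanalytic_map_has_derivative has_derivative_continuous by blast

lemma kanalytic_map_continuous: "kanalytic_map_on N \<phi> \<Longrightarrow> continuous_on N \<phi>"
  unfolding kanalytic_map_on_def kanalytic_on_def
  by (auto intro!: continuous_at_imp_continuous_on kanalytic_map_isCont)

lemma differential_axis: "differential f p (axis i t) = pd i f p * t"
  by (simp add: differential_def axis_def if_distrib[of "\<lambda>x. _ * x"] cong: if_cong)

lemma pd_chain:
  assumes f: "kanalytic_at f (\<phi> p)" and \<phi>: "\<And>j. kanalytic_at (\<lambda>q. \<phi> q $ j) p"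
  shows "pd i (\<lambda>q. f (\<phi> q)) p = (\<Sum>j\<in>UNIV. pd j f (\<phi> p) * pd i (\<lambda>q. \<phi> q $ j) p)"
proof (rule pd_eqI)
  have ax: "((\<lambda>t. p + axis i t) has_derivative axis i) (at 0)"
    using bounded_linear.has_derivative[OF bounded_linear_axis has_derivative_ident]
    by (rule has_derivative_add[OF has_derivative_const, simplified])
  have "axis i 0 = (0 :: 'a ^ 'c)" by (simp add: axis_def vec_eq_iff)
  then have ax0: "p + axis i 0 = p" by simp
  have "((\<lambda>t. f (\<phi> (p + axis i t))) has_derivative
      (\<lambda>t. differential f (\<phi> p) (\<chi> j. differential (\<lambda>q. \<phi> q $ j) p (axis i t)))) (at 0)"
    by (rule has_derivative_compose[OF has_derivative_compose[OF ax, of \<phi>], of _ f, unfolded ax0,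
          OF kanalytic_map_has_derivative[OF \<phi>] kanalytic_at_has_derivative[OF f]])
  moreover have "differential f (\<phi> p) (\<chi> j. differential (\<lambda>q. \<phi> q $ j) p (axis i t))
      = (\<Sum>j\<in>UNIV. pd j f (\<phi> p) * pd i (\<lambda>q. \<phi> q $ j) p) * t" for t
    by (simp add: differential_axis) (simp add: differential_def sum_distrib_left sum_distrib_right mult_ac)
  ultimately show "((\<lambda>t. f (\<phi> (p + axis i t))) has_field_derivative
      (\<Sum>j\<in>UNIV. pd j f (\<phi> p) * pd i (\<lambda>q. \<phi> q $ j) p)) (at 0)"
    by (simp add: has_field_derivative_def)
qed

lemma constant_along_segment:
  assumes S: "convex S" "x \<in> S" "y \<in> S" and f: "\<And>q. q \<in> S \<Longrightarrow> kanalytic_at f q"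
    and z: "\<And>q. q \<in> S \<Longrightarrow> differential f q (y - x) = 0"
  shows "f x = f y"
proof -
  define \<gamma> where "\<gamma> t = x + t *\<^sub>R (y - x)" for t :: real
  have in_S: "\<gamma> t \<in> S" if "t \<in> {0..1}" for t
  proof -
    have "\<gamma> t = (1 - t) *\<^sub>R x + t *\<^sub>R y" by (simp add: \<gamma>_def algebra_simps)
    then show ?thesis using convexD[OF S(1) S(2,3), of "1 - t" t] that by simp
  qed
  have "((\<lambda>t. f (\<gamma> t)) has_derivative (\<lambda>h. 0)) (at t within {0..1})" if "t \<in> {0..1}" for t
  proof -
    have "(\<gamma> has_derivative (\<lambda>h. h *\<^sub>R (y - x))) (at t within {0..1})"
      unfolding \<gamma>_def[abs_def] by (auto intro!: derivative_eq_intros)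
    then have "((\<lambda>t. f (\<gamma> t)) has_derivative (\<lambda>h. differential f (\<gamma> t) (h *\<^sub>R (y - x)))) (at t within {0..1})"
      by (rule has_derivative_compose[OF _ kanalytic_at_has_derivative]) (rule f[OF in_S[OF that]])
    moreover have "differential f (\<gamma> t) (h *\<^sub>R (y - x)) = 0" for h
      using linear_scale[OF linear_differential, of f "\<gamma> t" h "y - x"] z[OF in_S[OF that]] by simp
    ultimately show ?thesis by simp
  qed
  then have "f (\<gamma> 0) = f (\<gamma> 1)"
    by (intro has_derivative_zero_unique[of "{0..1}"]) (auto simp: convex_real_interval)
  then show ?thesis by (simp add: \<gamma>_def)
qed

text \<open>
  A function dominating its own derivative vanishes near a zero: on a small ball the mean value
  inequality bounds its maximum by half of itself.
\<close>

lemma zero_near_zero: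
  fixes \<rho> :: "'k::analytic_scalar ^ 'n \<Rightarrow> 'k"
  assumes e: "0 < e" and an: "\<And>q. q \<in> cball p e \<Longrightarrow> kanalytic_at \<rho> q"
    and M: "\<And>q i. q \<in> cball p e \<Longrightarrow> norm (pd i \<rho> q) \<le> M * norm (\<rho> q)" and z: "\<rho> p = 0"
  shows "eventually (\<lambda>q. \<rho> q = 0) (nhds p)"
proof -
  define L where "L = real CARD('n) * max M 0 + 1"
  define d where "d = min e (1 / (2 * L))"
  have L: "L > 0" by (simp add: L_def add_nonneg_pos)
  have d: "0 < d" "d \<le> e" "L * d \<le> 1/2"
    using e L by (auto simp: d_def min_def field_simps)
  have sub: "cball p d \<subseteq> cball p e" using d by (simp add: subset_cball)
  have "continuous_on (cball p d) (\<lambda>q. norm (\<rho> q))"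
    by (intro continuous_on_norm continuous_at_imp_continuous_on) (use an sub kanalytic_at_isCont in blast)
  then obtain q0 where q0: "q0 \<in> cball p d" "\<And>q. q \<in> cball p d \<Longrightarrow> norm (\<rho> q) \<le> norm (\<rho> q0)"
    using continuous_attains_sup[of "cball p d" "\<lambda>q. norm (\<rho> q)"] d by auto
  have on: "onorm (differential \<rho> q) \<le> L * norm (\<rho> q0)" if "q \<in> cball p d" for q
  proof (rule onorm_le)
    fix w
    have "norm (differential \<rho> q w) \<le> (\<Sum>i\<in>UNIV. norm (pd i \<rho> q * w $ i))"
      unfolding differential_def by (rule norm_sum)
    also have "\<dots> \<le> (\<Sum>i\<in>(UNIV::'n set). max M 0 * norm (\<rho> q0) * norm w)"
    proof (rule sum_mono)
      fix i
      have "norm (pd i \<rho> q) \<le> max M 0 * norm (\<rho> q0)"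
        using M[where q = q and i = i] sub that q0(2)[OF that] by (smt (verit) mult_mono norm_ge_zero subsetD mult_right_mono)
      then show "norm (pd i \<rho> q * w $ i) \<le> max M 0 * norm (\<rho> q0) * norm w"
        unfolding norm_mult using Finite_Cartesian_Product.norm_nth_le[of w i] by (intro mult_mono) auto
    qed
    also have "\<dots> = (real CARD('n) * max M 0) * norm (\<rho> q0) * norm w" by simp
    also have "\<dots> \<le> L * norm (\<rho> q0) * norm w"
      by (intro mult_right_mono) (auto simp: L_def)
    finally show "norm (differential \<rho> q w) \<le> L * norm (\<rho> q0) * norm w" .
  qed
  have "norm (\<rho> q0 - \<rho> p) \<le> L * norm (\<rho> q0) * norm (q0 - p)"
    by (rule differentiable_bound[where S = "cball p d" and f' = "differential \<rho>"])
       (use on q0 d sub an in \<open>auto intro!: has_derivative_at_withinI kanalytic_at_has_derivative\<close>)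
  also have "\<dots> \<le> L * norm (\<rho> q0) * d"
    using q0(1) L by (intro mult_left_mono) (auto simp: dist_norm norm_minus_commute)
  also have "\<dots> = (L * d) * norm (\<rho> q0)" by simp
  also have "\<dots> \<le> 1/2 * norm (\<rho> q0)" by (intro mult_right_mono d) simp
  finally have "norm (\<rho> q0) \<le> 0" using z by simp
  then have "\<rho> q = 0" if "dist q p < d" for q
    using q0(2)[of q] that by (auto simp: dist_commute)
  then show ?thesis using d(1) by (auto simp: eventually_nhds_metric)
qed

text \<open>
  The primitive is normalized to vanish on the hyperplane through \<open>p\<close>. Its derivative in
  another direction is then constant in the direction of integration and zero on the hyperplane
  as soon as the integrand does not depend on that other coordinate.
\<close>

lemma primitive:
  fixes G :: "'k::analytic_scalar ^ 'n \<Rightarrow> 'k"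
  assumes G: "kanalytic_at G p"
  obtains R P where "0 < R" "\<forall>q\<in>open_polydisc p R. kanalytic_at P q \<and> pd i P q = G q"
    "\<forall>r\<le>R. \<forall>j. j \<noteq> i \<longrightarrow> (\<forall>q\<in>open_polydisc p r. pd j G q = 0) \<longrightarrow>
       (\<forall>q\<in>open_polydisc p r. pd j P q = 0)"
proof -
  obtain S c where S: "0 < S" and c: "power_series S c (\<lambda>x. G (p + x))"
    using G kanalytic_at_iff_power_series by blast
  obtain F where F: "power_series S (primitive_coeffs i c) F" "\<And>x. x $ i = 0 \<Longrightarrow> F x = 0"
    using power_series_primitive[OF c] S by (metis less_imp_le)
  define P where "P q = F (q - p)" for q
  have Pan: "kanalytic_at P q" if "q \<in> open_polydisc p S" for q
    by (rule power_series_kanalytic_at[of S "primitive_coeffs i c" P p])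
       (use F that in \<open>auto simp: P_def open_polydisc_def\<close>)
  define R where "R = S / 2"
  have R: "0 < R" "R < S" using S by (auto simp: R_def)
  have "power_series R c (pd i F)"
    using power_series_pd[OF F(1) R, of i] by (simp add: pd_coeffs_primitive)
  from power_series_unique[OF this power_series_smaller(1)[OF c]]
  have dF: "pd i F x = G (p + x)" if "x \<in> polydisc R" for x using that R by simp
  have PR: "kanalytic_at P q \<and> pd i P q = G q" if "q \<in> open_polydisc p R" for q
  proof
    show "kanalytic_at P q" using Pan that open_polydisc_mono[of R S p] R by auto
    have "pd i P q = pd i (\<lambda>x. P (p + x)) (q - p)" by (simp add: pd_translate)
    also have "\<dots> = pd i F (q - p)" by (simp add: P_def)
    also have "\<dots> = G q" using dF[of "q - p"] that
      by (auto simp: polydisc_def open_polydisc_def less_imp_le)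
    finally show "pd i P q = G q" .
  qed
  have "pd j P q = 0"
    if r: "r \<le> R" and j: "j \<noteq> i" and z: "\<And>q. q \<in> open_polydisc p r \<Longrightarrow> pd j G q = 0"
      and q: "q \<in> open_polydisc p r" for r j q
  proof -
    define q' where "q' = (\<chi> l. if l = i then p $ i else q $ l)"
    have rpos: "0 < r" using q by (auto simp: open_polydisc_def intro: le_less_trans[OF norm_ge_zero])
    have q': "q' \<in> open_polydisc p r" using q rpos by (auto simp: q'_def open_polydisc_def)
    have sub: "open_polydisc p r \<subseteq> open_polydisc p R" by (rule open_polydisc_mono[OF r])
    have "pd j P q' = 0"
    proof -
      have "P (q' + axis j t) = 0" for t
        unfolding P_def by (rule F(2)) (use j in \<open>simp add: q'_def axis_def\<close>)
      then show ?thesis by (simp add: pd_def)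
    qed
    moreover have "pd j P q' = pd j P q"
    proof (rule constant_along_segment[OF convex_open_polydisc q' q])
      fix y assume y: "y \<in> open_polydisc p r"
      show "kanalytic_at (pd j P) y" using PR sub y kanalytic_at_pd by blast
      have ev: "eventually (\<lambda>y. pd i P y = G y) (nhds y)"
        using eventually_nhds_in_open[OF open_open_polydisc, of y p R] sub y PR
        by (force elim!: eventually_mono)
      have "pd i (pd j P) y = pd j (pd i P) y" by (rule pd_commute) (use PR sub y in blast)
      also have "\<dots> = pd j G y" by (rule pd_cong[OF ev])
      finally have "pd i (pd j P) y = 0" using z[OF y] by simp
      moreover have "q - q' = axis i (q $ i - p $ i)" by (auto simp: q'_def axis_def vec_eq_iff)
      ultimately show "differential (pd j P) y (q - q') = 0" by (simp add: differential_axis)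
    qed
    ultimately show ?thesis by simp
  qed
  then show ?thesis using that[OF R(1), of P] PR by blast
qed

section \<open>The analytic inverse function theorem\<close>

lemma majorized_power_diff:
  assumes r: "0 \<le> r" and R: "0 < R" and a: "majorized r R a" and b: "majorized r R b"
    and ab: "majorized r \<delta> (\<lambda>x. a x - b x)"
  shows "majorized r (real k * R ^ k * (\<delta> / R)) (\<lambda>x. a x ^ k - b x ^ k)"
proof (induction k)
  case 0
  show ?case using majorized_const[OF r, of 0] by simp
next
  case (Suc k)
  have "majorized r (\<delta> * R ^ k + R * (real k * R ^ k * (\<delta> / R)))
      (\<lambda>x. (a x - b x) * a x ^ k + b x * (a x ^ k - b x ^ k))"
    by (intro majorized_add majorized_mult majorized_power r a b ab Suc)
  moreover have "\<delta> * R ^ k + R * (real k * R ^ k * (\<delta> / R)) = real (Suc k) * R ^ Suc k * (\<delta> / R)"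
    using R by (simp add: field_simps)
  ultimately show ?case by (simp add: algebra_simps)
qed

lemma majorized_prod_diff:
  assumes r: "0 \<le> r" and R: "0 < R" and J: "finite J"
    and a: "\<And>j. j \<in> J \<Longrightarrow> majorized r (R ^ n j) (a j)"
    and b: "\<And>j. j \<in> J \<Longrightarrow> majorized r (R ^ n j) (b j)"
    and ab: "\<And>j. j \<in> J \<Longrightarrow> majorized r (real (n j) * R ^ n j * (\<delta> / R)) (\<lambda>x. a j x - b j x)"
  shows "majorized r (real (sum n J) * R ^ sum n J * (\<delta> / R)) (\<lambda>x. (\<Prod>j\<in>J. a j x) - (\<Prod>j\<in>J. b j x))"
  using J a b ab
proof (induction J)
  case empty
  show ?case using majorized_const[OF r, of 0] by simp
next
  case (insert j J)
  have P: "majorized r (R ^ sum n J) (\<lambda>x. \<Prod>j\<in>J. a j x)"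
    using majorized_prod[OF r insert(1), of "\<lambda>j. R ^ n j" a] insert by (simp add: power_sum)
  have "majorized r (real (n j) * R ^ n j * (\<delta> / R) * R ^ sum n J
            + R ^ n j * (real (sum n J) * R ^ sum n J * (\<delta> / R)))
      (\<lambda>x. (a j x - b j x) * (\<Prod>j\<in>J. a j x) + b j x * ((\<Prod>j\<in>J. a j x) - (\<Prod>j\<in>J. b j x)))"
    by (intro majorized_add majorized_mult r P) (use insert in auto)
  then show ?case using insert(1,2) by (simp add: power_add algebra_simps)
qed

lemma majorized_mpow_diff:
  assumes "0 \<le> r" "0 < R" "\<And>i. majorized r R (\<lambda>x. \<phi> x $ i)" "\<And>i. majorized r R (\<lambda>x. \<psi> x $ i)"
    and "\<And>i. majorized r \<delta> (\<lambda>x. \<phi> x $ i - \<psi> x $ i)"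
  shows "majorized r (real (mdeg m) * R ^ mdeg m * (\<delta> / R)) (\<lambda>x. mpow (\<phi> x) m - mpow (\<psi> x) m)"
  unfolding mpow_def mdeg_def
  by (rule majorized_prod_diff[OF assms(1,2) finite majorized_power[OF assms(1,3)]
        majorized_power[OF assms(1,4)] majorized_power_diff[OF assms(1-5)]])

text \<open>
  With \<open>q = R / S\<close>, a monomial of degree \<open>n\<close> contributes at most \<open>n q\<^sup>n \<delta> / R\<close> relative to its
  weight at radius \<open>S\<close>. For \<open>n \<ge> 2\<close> and \<open>q \<le> 1/2\<close> this is at most \<open>2 q\<^sup>2 \<delta> / R\<close>, and the bound on
  \<open>R\<close> turns the sum into \<open>\<delta> / 2\<close>.
\<close>

lemma majorized_compose_contracts:
  fixes G :: "'k::analytic_scalar ^ 'n \<Rightarrow> 'k" and \<phi> \<psi> :: "'k ^ 'l \<Rightarrow> 'k ^ 'n"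
  assumes G: "power_series S c G" and c: "\<And>m. mdeg m < 2 \<Longrightarrow> c m = 0"
    and S: "0 < R" "R \<le> S / 2" "4 * wsum S c * R \<le> S ^ 2" and r: "0 \<le> r" and \<delta>: "0 \<le> \<delta>"
    and \<phi>: "\<And>i. majorized r R (\<lambda>x. \<phi> x $ i)" and \<psi>: "\<And>i. majorized r R (\<lambda>x. \<psi> x $ i)"
    and d: "\<And>i. majorized r \<delta> (\<lambda>x. \<phi> x $ i - \<psi> x $ i)"
  shows "majorized r (\<delta> / 2) (\<lambda>x. G (\<phi> x) - G (\<psi> x))"
proof -
  have Spos: "0 < S" using S by auto
  have sc: "(\<lambda>m. norm (c m) * S ^ mdeg m) summable_on UNIV" using G unfolding power_series_def by blast
  define q where "q = R / S"
  have q: "0 < q" "q \<le> 1/2" using S Spos by (auto simp: q_def divide_simps)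
  define B where "B m = norm (c m) * (real (mdeg m) * R ^ mdeg m * (\<delta> / R))" for m
  have nq: "real n * q ^ n \<le> 2 * q ^ 2" if "2 \<le> n" for n
  proof -
    obtain k where k: "n = k + 2" using \<open>2 \<le> n\<close> by (metis add.commute le_Suc_ex)
    have "real (k + 2) * (1/2) ^ k \<le> 2"
    proof (induction k)
      case (Suc k)
      have "(1/2::real) ^ k \<le> 1" by (rule power_le_one) auto
      then show ?case using Suc by (simp add: algebra_simps)
    qed simp
    moreover have "q ^ k \<le> (1/2) ^ k" using q by (intro power_mono) auto
    then have "real (k + 2) * q ^ k \<le> real (k + 2) * (1/2) ^ k" by (intro mult_left_mono) auto
    ultimately have "real (k + 2) * q ^ k \<le> 2" by linarith
    then have "real (k + 2) * q ^ k * q ^ 2 \<le> 2 * q ^ 2" by (intro mult_right_mono) auto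
    then show ?thesis by (simp only: k power_add mult.assoc)
  qed
  have B_le: "B m \<le> (2 * q ^ 2 * (\<delta> / R)) * (norm (c m) * S ^ mdeg m)" for m
  proof (cases "mdeg m < 2")
    case True
    then show ?thesis by (simp add: B_def c)
  next
    case False
    have "R ^ mdeg m = q ^ mdeg m * S ^ mdeg m" using Spos by (simp add: q_def power_divide)
    then have "real (mdeg m) * R ^ mdeg m \<le> 2 * q ^ 2 * S ^ mdeg m"
      using mult_right_mono[OF nq[of "mdeg m"], of "S ^ mdeg m"] False Spos by (simp add: mult_ac)
    then have "norm (c m) * (real (mdeg m) * R ^ mdeg m * (\<delta> / R)) \<le> norm (c m) * (2 * q ^ 2 * S ^ mdeg m * (\<delta> / R))"
      using S \<delta> by (intro mult_left_mono mult_right_mono) auto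
    then show ?thesis by (simp add: B_def mult_ac)
  qed
  have sB: "B summable_on UNIV"
    by (rule summable_on_comparison_test[OF summable_on_cmult_right[OF sc, of "2 * q ^ 2 * (\<delta> / R)"]])
       (use B_le S \<delta> in \<open>auto simp: B_def\<close>)
  have "infsum B UNIV \<le> (\<Sum>\<^sub>\<infinity>m. (2 * q ^ 2 * (\<delta> / R)) * (norm (c m) * S ^ mdeg m))"
    by (rule infsum_mono[OF sB summable_on_cmult_right[OF sc] B_le])
  also have "\<dots> = 2 * q ^ 2 * (\<delta> / R) * wsum S c" by (subst infsum_cmult_right') (simp add: wsum_def)
  also have "\<dots> = \<delta> / 2 * ((4 * wsum S c * R) / S ^ 2)"
    using S(1) by (simp add: q_def power_divide power2_eq_square)
  also have "\<dots> \<le> \<delta> / 2 * 1"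
    using S Spos \<delta> by (intro mult_left_mono) auto
  finally have le: "infsum B UNIV \<le> \<delta> / 2" by simp
  have "majorized r (infsum B UNIV) (\<lambda>x. \<Sum>\<^sub>\<infinity>m. c m * (mpow (\<phi> x) m - mpow (\<psi> x) m))"
    unfolding B_def
    by (rule majorized_infsum[OF r majorized_cmult[OF r majorized_mpow_diff[OF r S(1) \<phi> \<psi> d]]])
       (use sB in \<open>simp add: B_def[abs_def]\<close>)
  then have "majorized r (\<delta> / 2) (\<lambda>x. \<Sum>\<^sub>\<infinity>m. c m * (mpow (\<phi> x) m - mpow (\<psi> x) m))"
    by (rule majorized_weaken) (rule le)
  then show ?thesis
  proof (rule majorized_cong)
    fix x :: "'k ^ 'l" assume "x \<in> polydisc r"
    then have "\<phi> x \<in> polydisc S" "\<psi> x \<in> polydisc S"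
      using majorized_compose_polydisc[OF r \<phi>] majorized_compose_polydisc[OF r \<psi>]
        polydisc_mono[of R S] S Spos by fastforce+
    then have "((\<lambda>m. c m * mpow (\<phi> x) m + (-1) * (c m * mpow (\<psi> x) m)) has_sum (G (\<phi> x) + (-1) * G (\<psi> x))) UNIV"
      using G unfolding power_series_def by (intro has_sum_add has_sum_cmult_right) auto
    then show "(\<Sum>\<^sub>\<infinity>m. c m * (mpow (\<phi> x) m - mpow (\<psi> x) m)) = G (\<phi> x) - G (\<psi> x)"
      by (intro infsumI) (simp add: algebra_simps)
  qed
qed

text \<open>
  The inverse of a perturbation of the identity is the limit of the iteration
  \<open>\<zeta> \<mapsto> y - G \<zeta>\<close>. The contraction is measured on majorants, not on values, so that the
  limit is again a power series.
\<close>

lemma inverse_near_identity: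
  fixes G :: "'n::finite \<Rightarrow> 'k::analytic_scalar ^ 'n \<Rightarrow> 'k"
  assumes S: "0 < S" and G: "\<And>i. power_series S (c i) (G i)" and c: "\<And>i m. mdeg m < 2 \<Longrightarrow> c i m = 0"
  obtains r C \<zeta> where "0 < r" "\<And>i. majorized r C (\<lambda>y. \<zeta> y $ i)" "\<zeta> 0 = 0"
    "\<And>y i. y \<in> polydisc r \<Longrightarrow> \<zeta> y $ i + G i (\<zeta> y) = y $ i"
proof -
  have "eventually (\<lambda>R. R < S / 2 \<and> (\<forall>i. 4 * wsum S (c i) * R < S ^ 2)) (at_right (0::real))"
  proof (intro eventually_conj eventually_all_finite_type)
    have "((\<lambda>R. R) \<longlongrightarrow> 0) (at_right (0::real))" by (rule tendsto_ident_at)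
    then show "eventually (\<lambda>R. R < S / 2) (at_right (0::real))"
      by (rule order_tendstoD) (use S in auto)
    have "((\<lambda>R. 4 * wsum S (c i) * R) \<longlongrightarrow> 4 * wsum S (c i) * 0) (at_right (0::real))" for i
      by (intro tendsto_intros)
    then show "eventually (\<lambda>R. 4 * wsum S (c i) * R < S ^ 2) (at_right (0::real))" for i
      by (rule order_tendstoD) (use S in auto)
  qed
  then obtain R where R: "0 < R" "R \<le> S / 2" "\<And>i. 4 * wsum S (c i) * R \<le> S ^ 2"
    by (rule eventually_positive_radius) (auto intro: less_imp_le)
  define r where "r = R / 2"
  have r: "0 < r" "0 \<le> r" using R by (auto simp: r_def)
  define T :: "('k ^ 'n \<Rightarrow> 'k ^ 'n) \<Rightarrow> 'k ^ 'n \<Rightarrow> 'k ^ 'n"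
    where "T \<phi> = (\<lambda>y. \<chi> i. y $ i - G i (\<phi> y))" for \<phi>
  define \<xi> where "\<xi> k = (T ^^ k) (\<lambda>y. y)" for k
  have \<xi>0: "\<xi> 0 = (\<lambda>y. y)" and \<xi>S: "\<xi> (Suc k) = T (\<xi> k)" for k by (simp_all add: \<xi>_def)
  have G0: "G i 0 = 0" for i
    using power_series_at_0[OF G[of i]] S c[of "\<lambda>_. 0" i] by (simp add: mdeg_def)
  have Gm: "majorized r (\<delta> / 2) (\<lambda>y. G i (\<phi> y) - G i (\<psi> y))"
    if "\<And>i. majorized r R (\<lambda>x. \<phi> x $ i)" "\<And>i. majorized r R (\<lambda>x. \<psi> x $ i)"
      "\<And>i. majorized r \<delta> (\<lambda>x. \<phi> x $ i - \<psi> x $ i)" for \<phi> \<psi> :: "'k ^ 'n \<Rightarrow> 'k ^ 'n" and \<delta> i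
    by (rule majorized_compose_contracts[OF G c R(1,2,3) r(2) _ that])
       (use majorized_nonneg[OF r(2) that(3)] in auto)
  have \<xi>m: "majorized r R (\<lambda>y. \<xi> k y $ i)" for k i
  proof (induction k arbitrary: i)
    case 0
    show ?case unfolding \<xi>0 using R by (intro majorized_weaken[OF majorized_coord[OF r(2)]]) (simp add: r_def)
  next
    case (Suc k)
    have z: "majorized r R (\<lambda>x. (0::'k ^ 'n) $ i)" for i
      using majorized_weaken[OF majorized_const[OF r(2), of 0], of R] R by simp
    have "majorized r (R / 2) (\<lambda>y. G i (\<xi> k y) - G i 0)"
      by (rule Gm[of "\<xi> k" "\<lambda>_. 0"]) (use Suc z in auto)
    then have "majorized r (R / 2) (\<lambda>y. G i (\<xi> k y))" by (simp add: G0)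
    from majorized_diff[OF r(2) majorized_coord[OF r(2), of i] this]
    show ?case by (simp add: \<xi>S T_def r_def)
  qed
  have \<xi>d: "majorized r (R * (1/2) ^ k) (\<lambda>y. \<xi> (Suc k) y $ i - \<xi> k y $ i)" for k i
  proof (induction k arbitrary: i)
    case 0
    have z: "majorized r R (\<lambda>x. (0::'k ^ 'n) $ i)" for i
      using majorized_weaken[OF majorized_const[OF r(2), of 0], of R] R by simp
    have "majorized r (R / 2) (\<lambda>y. G i 0 - G i (\<xi> 0 y))"
      by (rule Gm[of "\<lambda>_. 0" "\<xi> 0"])
         (use \<xi>m z majorized_cmult[OF r(2) \<xi>m, of "-1" 0] in auto)
    then have "majorized r R (\<lambda>y. G i 0 - G i (\<xi> 0 y))" by (rule majorized_weaken) (use R in simp)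
    then show ?case by (simp add: \<xi>S \<xi>0 T_def G0)
  next
    case (Suc k)
    have "majorized r (R * (1/2) ^ k / 2) (\<lambda>y. G i (\<xi> k y) - G i (\<xi> (Suc k) y))"
    proof (rule Gm)
      show "majorized r (R * (1/2) ^ k) (\<lambda>y. \<xi> k y $ i - \<xi> (Suc k) y $ i)" for i
        using majorized_cmult[OF r(2) Suc, of "-1" i] by simp
    qed (rule \<xi>m)+
    then show ?case by (simp add: \<xi>S[of "Suc k"] \<xi>S[of k] T_def)
  qed
  have geo: "(\<lambda>k::nat. R * (1/2) ^ k) summable_on UNIV"
    by (subst summable_on_UNIV_nonneg_real_iff) (use R in \<open>auto intro!: summable_mult summable_geometric\<close>)
  define \<zeta>' :: "'k ^ 'n \<Rightarrow> 'k ^ 'n" where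
    "\<zeta>' y = (\<chi> i. y $ i + (\<Sum>\<^sub>\<infinity>k. \<xi> (Suc k) y $ i - \<xi> k y $ i))" for y
  have \<zeta>m: "majorized r (r + infsum (\<lambda>k::nat. R * (1/2) ^ k) UNIV) (\<lambda>y. \<zeta>' y $ i)" for i
    unfolding \<zeta>'_def vec_lambda_beta
    by (intro majorized_add[OF r(2)] majorized_coord[OF r(2)] majorized_infsum[OF r(2) _ geo] \<xi>d)
  have \<zeta>0: "\<zeta>' 0 = 0"
  proof -
    have "\<xi> k 0 = 0" for k
    proof (induction k)
      case (Suc k)
      show ?case unfolding \<xi>S T_def Suc by (simp add: G0 vec_eq_iff)
    qed (simp add: \<xi>0)
    then show ?thesis by (simp add: \<zeta>'_def vec_eq_iff)
  qed
  have fix_pt: "\<zeta>' y $ i + G i (\<zeta>' y) = y $ i" if y: "y \<in> polydisc r" for y i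
  proof -
    have lim: "(\<lambda>k. \<xi> k y $ i) \<longlonglongrightarrow> \<zeta>' y $ i" for i
    proof -
      have "(\<lambda>k. norm (\<xi> (Suc k) y $ i - \<xi> k y $ i)) summable_on UNIV"
        by (rule Infinite_Sum.abs_summable_on_comparison_test'[OF geo]) (rule majorized_norm_le[OF \<xi>d y])
      then have "((\<lambda>k. \<xi> (Suc k) y $ i - \<xi> k y $ i) has_sum (\<Sum>\<^sub>\<infinity>k. \<xi> (Suc k) y $ i - \<xi> k y $ i)) UNIV"
        by (rule has_sum_infsum[OF abs_summable_summable])
      from has_sum_imp_sums[OF this]
      have "(\<lambda>n. \<Sum>k<n. \<xi> (Suc k) y $ i - \<xi> k y $ i) \<longlonglongrightarrow> (\<Sum>\<^sub>\<infinity>k. \<xi> (Suc k) y $ i - \<xi> k y $ i)"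
        by (simp only: sums_def)
      then have "(\<lambda>n. \<xi> n y $ i - \<xi> 0 y $ i) \<longlonglongrightarrow> (\<Sum>\<^sub>\<infinity>k. \<xi> (Suc k) y $ i - \<xi> k y $ i)"
        by (simp only: sum_lessThan_telescope[of "\<lambda>n. \<xi> n y $ i"])
      from tendsto_add[OF tendsto_const[of "y $ i"] this] show ?thesis by (simp add: \<xi>0 \<zeta>'_def)
    qed
    have bd: "norm (\<zeta>' y $ i) \<le> R" for i
      by (rule tendsto_upperbound[OF tendsto_norm[OF lim[of i]]])
         (auto intro!: always_eventually majorized_norm_le[OF \<xi>m y])
    have Glim: "(\<lambda>k. G i (\<xi> k y)) \<longlonglongrightarrow> G i (\<zeta>' y)"
    proof (rule LIM_zero_cancel, rule Lim_null_comparison)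
      show "eventually (\<lambda>k. norm (G i (\<xi> k y) - G i (\<zeta>' y)) \<le> norm (\<xi> k y - \<zeta>' y) / 2) sequentially"
      proof (rule always_eventually, rule allI)
        fix k
        have "majorized r (norm (\<xi> k y - \<zeta>' y) / 2) (\<lambda>_::'k ^ 'n. G i (\<xi> k y) - G i (\<zeta>' y))"
        proof (rule Gm[where \<phi> = "\<lambda>_. \<xi> k y" and \<psi> = "\<lambda>_. \<zeta>' y"])
          show "majorized r R (\<lambda>x. \<xi> k y $ i)" for i
            by (rule majorized_weaken[OF majorized_const[OF r(2)]]) (rule majorized_norm_le[OF \<xi>m y])
          show "majorized r R (\<lambda>x. \<zeta>' y $ i)" for i
            by (rule majorized_weaken[OF majorized_const[OF r(2)]]) (rule bd)
          show "majorized r (norm (\<xi> k y - \<zeta>' y)) (\<lambda>x. \<xi> k y $ i - \<zeta>' y $ i)" for i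
            using Finite_Cartesian_Product.norm_nth_le[of "\<xi> k y - \<zeta>' y" i]
            by (intro majorized_weaken[OF majorized_const[OF r(2)]]) simp
        qed
        from majorized_norm_le[OF this y]
        show "norm (G i (\<xi> k y) - G i (\<zeta>' y)) \<le> norm (\<xi> k y - \<zeta>' y) / 2" .
      qed
      have "(\<lambda>k. \<xi> k y) \<longlonglongrightarrow> \<zeta>' y" by (rule vec_tendstoI) (rule lim)
      then have "(\<lambda>k. norm (\<xi> k y - \<zeta>' y)) \<longlonglongrightarrow> 0"
        by (intro tendsto_norm_zero LIM_zero)
      from tendsto_mult_left_zero[OF this, of "1/2"]
      show "(\<lambda>k. norm (\<xi> k y - \<zeta>' y) / 2) \<longlonglongrightarrow> 0" by simp
    qed
    have "(\<lambda>k. \<xi> (Suc k) y $ i) \<longlonglongrightarrow> y $ i - G i (\<zeta>' y)"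
      unfolding \<xi>S T_def vec_lambda_beta by (intro tendsto_diff tendsto_const Glim)
    moreover have "(\<lambda>k. \<xi> (Suc k) y $ i) \<longlonglongrightarrow> \<zeta>' y $ i" by (rule LIMSEQ_Suc[OF lim])
    ultimately have "y $ i - G i (\<zeta>' y) = \<zeta>' y $ i" by (rule LIMSEQ_unique)
    then show ?thesis by (metis diff_add_cancel)
  qed
  show ?thesis using that[OF r(1) \<zeta>m \<zeta>0 fix_pt] .
qed

definition jacobian :: "('k::analytic_scalar ^ 'n \<Rightarrow> 'k ^ 'l) \<Rightarrow> 'k ^ 'n \<Rightarrow> 'k ^ 'n ^ 'l" where
  "jacobian \<phi> p = (\<chi> i j. pd j (\<lambda>q. \<phi> q $ i) p)"

lemma jacobian_compose:
  assumes "\<And>i. kanalytic_at (\<lambda>q. \<psi> q $ i) (\<phi> p)" "\<And>i. kanalytic_at (\<lambda>q. \<phi> q $ i) p"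
  shows "jacobian (\<lambda>q. \<psi> (\<phi> q)) p = jacobian \<psi> (\<phi> p) ** jacobian \<phi> p"
proof -
  have "pd j (\<lambda>q. \<psi> (\<phi> q) $ i) p = (\<Sum>k\<in>UNIV. pd k (\<lambda>q. \<psi> q $ i) (\<phi> p) * pd j (\<lambda>q. \<phi> q $ k) p)" for i j
    by (rule pd_chain[OF assms])
  then show ?thesis by (simp only: jacobian_def matrix_matrix_mult_def vec_lambda_beta)
qed

lemma jacobian_ident: "jacobian (\<lambda>q. q) p = mat 1"
  unfolding jacobian_def mat_def pd_coord by (simp add: vec_eq_iff)

lemma jacobian_cong:
  assumes "eventually (\<lambda>q. \<phi> q = \<psi> q) (nhds p)"
  shows "jacobian \<phi> p = jacobian \<psi> p"
proof -
  have "pd j (\<lambda>q. \<phi> q $ i) p = pd j (\<lambda>q. \<psi> q $ i) p" for i j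
    by (rule pd_cong, rule eventually_mono[OF assms]) simp
  then show ?thesis by (simp add: jacobian_def)
qed

text \<open>
  Composition with the inverse \<open>L\<close> of the derivative turns the map into a perturbation \<open>x + G x\<close> of
  the identity without linear terms in \<open>G\<close>.
\<close>

lemma local_right_inverse:
  fixes \<phi> :: "'k::analytic_scalar ^ 'n \<Rightarrow> 'k ^ 'n"
  assumes \<phi>: "\<And>i. kanalytic_at (\<lambda>q. \<phi> q $ i) p" and L: "L ** jacobian \<phi> p = mat 1"
  obtains \<psi> where "\<And>i. kanalytic_at (\<lambda>y. \<psi> y $ i) (\<phi> p)" "\<psi> (\<phi> p) = p"
    "eventually (\<lambda>y. \<phi> (\<psi> y) = y) (nhds (\<phi> p))"
proof -
  have L': "jacobian \<phi> p ** L = mat 1" using L by (rule matrix_left_right_inverse[THEN iffD1])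
  define G where "G i x = (\<Sum>j\<in>UNIV. L $ i $ j * (\<phi> (p + x) $ j - \<phi> p $ j)) - x $ i" for i x
  have an_tr: "kanalytic_at (\<lambda>x. \<phi> (p + x) $ j) 0" for j
    using \<phi>[of j] by (simp add: kanalytic_at_iff_power_series)
  have an: "kanalytic_at (\<lambda>x. \<Sum>j\<in>UNIV. L $ i $ j * (\<phi> (p + x) $ j - \<phi> p $ j)) 0" for i
    by (intro kanalytic_at_sum kanalytic_at_mult kanalytic_at_diff kanalytic_at_const an_tr)
  have Gan: "kanalytic_at (G i) 0" for i
    unfolding G_def by (intro kanalytic_at_diff an kanalytic_at_coord)
  have Gpd: "pd k (G i) 0 = 0" for i k
  proof -
    have "pd k (\<lambda>x. \<phi> (p + x) $ j) 0 = jacobian \<phi> p $ j $ k" for j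
      using pd_translate[of k "\<lambda>q. \<phi> q $ j" p 0] by (simp add: jacobian_def)
    then have "pd k (G i) 0 = (\<Sum>j\<in>UNIV. L $ i $ j * jacobian \<phi> p $ j $ k) - (if k = i then 1 else 0)"
      unfolding G_def
      by (simp add: pd_diff an an_tr kanalytic_at_coord kanalytic_at_const kanalytic_at_diff pd_sum
            kanalytic_at_mult pd_cmult pd_const pd_coord)
    also have "(\<Sum>j\<in>UNIV. L $ i $ j * jacobian \<phi> p $ j $ k) = (L ** jacobian \<phi> p) $ i $ k"
      by (simp add: matrix_matrix_mult_def)
    finally show ?thesis by (simp add: L mat_def)
  qed
  have G0: "G i 0 = 0" for i by (simp add: G_def)
  have "eventually (\<lambda>r. \<forall>i. \<exists>C. majorized r C (G i)) (at_right 0)"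
  proof (rule eventually_all_finite_type)
    fix i
    obtain C where "eventually (\<lambda>r. majorized r C (\<lambda>x. G i (0 + x))) (at_right 0)"
      using kanalytic_at_majorized[OF Gan] .
    then show "eventually (\<lambda>r. \<exists>C. majorized r C (G i)) (at_right 0)"
      by eventually_elim auto
  qed
  then obtain S where S: "0 < S" "\<And>i. \<exists>C. majorized S C (G i)" by (rule eventually_positive_radius) auto
  then obtain c where c: "\<And>i. power_series S (c i) (G i)" unfolding majorized_def by metis
  have c0: "c i m = 0" if "mdeg m < 2" for i m
  proof (cases "mdeg m = 0")
    case True
    then have "m = (\<lambda>_. 0)" by (auto simp: mdeg_def fun_eq_iff)
    then show ?thesis using power_series_at_0[OF c] S by (simp add: G0)
  next
    case False
    then obtain k where k: "m k > 0" by (auto simp: mdeg_def)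
    have "m k + (\<Sum>j\<in>UNIV - {k}. m j) < 2" using that by (simp add: mdeg_remove[of m k])
    then have "m k = 1 \<and> (\<Sum>j\<in>UNIV - {k}. m j) = 0" using k by linarith
    then have m: "m = (\<lambda>_. 0)(k := 1)" by (auto simp: fun_eq_iff)
    have "power_series (S/2) (pd_coeffs k (c i)) (pd k (G i))" by (rule power_series_pd[OF c]) (use S in auto)
    then have "pd k (G i) 0 = pd_coeffs k (c i) (\<lambda>_. 0)" by (rule power_series_at_0) (use S in auto)
    then have "pd_coeffs k (c i) (\<lambda>_. 0) = 0" using Gpd by simp
    then show ?thesis by (simp add: pd_coeffs_def m)
  qed
  obtain r C \<zeta> where r: "0 < r" and \<zeta>: "\<And>i. majorized r C (\<lambda>y. \<zeta> y $ i)" "\<zeta> 0 = 0"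
    "\<And>y i. y \<in> polydisc r \<Longrightarrow> \<zeta> y $ i + G i (\<zeta> y) = y $ i"
    by (rule inverse_near_identity[where S = S and c = c and G = G, OF S(1) c c0], assumption) (rule that)
  define lin where "lin y = L *v (y - \<phi> p)" for y
  define \<psi> where "\<psi> y = p + \<zeta> (lin y)" for y
  have lin_an: "kanalytic_at (\<lambda>y. lin y $ i) q" for i q
    unfolding lin_def matrix_vector_mult_def vec_lambda_beta vector_minus_component
    by (intro kanalytic_at_sum kanalytic_at_mult kanalytic_at_diff kanalytic_at_const kanalytic_at_coord)
  have lin0: "lin (\<phi> p) = 0" by (simp add: lin_def)
  have \<zeta>an: "kanalytic_at (\<lambda>y. \<zeta> y $ i) 0" for i
    by (rule kanalytic_atI[OF r]) (use \<zeta>(1)[of i] in simp)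
  have "kanalytic_at (\<lambda>y. \<psi> y $ i) (\<phi> p)" for i
    using kanalytic_at_compose[of "\<lambda>y. \<zeta> y $ i" lin "\<phi> p"] \<zeta>an lin_an
    by (simp add: \<psi>_def lin0 kanalytic_at_add kanalytic_at_const)
  moreover have "\<psi> (\<phi> p) = p" by (simp add: \<psi>_def lin0 \<zeta>(2))
  moreover have "eventually (\<lambda>y. \<phi> (\<psi> y) = y) (nhds (\<phi> p))"
  proof -
    have "isCont lin (\<phi> p)" by (rule kanalytic_map_isCont) (rule lin_an)
    then have "filterlim lin (nhds 0) (nhds (\<phi> p))"
      using lin0 by (simp add: isCont_def tendsto_nhds_iff)
    from eventually_compose_filterlim[OF eventually_polydisc[OF r, of 0] this]
    show ?thesis
    proof eventually_elim
      case (elim y)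
      then have y: "lin y \<in> polydisc r" by (auto simp: polydisc_def less_imp_le)
      have "L *v (\<phi> (\<psi> y) - \<phi> p) = lin y"
        using \<zeta>(3)[OF y] by (simp add: G_def \<psi>_def vec_eq_iff matrix_vector_mult_def)
      then have "jacobian \<phi> p *v (L *v (\<phi> (\<psi> y) - \<phi> p)) = jacobian \<phi> p *v (L *v (y - \<phi> p))"
        by (simp add: lin_def)
      then show ?case by (simp add: matrix_vector_mul_assoc L')
    qed
  qed
  ultimately show ?thesis using that by blast
qed

definition analytic_chart ::
    "('k::analytic_scalar ^ 'n) set \<Rightarrow> ('k ^ 'n \<Rightarrow> 'k ^ 'n) \<Rightarrow> ('k ^ 'n \<Rightarrow> 'k ^ 'n) \<Rightarrow> ('k ^ 'n) set \<Rightarrow> bool"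
  where
  "analytic_chart W \<phi> \<psi> P \<longleftrightarrow> open W \<and> \<phi> ` W = P \<and> kanalytic_map_on W \<phi> \<and> kanalytic_map_on P \<psi> \<and>
     (\<forall>q\<in>W. \<psi> (\<phi> q) = q) \<and> (\<forall>y\<in>P. \<phi> (\<psi> y) = y \<and> \<psi> y \<in> W)"

text \<open>
  A right inverse of the right inverse has to be the original map, so that right inverses
  are two-sided.
\<close>

lemma local_inverse:
  fixes \<phi> :: "'k::analytic_scalar ^ 'n \<Rightarrow> 'k ^ 'n"
  assumes \<phi>: "\<And>i. kanalytic_at (\<lambda>q. \<phi> q $ i) p" and L: "L ** jacobian \<phi> p = mat 1"
    and N: "open N" "p \<in> N"
  obtains W \<psi> r where "p \<in> W" "W \<subseteq> N" "0 < r" "analytic_chart W \<phi> \<psi> (open_polydisc (\<phi> p) r)"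
proof -
  obtain \<psi> where \<psi>: "\<And>i. kanalytic_at (\<lambda>y. \<psi> y $ i) (\<phi> p)" "\<psi> (\<phi> p) = p"
    and right: "eventually (\<lambda>y. \<phi> (\<psi> y) = y) (nhds (\<phi> p))"
    using local_right_inverse[OF \<phi> L] by blast
  have "jacobian \<phi> p ** jacobian \<psi> (\<phi> p) = jacobian (\<lambda>y. \<phi> (\<psi> y)) (\<phi> p)"
    using jacobian_compose[of \<phi> \<psi> "\<phi> p"] \<phi> \<psi> by simp
  also have "\<dots> = mat 1" using jacobian_cong[OF right] by (simp add: jacobian_ident)
  finally have inv: "jacobian \<phi> p ** jacobian \<psi> (\<phi> p) = mat 1" .
  obtain \<zeta> where \<zeta>: "\<And>i. kanalytic_at (\<lambda>y. \<zeta> y $ i) p" "\<zeta> p = \<phi> p"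
    and right': "eventually (\<lambda>q. \<psi> (\<zeta> q) = q) (nhds p)"
    using local_right_inverse[OF \<psi>(1) inv, unfolded \<psi>(2)] by blast
  have "filterlim \<zeta> (nhds (\<phi> p)) (nhds p)"
    using kanalytic_map_isCont[of \<zeta> p] \<zeta> by (simp add: isCont_def tendsto_nhds_iff)
  from eventually_compose_filterlim[OF right this] right'
  have left: "eventually (\<lambda>q. \<psi> (\<phi> q) = q) (nhds p)"
    by eventually_elim metis
  have "eventually (\<lambda>q. \<forall>i. kanalytic_at (\<lambda>q. \<phi> q $ i) q) (nhds p)"
    by (intro eventually_all_finite_type eventually_kanalytic_at \<phi>)
  with left N have "eventually (\<lambda>q. \<psi> (\<phi> q) = q \<and> (\<forall>i. kanalytic_at (\<lambda>q. \<phi> q $ i) q) \<and> q \<in> N) (nhds p)"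
    by (intro eventually_conj eventually_nhds_in_open)
  then obtain B where B: "open B" "p \<in> B" "\<And>q. q \<in> B \<Longrightarrow> \<psi> (\<phi> q) = q"
    "\<And>q i. q \<in> B \<Longrightarrow> kanalytic_at (\<lambda>q. \<phi> q $ i) q" "B \<subseteq> N"
    unfolding eventually_nhds by blast
  have "filterlim \<psi> (nhds p) (nhds (\<phi> p))"
    using kanalytic_map_isCont[of \<psi> "\<phi> p"] \<psi> by (simp add: isCont_def tendsto_nhds_iff)
  from eventually_compose_filterlim[OF eventually_nhds_in_open[OF B(1,2)] this]
  have "eventually (\<lambda>y. \<psi> y \<in> B) (nhds (\<phi> p))" .
  moreover have "eventually (\<lambda>y. \<forall>i. kanalytic_at (\<lambda>y. \<psi> y $ i) y) (nhds (\<phi> p))"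
    by (intro eventually_all_finite_type eventually_kanalytic_at \<psi>)
  ultimately have "eventually (\<lambda>y. \<psi> y \<in> B \<and> (\<forall>i. kanalytic_at (\<lambda>y. \<psi> y $ i) y) \<and> \<phi> (\<psi> y) = y) (nhds (\<phi> p))"
    using right by (intro eventually_conj)
  then obtain r where r: "0 < r" and P: "\<And>y. y \<in> open_polydisc (\<phi> p) r \<Longrightarrow> \<psi> y \<in> B"
    "\<And>y i. y \<in> open_polydisc (\<phi> p) r \<Longrightarrow> kanalytic_at (\<lambda>y. \<psi> y $ i) y"
    "\<And>y. y \<in> open_polydisc (\<phi> p) r \<Longrightarrow> \<phi> (\<psi> y) = y"
    by (rule eventually_nhds_open_polydisc) blast
  define W where "W = B \<inter> \<phi> -` open_polydisc (\<phi> p) r"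
  have cont: "continuous_on B \<phi>"
    by (intro continuous_at_imp_continuous_on ballI kanalytic_map_isCont) (rule B(4))
  have "open W" unfolding W_def
    using continuous_open_preimage[OF cont B(1) open_open_polydisc] .
  moreover have "p \<in> W" using B r by (simp add: W_def open_polydisc_center)
  moreover have "W \<subseteq> N" using B by (auto simp: W_def)
  moreover have "\<phi> ` W = open_polydisc (\<phi> p) r"
    using P by (force simp: W_def image_iff)
  moreover have "kanalytic_map_on W \<phi>" "kanalytic_map_on (open_polydisc (\<phi> p) r) \<psi>"
    using B P by (auto simp: W_def kanalytic_map_on_def kanalytic_on_def)
  moreover have "\<psi> (\<phi> q) = q" if "q \<in> W" for q using that B by (auto simp: W_def)
  moreover have "\<phi> (\<psi> y) = y \<and> \<psi> y \<in> W" if "y \<in> open_polydisc (\<phi> p) r" for y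
    using that P by (auto simp: W_def)
  ultimately have "analytic_chart W \<phi> \<psi> (open_polydisc (\<phi> p) r)" "p \<in> W" "W \<subseteq> N"
    unfolding analytic_chart_def by blast+
  then show ?thesis using that r by blast
qed

section \<open>Vectors and 2-forms in three dimensions\<close>

definition vdot :: "'k::field ^ 3 \<Rightarrow> 'k ^ 3 \<Rightarrow> 'k" where
  "vdot u v = (\<Sum>i\<in>UNIV. u $ i * v $ i)"

definition vcross :: "'k::field ^ 3 \<Rightarrow> 'k ^ 3 \<Rightarrow> 'k ^ 3" where
  "vcross u v = vector [u $ 2 * v $ 3 - u $ 3 * v $ 2, u $ 3 * v $ 1 - u $ 1 * v $ 3,
     u $ 1 * v $ 2 - u $ 2 * v $ 1]"

definition triple :: "'k::field ^ 3 \<Rightarrow> 'k ^ 3 \<Rightarrow> 'k ^ 3 \<Rightarrow> 'k" where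
  "triple u v w = vdot u (vcross v w)"

lemmas vec3_simps = vdot_def vcross_def triple_def sum_3 vec_eq_iff forall_3 vector_3 algebra_simps

lemma vcross_linear:
  "vcross (u + v) w = vcross u w + vcross v w" "vcross w (u + v) = vcross w u + vcross w v"
  "vcross (c *s u) w = c *s vcross u w" "vcross w (c *s u) = c *s vcross w u"
  "vcross u u = 0" "vcross 0 u = 0" "vcross u 0 = 0"
  by (simp_all add: vec3_simps)

lemma vcross_antisym: "vcross v u = - vcross u v"
  by (simp add: vec3_simps)

lemma vdot_linear:
  "vdot (u + v) w = vdot u w + vdot v w" "vdot w (u + v) = vdot w u + vdot w v"
  "vdot (c *s u) w = c * vdot u w" "vdot w (c *s u) = c * vdot w u"
  "vdot 0 w = 0" "vdot w 0 = 0" "vdot v u = vdot u v"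
  by (simp_all add: vec3_simps)

lemma vdot_vcross: "vdot u (vcross u v) = 0" "vdot v (vcross u v) = 0"
  by (simp_all add: vec3_simps)

lemma expand_in_basis:
  "triple a b c *s w = vdot w (vcross b c) *s a + vdot w (vcross c a) *s b + vdot w (vcross a b) *s c"
  by (simp add: vec3_simps)

lemma expand_in_dual_basis:
  "triple a b c *s w = vdot w a *s vcross b c + vdot w b *s vcross c a + vdot w c *s vcross a b"
  by (simp add: vec3_simps)

lemma triple_dual_basis:
  "triple (vcross a b) (vcross b c) (vcross c a) = triple a b c ^ 2"
  by (simp add: vec3_simps power2_eq_square)

lemma triple_linear:
  "triple (u + u') v w = triple u v w + triple u' v w"
  "triple u (v + v') w = triple u v w + triple u v' w"
  "triple u v (w + w') = triple u v w + triple u v w'"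
  "triple (c *s u) v w = c * triple u v w" "triple u (c *s v) w = c * triple u v w"
  "triple u v (c *s w) = c * triple u v w"
  "triple u u w = 0" "triple u w u = 0" "triple w u u = 0"
  by (simp_all add: vec3_simps)

lemma vec_zero_scale: "c *s (v :: 'k::field ^ 'n) = 0 \<longleftrightarrow> c = 0 \<or> v = 0"
  by (auto simp: vec_eq_iff)

lemma vcross_eq_0_parallel:
  assumes "vcross a b = 0" "a \<noteq> 0"
  obtains s where "b = s *s a"
proof -
  obtain i where i: "a $ i \<noteq> 0" using assms(2) by (auto simp: vec_eq_iff)
  have e: "a $ 2 * b $ 3 = a $ 3 * b $ 2" "a $ 3 * b $ 1 = a $ 1 * b $ 3" "a $ 1 * b $ 2 = a $ 2 * b $ 1"
    using assms(1) by (auto simp: vcross_def vec_eq_iff forall_3)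
  have "\<forall>i j. a $ i * b $ j = a $ j * b $ i" unfolding forall_3 by (simp add: e)
  then have "b $ j = (b $ i / a $ i) * a $ j" for j
    using i by (simp add: field_simps)
  then have "b = (b $ i / a $ i) *s a" unfolding vec_eq_iff vector_smult_component by blast
  then show ?thesis by (rule that)
qed

lemma orthogonal_to_both_parallel:
  assumes "vdot a w = 0" "vdot b w = 0" "vcross a b \<noteq> 0"
  obtains s where "w = s *s vcross a b"
proof (rule vcross_eq_0_parallel[OF _ assms(3)])
  have "vcross (vcross a b) w = vdot a w *s b - vdot b w *s a" by (simp add: vec3_simps)
  then show "vcross (vcross a b) w = 0" using assms by simp
qed (rule that)

lemma orthogonal_to_cross_in_span:
  fixes a b u :: "'k::field ^ 3"
  assumes "vdot u (vcross a b) = 0" "vcross a b \<noteq> 0"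
  obtains \<alpha> \<beta> where "u = \<alpha> *s a + \<beta> *s b"
proof -
  define n where "n = vcross a b"
  obtain i where i: "n $ i \<noteq> 0" using assms(2) by (auto simp: vec_eq_iff n_def)
  have t: "triple a b (axis i 1) = n $ i"
    using exhaust_3[of i] by (auto simp: vec3_simps n_def axis_def)
  have "n $ i *s u = vdot u (vcross b (axis i 1)) *s a + vdot u (vcross (axis i 1) a) *s b"
    using expand_in_basis[of a b "axis i 1" u] assms(1) by (simp add: t)
  then have "(1 / n $ i) *s (n $ i *s u) =
      (1 / n $ i) *s (vdot u (vcross b (axis i 1)) *s a + vdot u (vcross (axis i 1) a) *s b)" by simp
  then have "u = (vdot u (vcross b (axis i 1)) / n $ i) *s a + (vdot u (vcross (axis i 1) a) / n $ i) *s b"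
    using i by (simp add: vec_eq_iff field_simps)
  then show ?thesis by (rule that)
qed

lemma lin_indep_triple:
  assumes ij: "i \<noteq> j" "j \<noteq> l" "i \<noteq> l"
  shows "lin_indep (*s) {i, j, l} V \<longleftrightarrow> triple (V i) (V j) (V l :: 'k::field ^ 3) \<noteq> 0"
proof
  assume t: "triple (V i) (V j) (V l) \<noteq> 0"
  show "lin_indep (*s) {i, j, l} V"
    unfolding lin_indep_def
  proof (intro allI impI)
    fix c assume "(\<Sum>m\<in>{i, j, l}. c m *s V m) = 0"
    then have z: "c i *s V i + c j *s V j + c l *s V l = 0" using ij by (simp add: add.assoc)
    have "c i * triple (V i) (V j) (V l) = 0"
      using arg_cong[OF z, of "\<lambda>x. triple x (V j) (V l)"] by (simp add: triple_linear) (simp add: triple_def vdot_linear)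
    moreover have "c j * triple (V i) (V j) (V l) = 0"
      using arg_cong[OF z, of "\<lambda>x. triple (V i) x (V l)"] by (simp add: triple_linear) (simp add: triple_def vdot_linear vcross_linear)
    moreover have "c l * triple (V i) (V j) (V l) = 0"
      using arg_cong[OF z, of "\<lambda>x. triple (V i) (V j) x"] by (simp add: triple_linear) (simp add: triple_def vdot_linear vcross_linear)
    ultimately show "\<forall>m\<in>{i, j, l}. c m = 0" using t by simp
  qed
next
  assume indep: "lin_indep (*s) {i, j, l} V"
  have L: "x = 0 \<and> y = 0 \<and> z = 0" if "x *s V i + y *s V j + z *s V l = 0" for x y z
  proof -
    define c where "c m = (if m = i then x else if m = j then y else z)" for m
    have "(\<Sum>m\<in>{i, j, l}. c m *s V m) = 0" using ij that by (simp add: c_def add.assoc)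
    then have "\<forall>m\<in>{i, j, l}. c m = 0" using indep unfolding lin_indep_def by blast
    then show ?thesis using ij by (auto simp: c_def)
  qed
  show "triple (V i) (V j) (V l) \<noteq> 0"
  proof
    assume t: "triple (V i) (V j) (V l) = 0"
    have "vcross (V j) (V l) $ m = 0" for m
    proof -
      have "vdot (axis m 1) (vcross (V j) (V l)) *s V i + vdot (axis m 1) (vcross (V l) (V i)) *s V j
          + vdot (axis m 1) (vcross (V i) (V j)) *s V l = 0"
        using expand_in_basis[of "V i" "V j" "V l" "axis m 1"] t by simp
      from L[OF this] have "vdot (axis m 1) (vcross (V j) (V l)) = 0" by blast
      then show ?thesis by (simp add: vdot_def axis_def if_distrib[of "\<lambda>x. x * _"] cong: if_cong)
    qed
    then have "vcross (V j) (V l) = 0" by (simp add: vec_eq_iff)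
    moreover have "V j \<noteq> 0" using L[of 0 1 0] by auto
    ultimately obtain s where "V l = s *s V j" by (rule vcross_eq_0_parallel)
    then have "0 *s V i + (- s) *s V j + 1 *s V l = 0" by (simp add: vec_eq_iff)
    from L[OF this] show False by simp
  qed
qed

text \<open>The vector whose contraction with the volume form \<open>dx \<and> dy \<and> dz\<close> is the given 2-form.\<close>

definition vec_of_form :: "'k::analytic_scalar ^ 3 ^ 3 \<Rightarrow> 'k ^ 3" where
  "vec_of_form \<eta> = vector [\<eta> $ 2 $ 3, \<eta> $ 3 $ 1, \<eta> $ 1 $ 2]"

definition gradient :: "('k::analytic_scalar ^ 3 \<Rightarrow> 'k) \<Rightarrow> 'k ^ 3 \<Rightarrow> 'k ^ 3" where
  "gradient f q = (\<chi> i. pd i f q)"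

text \<open>The vector dual to the 2-form \<open>da \<and> db\<close>; it spans the common kernel of \<open>da\<close> and \<open>db\<close>, the tangent line of the leaf.\<close>

definition leaf_field ::
    "('k::analytic_scalar ^ 3 \<Rightarrow> 'k) \<Rightarrow> ('k ^ 3 \<Rightarrow> 'k) \<Rightarrow> 'k ^ 3 \<Rightarrow> 'k ^ 3" where
  "leaf_field a b q = vcross (gradient a q) (gradient b q)"

lemma differential_vdot: "differential f q w = vdot (gradient f q) w"
  by (simp add: differential_def vdot_def gradient_def)

lemma vec_of_wedge: "vec_of_form (wedge_d a b q) = leaf_field a b q"
  by (simp add: vec_of_form_def wedge_d_def leaf_field_def vcross_def gradient_def)

lemma antisym_form_eq_0:
  assumes "\<And>i j. \<eta> $ i $ j = - \<eta> $ j $ (i::3)"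
  shows "\<eta> = 0 \<longleftrightarrow> vec_of_form \<eta> = (0 :: 'k::analytic_scalar ^ 3)"
proof
  assume "vec_of_form \<eta> = 0"
  then have z: "\<eta> $ 2 $ 3 = 0" "\<eta> $ 3 $ 1 = 0" "\<eta> $ 1 $ 2 = 0"
    by (auto simp: vec_of_form_def vec_eq_iff forall_3)
  have d: "\<eta> $ i $ i = 0" for i
  proof -
    have "\<eta> $ i $ i + \<eta> $ i $ i = 0" using assms[of i i] by (simp only: eq_neg_iff_add_eq_0)
    then have "(2::'k) * \<eta> $ i $ i = 0" by (simp only: mult_2)
    then show ?thesis by simp
  qed
  show "\<eta> = 0"
    using z assms[of 3 2] assms[of 1 3] assms[of 2 1] by (simp add: vec_eq_iff forall_3 d)
qed (simp add: vec_of_form_def vec_eq_iff forall_3)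

lemma wedge_d_antisym: "wedge_d a b q $ i $ j = - wedge_d a b q $ j $ i"
  by (simp add: wedge_d_def)

lemma wedge_d_eq_0: "wedge_d a b q = 0 \<longleftrightarrow> leaf_field a b q = 0"
  using antisym_form_eq_0[OF wedge_d_antisym] by (simp only: vec_of_wedge)

lemma vec_of_form_linear:
  "vec_of_form (\<eta> + \<theta>) = vec_of_form \<eta> + vec_of_form \<theta>"
  "vec_of_form (form_scale c \<eta>) = c *s vec_of_form \<eta>" "vec_of_form 0 = 0"
  by (simp_all add: vec_of_form_def form_scale_def vec_eq_iff forall_3)

lemma vec_of_form_sum: "vec_of_form (\<Sum>i\<in>I. \<eta> i) = (\<Sum>i\<in>I. vec_of_form (\<eta> i))"
  by (induction I rule: infinite_finite_induct) (auto simp: vec_of_form_linear)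

lemma lin_indep_wedges:
  "lin_indep form_scale S (\<lambda>l. wedge_d (a l) (b l) q) \<longleftrightarrow> lin_indep (*s) S (\<lambda>l. leaf_field (a l) (b l) q)"
proof -
  have "(\<Sum>l\<in>S. form_scale (c l) (wedge_d (a l) (b l) q)) = 0 \<longleftrightarrow> (\<Sum>l\<in>S. c l *s leaf_field (a l) (b l) q) = 0" for c
  proof -
    have "(\<Sum>l\<in>S. form_scale (c l) (wedge_d (a l) (b l) q)) $ i $ j
        = - (\<Sum>l\<in>S. form_scale (c l) (wedge_d (a l) (b l) q)) $ j $ i" for i j
      by (simp add: form_scale_def wedge_d_def sum_negf[symmetric] right_diff_distrib)
    from antisym_form_eq_0[OF this] show ?thesis
      by (simp add: vec_of_form_sum vec_of_form_linear vec_of_wedge)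
  qed
  then show ?thesis unfolding lin_indep_def by simp
qed

section \<open>Flow boxes\<close>

lemma local_coordinates:
  fixes a b c :: "'k::analytic_scalar ^ 3 \<Rightarrow> 'k"
  assumes an: "kanalytic_at a p" "kanalytic_at b p" "kanalytic_at c p"
    and t: "triple (gradient a p) (gradient b p) (gradient c p) \<noteq> 0" and N: "open N" "p \<in> N"
  defines "\<phi> \<equiv> \<lambda>q. vector [a q, b q, c q] :: 'k ^ 3"
  obtains W \<psi> r where "p \<in> W" "W \<subseteq> N" "0 < r" "analytic_chart W \<phi> \<psi> (open_polydisc (\<phi> p) r)"
proof -
  have \<phi>: "kanalytic_at (\<lambda>q. \<phi> q $ i) p" for i
    using exhaust_3[of i] an by (auto simp: \<phi>_def)
  have "det (jacobian \<phi> p) = triple (gradient a p) (gradient b p) (gradient c p)"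
    by (simp add: det_3 jacobian_def \<phi>_def gradient_def vec3_simps)
  then have "invertible (jacobian \<phi> p)" using t by (simp add: invertible_det_nz)
  then obtain L where L: "L ** jacobian \<phi> p = mat 1" unfolding invertible_def by blast
  show ?thesis by (rule local_inverse[OF \<phi> L N]) (rule that)
qed

lemma gradient_coord: "gradient (\<lambda>q. q $ i) p = axis i 1"
  by (auto simp: gradient_def pd_coord axis_def vec_eq_iff)

text \<open>
  In the coordinates \<open>(a, b, q $ i)\<close> the common level sets of \<open>a\<close> and \<open>b\<close> are parallel discs.
\<close>

lemma flow_box:
  fixes a b :: "'k::analytic_scalar ^ 3 \<Rightarrow> 'k"
  assumes an: "kanalytic_at a p" "kanalytic_at b p" and nz: "leaf_field a b p \<noteq> 0" and N: "open N" "p \<in> N"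
  obtains W i \<psi> r where "p \<in> W" "W \<subseteq> N" "0 < r"
    "analytic_chart W (\<lambda>q. vector [a q, b q, q $ i]) \<psi> (open_polydisc (vector [a p, b p, p $ i]) r)"
proof -
  obtain i where i: "leaf_field a b p $ i \<noteq> 0" using nz by (auto simp: vec_eq_iff)
  have "triple (gradient a p) (gradient b p) (axis i 1) = leaf_field a b p $ i"
    using exhaust_3[of i] by (auto simp: leaf_field_def vec3_simps axis_def)
  then have t: "triple (gradient a p) (gradient b p) (gradient (\<lambda>q. q $ i) p) \<noteq> 0"
    using i by (simp add: gradient_coord)
  show ?thesis by (rule local_coordinates[OF an kanalytic_at_coord t N]) (rule that)
qed

definition level_set :: "'m set \<Rightarrow> ('m \<Rightarrow> 'k) \<Rightarrow> ('m \<Rightarrow> 'k) \<Rightarrow> 'm \<Rightarrow> 'm set" where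
  "level_set N a b q = {q' \<in> N. a q' = a q \<and> b q' = b q}"

lemma pd_inverse_coordinate:
  assumes "open P" "y \<in> P" "\<And>y. y \<in> P \<Longrightarrow> \<phi> (\<psi> y) = y" "kanalytic_map_on P \<psi>"
    and a: "\<And>q. \<phi> q $ i = a q" "kanalytic_at a (\<psi> y)"
  shows "vdot (gradient a (\<psi> y)) (\<chi> l. pd j (\<lambda>y. \<psi> y $ l) y) = (if j = i then 1 else 0)"
proof -
  have "pd j (\<lambda>y. a (\<psi> y)) y = (\<Sum>l\<in>UNIV. pd l a (\<psi> y) * pd j (\<lambda>y. \<psi> y $ l) y)"
    by (rule pd_chain) (use assms in \<open>auto simp: kanalytic_map_on_def kanalytic_on_def\<close>)
  moreover have "pd j (\<lambda>y. a (\<psi> y)) y = pd j (\<lambda>y. y $ i) y"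
  proof (rule pd_cong)
    show "eventually (\<lambda>y. a (\<psi> y) = y $ i) (nhds y)"
      using eventually_nhds_in_open[OF assms(1,2)] by eventually_elim (use assms(3) a(1) in metis)
  qed
  ultimately show ?thesis by (simp add: pd_coord vdot_def gradient_def)
qed

lemma level_set_chart:
  fixes a b :: "'k::analytic_scalar ^ 3 \<Rightarrow> 'k"
  assumes an: "kanalytic_at a p" "kanalytic_at b p" and nz: "leaf_field a b p \<noteq> 0" and N: "open N" "p \<in> N"
  obtains W where "open W" "p \<in> W" "W \<subseteq> N" "\<forall>q\<in>W. path_connected (level_set W a b q)"
    "\<forall>f. kanalytic_on W f \<longrightarrow>
       (\<forall>q\<in>W. \<forall>w. differential a q w = 0 \<longrightarrow> differential b q w = 0 \<longrightarrow> differential f q w = 0) \<longrightarrow>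
       (\<forall>q\<in>W. \<forall>q'\<in>level_set W a b q. f q' = f q)"
    "\<forall>f. kanalytic_at f p \<longrightarrow> (\<forall>q\<in>level_set W a b p. f q = f p) \<longrightarrow>
       (\<forall>w. differential a p w = 0 \<longrightarrow> differential b p w = 0 \<longrightarrow> differential f p w = 0)"
proof -
  have "eventually (\<lambda>q. kanalytic_at a q \<and> kanalytic_at b q \<and> q \<in> N) (nhds p)"
    by (intro eventually_conj eventually_kanalytic_at an eventually_nhds_in_open N)
  then obtain N' where N': "open N'" "p \<in> N'" "\<And>q. q \<in> N' \<Longrightarrow> kanalytic_at a q \<and> kanalytic_at b q \<and> q \<in> N"
    unfolding eventually_nhds by blast
  obtain W i \<psi> r where box: "p \<in> W" "W \<subseteq> N'" "0 < r"
    "analytic_chart W (\<lambda>q. vector [a q, b q, q $ i]) \<psi> (open_polydisc (vector [a p, b p, p $ i]) r)"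
    by (rule flow_box[OF an nz N'(1,2)]) (rule that)
  define \<phi> where "\<phi> q = (vector [a q, b q, q $ i] :: 'k ^ 3)" for q
  have ab: "\<phi> q $ 1 = a q" "\<phi> q $ 2 = b q" for q by (simp_all add: \<phi>_def)
  have chart: "analytic_chart W \<phi> \<psi> (open_polydisc (\<phi> p) r)" using box(4) by (simp add: \<phi>_def[abs_def])
  then have W: "open W" "p \<in> W" "W \<subseteq> N'" "0 < r" "\<phi> ` W = open_polydisc (\<phi> p) r"
    "kanalytic_map_on W \<phi>" and \<psi>: "kanalytic_map_on (open_polydisc (\<phi> p) r) \<psi>"
    using box unfolding analytic_chart_def by blast+
  have inv: "\<psi> (\<phi> q) = q" if "q \<in> W" for q using chart that unfolding analytic_chart_def by blast
  have inv_right: "\<phi> (\<psi> y) = y \<and> \<psi> y \<in> W" if "y \<in> open_polydisc (\<phi> p) r" for y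
    using chart that unfolding analytic_chart_def by blast
  define P where "P = open_polydisc (\<phi> p) r"
  have P: "open P" "convex P" unfolding P_def by (rule open_open_polydisc, rule convex_open_polydisc)
  have \<phi>P: "\<phi> q \<in> P" if "q \<in> W" for q using W(5) that by (auto simp: P_def)
  note inv' = inv_right[folded P_def]
  note \<psi>P = \<psi>[folded P_def]
  have \<psi>an: "kanalytic_at (\<lambda>y. \<psi> y $ l) y" if "y \<in> P" for y l
    using \<psi>P that unfolding kanalytic_map_on_def kanalytic_on_def by blast
  have abW: "kanalytic_at a q" "kanalytic_at b q" if "q \<in> W" for q using W(3) N'(3) that by auto
  define slice where "slice q = {y \<in> P. y $ 1 = a q \<and> y $ 2 = b q}" for q
  have slice: "level_set W a b q = \<psi> ` slice q" for q
  proof (intro equalityI subsetI)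
    fix q' assume "q' \<in> level_set W a b q"
    then have "q' \<in> W" "a q' = a q" "b q' = b q" by (auto simp: level_set_def)
    then have "\<phi> q' \<in> slice q" "\<psi> (\<phi> q') = q'" using inv \<phi>P ab by (simp_all add: slice_def)
    then show "q' \<in> \<psi> ` slice q" by (metis image_eqI)
  next
    fix q' assume "q' \<in> \<psi> ` slice q"
    then obtain y where "y \<in> slice q" "q' = \<psi> y" by blast
    moreover from this have "\<phi> (\<psi> y) = y" "\<psi> y \<in> W" using inv' by (auto simp: slice_def)
    ultimately show "q' \<in> level_set W a b q" using ab[of "\<psi> y"] by (auto simp: level_set_def slice_def)
  qed
  have cs: "convex (slice q)" for q
  proof -
    have "slice q = P \<inter> ((\<lambda>y. y $ 1) -` {a q} \<inter> (\<lambda>y. y $ 2) -` {b q})" by (auto simp: slice_def)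
    moreover have "convex ((\<lambda>y. y $ i) -` {c})" for i :: 3 and c :: 'k
      by (rule convex_linear_vimage) (auto intro: linearI)
    ultimately show ?thesis using P(2) by (simp add: convex_Int)
  qed
  show ?thesis
  proof (rule that[OF W(1,2)]; (intro allI impI ballI)?)
    show "W \<subseteq> N" using W(3) N'(3) by auto
    fix q assume "q \<in> W"
    have "continuous_on (slice q) \<psi>"
      by (rule continuous_on_subset[OF kanalytic_map_continuous[OF \<psi>P]]) (auto simp: slice_def)
    then show "path_connected (level_set W a b q)"
      unfolding slice by (rule path_connected_continuous_image) (rule convex_imp_path_connected[OF cs])
  next
    fix f q q'
    assume f: "kanalytic_on W f" and
      d: "\<forall>q\<in>W. \<forall>w. differential a q w = 0 \<longrightarrow> differential b q w = 0 \<longrightarrow> differential f q w = 0"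
      and q: "q \<in> W" "q' \<in> level_set W a b q"
    have q': "q' \<in> W" "a q' = a q" "b q' = b q" using q by (auto simp: level_set_def)
    have fan: "kanalytic_at (\<lambda>y. f (\<psi> y)) y" if "y \<in> P" for y
    proof -
      have "kanalytic_at f (\<psi> y)" using f inv' that unfolding kanalytic_on_def by blast
      then show ?thesis by (rule kanalytic_at_compose[OF _ \<psi>an[OF that]])
    qed
    have "f (\<psi> (\<phi> q')) = f (\<psi> (\<phi> q))"
    proof (rule constant_along_segment[OF P(2) \<phi>P[OF q'(1)] \<phi>P[OF q(1)] fan])
      fix y assume y: "y \<in> P"
      define v where "v = (\<chi> l. pd 3 (\<lambda>y. \<psi> y $ l) y)"
      have W': "\<psi> y \<in> W" using inv' y by blast
      have "differential a (\<psi> y) v = 0" "differential b (\<psi> y) v = 0"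
        unfolding differential_vdot v_def
        using pd_inverse_coordinate[OF P(1) y _ \<psi>P ab(1) abW(1)[OF W'], of 3]
          pd_inverse_coordinate[OF P(1) y _ \<psi>P ab(2) abW(2)[OF W'], of 3] inv' by simp_all
      then have "differential f (\<psi> y) v = 0" by (rule d[rule_format, OF W'])
      moreover have "pd 3 (\<lambda>y. f (\<psi> y)) y = differential f (\<psi> y) v"
        using pd_chain[OF _ \<psi>an[OF y], of f 3] f W'
        by (simp add: kanalytic_on_def differential_def v_def)
      ultimately have "pd 3 (\<lambda>y. f (\<psi> y)) y = 0" by simp
      moreover have "(\<phi> q - \<phi> q') $ 1 = 0" "(\<phi> q - \<phi> q') $ 2 = 0" using ab q' by auto
      ultimately show "differential (\<lambda>y. f (\<psi> y)) y (\<phi> q - \<phi> q') = 0"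
        by (simp add: differential_def sum_3)
    qed
    then show "f q' = f q" using inv q(1) q'(1) by simp
  next
    fix f w
    assume f: "kanalytic_at f p" and c: "\<forall>q\<in>level_set W a b p. f q = f p"
      and w: "differential a p w = 0" "differential b p w = 0"
    have y: "\<phi> p \<in> P" "\<psi> (\<phi> p) = p" using \<phi>P W(2) inv by auto
    have fan: "kanalytic_at (\<lambda>y. f (\<psi> y)) (\<phi> p)"
      by (rule kanalytic_at_compose[OF _ \<psi>an[OF y(1)]]) (simp add: y f)
    have "eventually (\<lambda>t. \<phi> p + axis 3 t \<in> P) (nhds 0)"
    proof -
      have "isCont (\<lambda>t. \<phi> p + axis 3 t) 0"
        by (intro continuous_intros linear_continuous_at bounded_linear_axis)
      then have "filterlim (\<lambda>t. \<phi> p + axis 3 t) (nhds (\<phi> p)) (nhds 0)"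
        by (simp add: isCont_def tendsto_nhds_iff axis_def zero_vec_def[symmetric])
      then show ?thesis by (rule eventually_compose_filterlim[OF eventually_nhds_in_open[OF P(1) y(1)]])
    qed
    then have ev: "eventually (\<lambda>t. f (\<psi> (\<phi> p + axis 3 t)) = f p) (nhds 0)"
    proof eventually_elim
      case (elim t)
      then have "\<phi> p + axis 3 t \<in> slice p" using ab by (auto simp: slice_def axis_def)
      then show ?case using c slice by blast
    qed
    have p3: "pd 3 (\<lambda>y. f (\<psi> y)) (\<phi> p) = 0"
      unfolding pd_def using deriv_cong_ev[OF ev] by simp
    have ch: "pd l (\<lambda>q. f (\<psi> (\<phi> q))) p = (\<Sum>j\<in>UNIV. pd j (\<lambda>y. f (\<psi> y)) (\<phi> p) * pd l (\<lambda>q. \<phi> q $ j) p)" for l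
      using W(2,6) by (intro pd_chain[where f = "\<lambda>y. f (\<psi> y)" and \<phi> = \<phi>, OF fan])
        (auto simp: kanalytic_map_on_def kanalytic_on_def)
    have "pd l f p = pd l (\<lambda>q. f (\<psi> (\<phi> q))) p" for l
    proof (rule pd_cong)
      show "eventually (\<lambda>q. f q = f (\<psi> (\<phi> q))) (nhds p)"
        using eventually_nhds_in_open[OF W(1,2)] by eventually_elim (simp add: inv)
    qed
    then have "pd l f p = pd 1 (\<lambda>y. f (\<psi> y)) (\<phi> p) * pd l a p + pd 2 (\<lambda>y. f (\<psi> y)) (\<phi> p) * pd l b p" for l
      by (simp add: ch p3 sum_3 ab)
    then have "differential f p w = pd 1 (\<lambda>y. f (\<psi> y)) (\<phi> p) * differential a p w
        + pd 2 (\<lambda>y. f (\<psi> y)) (\<phi> p) * differential b p w"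
      by (simp add: differential_def sum_3 algebra_simps)
    then show "differential f p w = 0" using w by simp
  qed
qed

section \<open>Leaves\<close>

text \<open>
  Restricting leaves in two steps gives the same leaves as restricting them at once, since taking
  the path component of a point commutes with a further restriction.
\<close>

lemma path_component_restrict:
  "path_component_set (path_component_set S q \<inter> T) q = path_component_set (S \<inter> T) q"
proof (cases "q \<in> S \<inter> T")
  case True
  show ?thesis
  proof
    show "path_component_set (path_component_set S q \<inter> T) q \<subseteq> path_component_set (S \<inter> T) q"
      by (rule path_component_mono) (use path_component_subset in blast)
    have q: "q \<in> path_component_set (S \<inter> T) q" using True path_component_refl_eq by blast
    have "path_component_set (S \<inter> T) q \<subseteq> path_component_set S q \<inter> T"
      using path_component_mono[of "S \<inter> T" S q] path_component_subset[of "S \<inter> T" q] by blast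
    then show "path_component_set (S \<inter> T) q \<subseteq> path_component_set (path_component_set S q \<inter> T) q"
      by (rule path_component_maximal[OF q path_connected_path_component])
  qed
next
  case False
  then have "q \<notin> path_component_set S q \<inter> T" using path_component_subset by blast
  then show ?thesis using False path_component_eq_empty by metis
qed

lemma restrict_leaves_alt:
  "restrict_leaves \<L> N = {path_component_set (L \<inter> N) q | L q. L \<in> \<L> \<and> q \<in> L \<and> q \<in> N}"
  unfolding restrict_leaves_def by auto

lemma restrict_leaves_twice:
  assumes "N' \<subseteq> N"
  shows "restrict_leaves (restrict_leaves \<L> N) N' = restrict_leaves \<L> N'"
proof -
  have eq: "path_component_set (path_component_set (L \<inter> N) q0 \<inter> N') q = path_component_set (L \<inter> N') q"
    if "q \<in> path_component_set (L \<inter> N) q0" for L q0 q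
  proof -
    have "path_component_set (L \<inter> N) q0 = path_component_set (L \<inter> N) q" using path_component_eq[OF that] by simp
    then have "path_component_set (path_component_set (L \<inter> N) q0 \<inter> N') q = path_component_set ((L \<inter> N) \<inter> N') q"
      by (simp only: path_component_restrict)
    also have "(L \<inter> N) \<inter> N' = L \<inter> N'" using assms by blast
    finally show ?thesis .
  qed
  show ?thesis
  proof (intro equalityI subsetI)
    fix X assume "X \<in> restrict_leaves (restrict_leaves \<L> N) N'"
    then obtain L q0 q where L: "L \<in> \<L>" and q: "q \<in> path_component_set (L \<inter> N) q0" "q \<in> N'"
      and X: "X = path_component_set (path_component_set (L \<inter> N) q0 \<inter> N') q"
      unfolding restrict_leaves_alt[of _ N'] restrict_leaves_alt[of _ N] by blast
    have "q \<in> L" using q path_component_subset by fastforce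
    then show "X \<in> restrict_leaves \<L> N'" using L q eq[OF q(1)] X unfolding restrict_leaves_alt by blast
  next
    fix X assume "X \<in> restrict_leaves \<L> N'"
    then obtain L q where L: "L \<in> \<L>" "q \<in> L" "q \<in> N'" and X: "X = path_component_set (L \<inter> N') q"
      unfolding restrict_leaves_alt by blast
    have q: "q \<in> path_component_set (L \<inter> N) q" using L assms path_component_refl_eq by blast
    have "path_component_set (L \<inter> N) q \<in> restrict_leaves \<L> N" using L assms unfolding restrict_leaves_alt by blast
    then show "X \<in> restrict_leaves (restrict_leaves \<L> N) N'"
      using eq[OF q] X q L(3) unfolding restrict_leaves_alt[of _ N'] by blast
  qed
qed

lemma homeomorphism_image_component:
  assumes h: "homeomorphism S T h k" and q: "q \<in> S"
  shows "h ` path_component_set S q = path_component_set T (h q)"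
    "h ` connected_component_set S q = connected_component_set T (h q)"
proof -
  have imgs: "h ` S = T" "k ` T = S" "continuous_on S h" "continuous_on T k" and
    inv: "\<And>x. x \<in> S \<Longrightarrow> k (h x) = x" "\<And>y. y \<in> T \<Longrightarrow> h (k y) = y"
    using h unfolding homeomorphism_def by auto
  have hq: "h q \<in> T" "k (h q) = q" using q imgs inv by auto
  have A: "h ` path_component_set S q \<subseteq> path_component_set T (h q)" if "h ` S \<subseteq> T" "continuous_on S h" "q \<in> S"
    for h :: "'c::topological_space \<Rightarrow> 'd::topological_space" and S T q
  proof (rule path_component_maximal)
    show "h q \<in> h ` path_component_set S q" using that path_component_refl_eq[of S q] by blast
    have "continuous_on (path_component_set S q) h"
      using that(2) path_component_subset continuous_on_subset by blast
    then show "path_connected (h ` path_component_set S q)"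
      by (rule path_connected_continuous_image) simp
    show "h ` path_component_set S q \<subseteq> T" using that(1) path_component_subset[of S q] by blast
  qed
  have B: "h ` connected_component_set S q \<subseteq> connected_component_set T (h q)"
    if "h ` S \<subseteq> T" "continuous_on S h" "q \<in> S"
    for h :: "'c::topological_space \<Rightarrow> 'd::topological_space" and S T q
  proof (rule connected_component_maximal)
    show "h q \<in> h ` connected_component_set S q" using that connected_component_refl_eq[of S q] by blast
    have "continuous_on (connected_component_set S q) h"
      using that(2) connected_component_subset continuous_on_subset by blast
    then show "connected (h ` connected_component_set S q)"
      by (rule connected_continuous_image) simp
    show "h ` connected_component_set S q \<subseteq> T" using that(1) connected_component_subset[of S q] by blast
  qed
  have pull_back: "X \<subseteq> h ` Y" if "k ` X \<subseteq> Y" "X \<subseteq> T" for X Y using that inv(2) by force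
  show "h ` path_component_set S q = path_component_set T (h q)"
  proof
    show "h ` path_component_set S q \<subseteq> path_component_set T (h q)" using A[of h S T q] imgs q by blast
    have "k ` path_component_set T (h q) \<subseteq> path_component_set S q"
      using A[of k T S "h q"] imgs hq by simp
    then show "path_component_set T (h q) \<subseteq> h ` path_component_set S q"
      by (rule pull_back) (rule path_component_subset)
  qed
  show "h ` connected_component_set S q = connected_component_set T (h q)"
  proof
    show "h ` connected_component_set S q \<subseteq> connected_component_set T (h q)" using B[of h S T q] imgs q by blast
    have "k ` connected_component_set T (h q) \<subseteq> connected_component_set S q"
      using B[of k T S "h q"] imgs hq by simp
    then show "connected_component_set T (h q) \<subseteq> h ` connected_component_set S q"
      by (rule pull_back) (rule connected_component_subset)
  qed
qed

lemma homeomorphism_restrict: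
  assumes "homeomorphism S T h k" "S' \<subseteq> S"
  shows "homeomorphism S' (h ` S') h k"
proof -
  have h: "\<forall>x\<in>S. k (h x) = x" "continuous_on S h" "continuous_on T k" "h ` S = T"
    using assms(1) unfolding homeomorphism_def by auto
  have "k ` h ` S' = S'" using h(1) assms(2) by force
  moreover have "h ` S' \<subseteq> T" using h(4) assms(2) by blast
  moreover have "\<forall>y\<in>h ` S'. h (k y) = y" "\<forall>x\<in>S'. k (h x) = x" using h(1) assms(2) by auto
  ultimately show ?thesis
    unfolding homeomorphism_def
    using continuous_on_subset[OF h(2) assms(2)] continuous_on_subset[OF h(3)] by blast
qed

lemma restrict_leaves_image:
  assumes h: "homeomorphism D E h k" and N: "N \<subseteq> D"
  shows "restrict_leaves ((\<lambda>L. h ` L) ` restrict_leaves \<L> D) (h ` N) = (\<lambda>L. h ` L) ` restrict_leaves \<L> N"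
proof -
  define \<K> where "\<K> = restrict_leaves \<L> D"
  have sub: "L \<subseteq> D" if "L \<in> \<K>" for L
    using that path_component_subset unfolding \<K>_def restrict_leaves_def by fastforce
  have inj: "inj_on h D" using h unfolding homeomorphism_def by (metis inj_onI)
  have int: "h ` L \<inter> h ` N = h ` (L \<inter> N)" if "L \<in> \<K>" for L
    using inj_on_image_Int[OF inj sub[OF that] N] by simp
  have pc: "path_component_set (h ` L \<inter> h ` N) (h q) = h ` path_component_set (L \<inter> N) q"
    if "L \<in> \<K>" "q \<in> L" "q \<in> N" for L q
  proof -
    have "homeomorphism (L \<inter> N) (h ` (L \<inter> N)) h k" by (rule homeomorphism_restrict[OF h]) (use N in blast)
    from homeomorphism_image_component(1)[OF this, of q] show ?thesis using that int by simp
  qed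
  have "restrict_leaves ((\<lambda>L. h ` L) ` \<K>) (h ` N) = (\<lambda>L. h ` L) ` restrict_leaves \<K> N"
  proof (intro equalityI subsetI)
    fix X assume "X \<in> restrict_leaves ((\<lambda>L. h ` L) ` \<K>) (h ` N)"
    then obtain L y where L: "L \<in> \<K>" "y \<in> h ` L \<inter> h ` N" "X = path_component_set (h ` L \<inter> h ` N) y"
      unfolding restrict_leaves_def by blast
    then obtain q where "q \<in> L" "q \<in> N" "y = h q" using int[OF L(1)] by auto
    then show "X \<in> (\<lambda>L. h ` L) ` restrict_leaves \<K> N"
      using L pc[OF L(1)] unfolding restrict_leaves_alt by blast
  next
    fix X assume "X \<in> (\<lambda>L. h ` L) ` restrict_leaves \<K> N"
    then obtain L q where L: "L \<in> \<K>" "q \<in> L" "q \<in> N" "X = h ` path_component_set (L \<inter> N) q"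
      unfolding restrict_leaves_alt by blast
    then have "X = path_component_set (h ` L \<inter> h ` N) (h q)" using pc by simp
    then show "X \<in> restrict_leaves ((\<lambda>L. h ` L) ` \<K>) (h ` N)"
      unfolding restrict_leaves_def using L by blast
  qed
  then show ?thesis using restrict_leaves_twice[OF N] by (simp add: \<K>_def)
qed

lemma level_curves_image:
  assumes h: "homeomorphism N N' h k"
    and ab: "\<And>q. q \<in> N \<Longrightarrow> a q = a' (h q)" "\<And>q. q \<in> N \<Longrightarrow> b q = b' (h q)"
  shows "(\<lambda>L. h ` L) ` level_curves N a b = level_curves N' a' b'"
proof -
  have "(\<lambda>L. h ` L) ` components {q \<in> N. a q = c \<and> b q = d} = components {y \<in> N'. a' y = c \<and> b' y = d}" for c d
  proof -
    define S where "S = {q \<in> N. a q = c \<and> b q = d}"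
    define T where "T = {y \<in> N'. a' y = c \<and> b' y = d}"
    have T: "T = h ` S"
      using h ab unfolding homeomorphism_def S_def T_def by (auto simp: image_iff)
    have hST: "homeomorphism S T h k" unfolding T by (rule homeomorphism_restrict[OF h]) (auto simp: S_def)
    have "(\<lambda>L. h ` L) ` components S = (\<lambda>q. connected_component_set T (h q)) ` S"
      unfolding components_def image_image
      using homeomorphism_image_component(2)[OF hST] by (intro image_cong) auto
    also have "\<dots> = components T" unfolding components_def T by auto
    finally show ?thesis by (simp add: S_def T_def)
  qed
  then show ?thesis unfolding level_curves_def by (simp add: image_UN)
qed

definition leaf_functions ::
    "('k::analytic_scalar ^ 3) set \<Rightarrow> ('k ^ 3 \<Rightarrow> 'k) \<Rightarrow> ('k ^ 3 \<Rightarrow> 'k) \<Rightarrow> bool" where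
  "leaf_functions N a b \<longleftrightarrow>
     open N \<and> kanalytic_on N a \<and> kanalytic_on N b \<and> (\<forall>q\<in>N. leaf_field a b q \<noteq> 0)"

lemma leaf_functions_basic:
  "open N \<Longrightarrow> basic_functions N a b \<L> \<longleftrightarrow> leaf_functions N a b \<and> \<L> = level_curves N a b"
  unfolding basic_functions_def leaf_functions_def by (auto simp: wedge_d_eq_0)

lemma leaf_functions_subset:
  "leaf_functions N a b \<Longrightarrow> open N' \<Longrightarrow> N' \<subseteq> N \<Longrightarrow> leaf_functions N' a b"
  unfolding leaf_functions_def kanalytic_on_def by blast

lemma leaf_functions_at:
  "leaf_functions N a b \<Longrightarrow> p \<in> N \<Longrightarrow> kanalytic_at a p" "leaf_functions N a b \<Longrightarrow> p \<in> N \<Longrightarrow> kanalytic_at b p"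
  "leaf_functions N a b \<Longrightarrow> p \<in> N \<Longrightarrow> leaf_field a b p \<noteq> 0" "leaf_functions N a b \<Longrightarrow> open N"
  unfolding leaf_functions_def kanalytic_on_def by blast+

lemma locally_path_connected_level_set:
  assumes "leaf_functions N a b"
  shows "locally path_connected (level_set N a b q)"
  unfolding locally_path_connected
proof (intro allI impI)
  fix V x assume "openin (top_of_set (level_set N a b q)) V \<and> x \<in> V"
  then obtain O' where O': "open O'" "V = level_set N a b q \<inter> O'" "x \<in> V" by (auto simp: openin_open)
  then have x: "x \<in> N" "x \<in> O'" "a x = a q" "b x = b q" by (auto simp: level_set_def)
  have N: "open (N \<inter> O')" "x \<in> N \<inter> O'" using O' x leaf_functions_at(4)[OF assms] by auto
  obtain W where W: "open W" "x \<in> W" "W \<subseteq> N \<inter> O'" and pcW: "\<forall>q\<in>W. path_connected (level_set W a b q)"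
    by (rule level_set_chart[OF leaf_functions_at(1-3)[OF assms x(1)] N]) (rule that)
  have e: "level_set W a b x = level_set N a b q \<inter> W" using W(3) x by (auto simp: level_set_def)
  show "\<exists>U. openin (top_of_set (level_set N a b q)) U \<and> path_connected U \<and> x \<in> U \<and> U \<subseteq> V"
  proof (intro exI conjI)
    show "openin (top_of_set (level_set N a b q)) (level_set W a b x)"
      unfolding e using W(1) by (simp add: openin_open_Int)
    show "path_connected (level_set W a b x)" by (rule pcW[rule_format, OF W(2)])
    show "x \<in> level_set W a b x" using W(2) by (simp add: level_set_def)
    show "level_set W a b x \<subseteq> V" unfolding e O'(2) using W(3) by blast
  qed
qed

lemma level_curves_path_components:
  assumes "leaf_functions N a b"
  shows "level_curves N a b = (\<lambda>q. path_component_set (level_set N a b q) q) ` N"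
proof -
  have eq: "path_component_set (level_set N a b q) q = connected_component_set (level_set N a b q) q" for q
    by (rule path_component_eq_connected_component_set[OF locally_path_connected_level_set[OF assms]])
  have "X \<in> level_curves N a b \<longleftrightarrow> (\<exists>q\<in>N. X = connected_component_set (level_set N a b q) q)" for X
  proof
    assume "X \<in> level_curves N a b"
    then obtain c d q where q: "q \<in> N" "a q = c" "b q = d"
      "X = connected_component_set {q \<in> N. a q = c \<and> b q = d} q"
      unfolding level_curves_def components_def by auto
    then show "\<exists>q\<in>N. X = connected_component_set (level_set N a b q) q"
      by (intro bexI[of _ q]) (simp_all add: level_set_def)
  next
    assume "\<exists>q\<in>N. X = connected_component_set (level_set N a b q) q"
    then obtain q where q: "q \<in> N" "X = connected_component_set (level_set N a b q) q" by blast
    then have "X \<in> components {q' \<in> N. a q' = a q \<and> b q' = b q}"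
      unfolding components_def level_set_def by blast
    then show "X \<in> level_curves N a b" unfolding level_curves_def by blast
  qed
  then show ?thesis by (auto simp: eq)
qed

lemma level_set_self: "q \<in> N \<Longrightarrow> q \<in> level_set N a b q"
  by (simp add: level_set_def)

lemma level_set_eq: "q' \<in> level_set N a b q \<Longrightarrow> level_set N a b q' = level_set N a b q"
  by (auto simp: level_set_def)

lemma restrict_level_curves:
  assumes ab: "leaf_functions N a b" and N': "open N'" "N' \<subseteq> N"
  shows "restrict_leaves (level_curves N a b) N' = level_curves N' a b"
proof -
  have pc: "path_component_set (path_component_set (level_set N a b q0) q0 \<inter> N') q
      = path_component_set (level_set N' a b q) q"
    if "q \<in> path_component_set (level_set N a b q0) q0" for q0 q
  proof -
    have "q \<in> level_set N a b q0" using that path_component_subset by blast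
    then have e: "level_set N a b q0 = level_set N a b q" using level_set_eq by metis
    have "path_component_set (level_set N a b q0) q0 = path_component_set (level_set N a b q) q"
      using path_component_eq[OF that] e by simp
    moreover have "level_set N a b q \<inter> N' = level_set N' a b q" using N' by (auto simp: level_set_def)
    ultimately show ?thesis by (simp add: path_component_restrict)
  qed
  show ?thesis
    unfolding level_curves_path_components[OF ab]
      level_curves_path_components[OF leaf_functions_subset[OF ab N']]
  proof (intro equalityI subsetI)
    fix X assume "X \<in> restrict_leaves ((\<lambda>q. path_component_set (level_set N a b q) q) ` N) N'"
    then show "X \<in> (\<lambda>q. path_component_set (level_set N' a b q) q) ` N'"
      unfolding restrict_leaves_alt using pc by blast
  next
    fix X assume "X \<in> (\<lambda>q. path_component_set (level_set N' a b q) q) ` N'"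
    then obtain q where q: "q \<in> N'" "X = path_component_set (level_set N' a b q) q" by blast
    then have "q \<in> N" using N' by blast
    then have s: "q \<in> path_component_set (level_set N a b q) q"
      using path_component_refl[OF level_set_self[OF \<open>q \<in> N\<close>]] by simp
    show "X \<in> restrict_leaves ((\<lambda>q. path_component_set (level_set N a b q) q) ` N) N'"
      unfolding restrict_leaves_alt using pc[OF s] q s \<open>q \<in> N\<close> by blast
  qed
qed

text \<open>Flow boxes give constancy on small arcs, and connectedness spreads it over the leaf.\<close>

lemma constant_on_leaf:
  assumes ab: "leaf_functions N a b" and f: "kanalytic_on N f"
    and d: "\<And>q w. q \<in> N \<Longrightarrow> differential a q w = 0 \<Longrightarrow> differential b q w = 0 \<Longrightarrow> differential f q w = 0"
    and q': "q' \<in> path_component_set (level_set N a b q) q"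
  shows "f q' = f q"
proof -
  define C where "C = path_component_set (level_set N a b q) q"
  have CN: "C \<subseteq> level_set N a b q" unfolding C_def by (rule path_component_subset)
  have "f constant_on C"
  proof (rule locally_constant_imp_constant)
    show "connected C" unfolding C_def by (intro path_connected_imp_connected path_connected_path_component)
    fix x assume x: "x \<in> C"
    then have xN: "x \<in> N" "a x = a q" "b x = b q" using CN by (auto simp: level_set_def)
    obtain W where W: "open W" "x \<in> W" "W \<subseteq> N" and
      cst: "\<forall>f. kanalytic_on W f \<longrightarrow>
       (\<forall>q\<in>W. \<forall>w. differential a q w = 0 \<longrightarrow> differential b q w = 0 \<longrightarrow> differential f q w = 0) \<longrightarrow>
       (\<forall>q\<in>W. \<forall>q'\<in>level_set W a b q. f q' = f q)"
      by (rule level_set_chart[OF leaf_functions_at(1-3)[OF ab xN(1)] leaf_functions_at(4)[OF ab] xN(1)]) (rule that)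
    have fW: "kanalytic_on W f" using f W(3) unfolding kanalytic_on_def by blast
    have "\<forall>q\<in>W. \<forall>q'\<in>level_set W a b q. f q' = f q"
      using cst fW d W(3) by blast
    moreover have "y \<in> level_set W a b x" if "y \<in> C \<inter> W" for y
      using that CN xN by (auto simp: level_set_def)
    ultimately have "f y = f x" if "y \<in> C \<inter> W" for y using that W(2) by blast
    then have "openin (top_of_set C) (C \<inter> W) \<and> x \<in> C \<inter> W \<and> (\<forall>y\<in>C \<inter> W. f y = f x)"
      using W x openin_open_Int by blast
    then show "\<exists>T. openin (top_of_set C) T \<and> x \<in> T \<and> (\<forall>y\<in>T. f y = f x)" ..
  qed
  then have "\<exists>c. \<forall>y\<in>C. f y = c" by (simp only: constant_on_def)
  then obtain c where c: "\<forall>y\<in>C. f y = c" ..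
  have "path_component (level_set N a b q) q q'" using q' by simp
  then have "q \<in> C" unfolding C_def using path_component_mem(1) path_component_refl by (metis mem_Collect_eq)
  moreover have "q' \<in> C" using q' by (simp add: C_def)
  ultimately show ?thesis using c by simp
qed

lemma level_curves_same_kernel:
  assumes ab: "leaf_functions N a b" and ab': "leaf_functions N a' b'"
    and par: "\<And>q. q \<in> N \<Longrightarrow> \<exists>s. leaf_field a' b' q = s *s leaf_field a b q"
  shows "level_curves N a b = level_curves N a' b'"
proof -
  have incl: "path_component_set (level_set N a b q) q \<subseteq> path_component_set (level_set N a' b' q) q"
    if ab: "leaf_functions N a b" and ab': "leaf_functions N a' b'"
      and par: "\<And>q. q \<in> N \<Longrightarrow> \<exists>s. leaf_field a b q = s *s leaf_field a' b' q" and q: "q \<in> N"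
    for a b a' b' :: "'a ^ 3 \<Rightarrow> 'a" and q
  proof (rule path_component_maximal[OF _ path_connected_path_component])
    show "q \<in> path_component_set (level_set N a b q) q"
      using path_component_refl[OF level_set_self[OF q]] by simp
    have ker: "differential a' q w = 0 \<and> differential b' q w = 0"
      if q: "q \<in> N" and w: "differential a q w = 0" "differential b q w = 0" for q w
    proof -
      obtain t where t: "w = t *s leaf_field a b q"
        using w leaf_functions_at(3)[OF ab q] orthogonal_to_both_parallel[of "gradient a q" w "gradient b q"]
        unfolding differential_vdot leaf_field_def by blast
      obtain s where "leaf_field a b q = s *s leaf_field a' b' q" using par[OF q] by blast
      then show ?thesis unfolding differential_vdot t leaf_field_def by (simp add: vdot_linear vdot_vcross)
    qed
    have an: "kanalytic_on N a'" "kanalytic_on N b'" using ab' unfolding leaf_functions_def by auto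
    show "path_component_set (level_set N a b q) q \<subseteq> level_set N a' b' q"
    proof
      fix y assume y: "y \<in> path_component_set (level_set N a b q) q"
      have "y \<in> N" using y path_component_subset[of "level_set N a b q" q] by (auto simp: level_set_def)
      moreover have "a' y = a' q" by (rule constant_on_leaf[OF ab an(1) _ y]) (use ker in blast)
      moreover have "b' y = b' q" by (rule constant_on_leaf[OF ab an(2) _ y]) (use ker in blast)
      ultimately show "y \<in> level_set N a' b' q" by (simp add: level_set_def)
    qed
  qed
  have par': "\<exists>s. leaf_field a b q = s *s leaf_field a' b' q" if q: "q \<in> N" for q
  proof -
    obtain s where s: "leaf_field a' b' q = s *s leaf_field a b q" using par[OF q] by blast
    then have "s \<noteq> 0" using leaf_functions_at(3)[OF ab' q] by auto
    then have "leaf_field a b q = (1 / s) *s leaf_field a' b' q" using s by (simp add: vec_eq_iff)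
    then show ?thesis by blast
  qed
  have "path_component_set (level_set N a b q) q = path_component_set (level_set N a' b' q) q" if "q \<in> N" for q
    using incl[OF ab ab' par' that] incl[OF ab' ab par that] by blast
  then show ?thesis
    unfolding level_curves_path_components[OF ab] level_curves_path_components[OF ab'] by (intro image_cong) auto
qed

text \<open>
  The tangent line is independent of the chosen basic functions, since these are constant
  on the same arcs.
\<close>

lemma tangent_space_leaf_field:
  assumes bf: "basic_functions N a b (restrict_leaves \<L> N)" and N: "open N" "p \<in> N"
  shows "tangent_space \<L> p = {w. differential a p w = 0 \<and> differential b p w = 0}"
proof -
  have ker: "differential a' p w = 0 \<and> differential b' p w = 0"
    if bf: "basic_functions N a b (restrict_leaves \<L> N)" and N: "open N" "p \<in> N"
      and bf': "basic_functions N' a' b' (restrict_leaves \<L> N')" and N': "open N'" "p \<in> N'"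
      and w: "differential a p w = 0" "differential b p w = 0" for N a b N' a' b' w
  proof -
    have ab: "leaf_functions N a b" and L: "restrict_leaves \<L> N = level_curves N a b"
      using bf leaf_functions_basic[OF N(1)] by auto
    have ab': "leaf_functions N' a' b'" and L': "restrict_leaves \<L> N' = level_curves N' a' b'"
      using bf' leaf_functions_basic[OF N'(1)] by auto
    define M where "M = N \<inter> N'"
    have M: "open M" "M \<subseteq> N" "M \<subseteq> N'" "p \<in> M" using N N' by (auto simp: M_def)
    have eq: "level_curves M a b = level_curves M a' b'"
      using restrict_level_curves[OF ab M(1,2)] restrict_level_curves[OF ab' M(1,3)]
        restrict_leaves_twice[OF M(2), of \<L>] restrict_leaves_twice[OF M(3), of \<L>] L L' by simp
    have abM: "leaf_functions M a b" "leaf_functions M a' b'"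
      using leaf_functions_subset[OF ab M(1,2)] leaf_functions_subset[OF ab' M(1,3)] .
    obtain W where W: "open W" "p \<in> W" "W \<subseteq> M" and pcW: "\<forall>q\<in>W. path_connected (level_set W a b q)"
      and tan: "\<forall>f. kanalytic_at f p \<longrightarrow> (\<forall>q\<in>level_set W a b p. f q = f p) \<longrightarrow>
       (\<forall>w. differential a p w = 0 \<longrightarrow> differential b p w = 0 \<longrightarrow> differential f p w = 0)"
      by (rule level_set_chart[OF leaf_functions_at(1-3)[OF ab N(2)] M(1,4)]) (rule that)
    have "level_set W a b p \<subseteq> path_component_set (level_set M a b p) p"
      by (rule path_component_maximal[OF level_set_self[OF W(2)] pcW[rule_format, OF W(2)]]) (use W(3) in \<open>auto simp: level_set_def\<close>)
    moreover have "path_component_set (level_set M a b p) p \<in> level_curves M a' b'"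
      unfolding eq[symmetric] level_curves_path_components[OF abM(1)] using M(4) by blast
    then obtain q0 where q0: "path_component_set (level_set M a b p) p = path_component_set (level_set M a' b' q0) q0"
      unfolding level_curves_path_components[OF abM(2)] by blast
    ultimately have in_leaf: "level_set W a b p \<subseteq> level_set M a' b' q0"
      using path_component_subset[of "level_set M a' b' q0" q0] by auto
    then have c: "a' q = a' p \<and> b' q = b' p" if "q \<in> level_set W a b p" for q
    proof -
      have "q \<in> level_set M a' b' q0" "p \<in> level_set M a' b' q0"
        using in_leaf that level_set_self[OF W(2)] by blast+
      then show ?thesis by (simp add: level_set_def)
    qed
    show ?thesis
      using tan c w leaf_functions_at(1,2)[OF ab' N'(2)] by simp
  qed
  show ?thesis
  proof (intro equalityI subsetI)
    fix w assume "w \<in> tangent_space \<L> p"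
    then obtain N' a' b' where "open N'" "p \<in> N'" "basic_functions N' a' b' (restrict_leaves \<L> N')"
      "differential a' p w = 0" "differential b' p w = 0" unfolding tangent_space_def by blast
    with ker[of N' a' b' N a b w] bf N show "w \<in> {w. differential a p w = 0 \<and> differential b p w = 0}" by blast
  next
    fix w assume "w \<in> {w. differential a p w = 0 \<and> differential b p w = 0}"
    then show "w \<in> tangent_space \<L> p" unfolding tangent_space_def using bf N by blast
  qed
qed

lemma tangent_space_span:
  assumes "basic_functions N a b (restrict_leaves \<L> N)" "open N" "p \<in> N"
  shows "tangent_space \<L> p = vec.span {leaf_field a b p}"
proof -
  have nz: "leaf_field a b p \<noteq> 0" using assms by (auto simp: basic_functions_def wedge_d_eq_0)
  have "w \<in> tangent_space \<L> p \<longleftrightarrow> (\<exists>s. w = s *s leaf_field a b p)" for w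
  proof
    assume "w \<in> tangent_space \<L> p"
    then have "vdot (gradient a p) w = 0" "vdot (gradient b p) w = 0"
      unfolding tangent_space_leaf_field[OF assms] by (auto simp: differential_vdot)
    then show "\<exists>s. w = s *s leaf_field a b p"
      using orthogonal_to_both_parallel[of "gradient a p" w "gradient b p"] nz unfolding leaf_field_def by blast
  next
    assume "\<exists>s. w = s *s leaf_field a b p"
    then show "w \<in> tangent_space \<L> p"
      unfolding tangent_space_leaf_field[OF assms] by (auto simp: differential_vdot leaf_field_def vdot_linear vdot_vcross)
  qed
  then show ?thesis by (auto simp: vec.span_singleton)
qed

section \<open>Closed 2-forms as divergence-free fields\<close>

definition vanalytic_at :: "('k::analytic_scalar ^ 3 \<Rightarrow> 'k ^ 3) \<Rightarrow> 'k ^ 3 \<Rightarrow> bool" where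
  "vanalytic_at F q \<longleftrightarrow> (\<forall>i. kanalytic_at (\<lambda>q. F q $ i) q)"

lemma vanalytic_at_nth: "vanalytic_at F q \<Longrightarrow> kanalytic_at (\<lambda>q. F q $ i) q"
  by (simp add: vanalytic_at_def)

lemma vanalytic_at_scale: "kanalytic_at s q \<Longrightarrow> vanalytic_at F q \<Longrightarrow> vanalytic_at (\<lambda>q. s q *s F q) q"
  by (simp add: vanalytic_at_def kanalytic_at_mult)

lemma vanalytic_at_diff: "vanalytic_at F q \<Longrightarrow> vanalytic_at G q \<Longrightarrow> vanalytic_at (\<lambda>q. F q - G q) q"
  by (simp add: vanalytic_at_def kanalytic_at_diff)

lemma vanalytic_at_cross:
  "vanalytic_at F q \<Longrightarrow> vanalytic_at G q \<Longrightarrow> vanalytic_at (\<lambda>q. vcross (F q) (G q)) q"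
  unfolding vanalytic_at_def forall_3
  by (simp add: vcross_def kanalytic_at_diff kanalytic_at_mult)

lemma kanalytic_at_vdot:
  "vanalytic_at F q \<Longrightarrow> vanalytic_at G q \<Longrightarrow> kanalytic_at (\<lambda>q. vdot (F q) (G q)) q"
  unfolding vdot_def vanalytic_at_def by (intro kanalytic_at_sum kanalytic_at_mult) auto

lemma kanalytic_at_triple:
  "vanalytic_at F q \<Longrightarrow> vanalytic_at G q \<Longrightarrow> vanalytic_at H q \<Longrightarrow> kanalytic_at (\<lambda>q. triple (F q) (G q) (H q)) q"
  unfolding triple_def by (intro kanalytic_at_vdot vanalytic_at_cross)

lemma vanalytic_at_gradient: "kanalytic_at a q \<Longrightarrow> vanalytic_at (gradient a) q"
  by (simp add: vanalytic_at_def gradient_def kanalytic_at_pd)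

lemma vanalytic_at_leaf_field:
  "kanalytic_at a q \<Longrightarrow> kanalytic_at b q \<Longrightarrow> vanalytic_at (leaf_field a b) q"
  unfolding leaf_field_def[abs_def] by (intro vanalytic_at_cross vanalytic_at_gradient)

definition divergence :: "('k::analytic_scalar ^ 3 \<Rightarrow> 'k ^ 3) \<Rightarrow> 'k ^ 3 \<Rightarrow> 'k" where
  "divergence F q = (\<Sum>i\<in>UNIV. pd i (\<lambda>q. F q $ i) q)"

lemma kanalytic_at_divergence: "vanalytic_at F q \<Longrightarrow> kanalytic_at (divergence F) q"
  unfolding divergence_def[abs_def] by (intro kanalytic_at_sum kanalytic_at_pd vanalytic_at_nth)

lemma divergence_leaf_field:
  assumes "kanalytic_at a q" "kanalytic_at b q"
  shows "divergence (leaf_field a b) q = 0"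
proof -
  have m: "pd i (\<lambda>q. pd j a q * pd k b q - pd k a q * pd j b q) q
      = pd i (pd j a) q * pd k b q + pd j a q * pd i (pd k b) q
        - (pd i (pd k a) q * pd j b q + pd k a q * pd i (pd j b) q)" for i j k
    by (simp add: pd_diff pd_mult kanalytic_at_mult kanalytic_at_pd assms)
  have c: "pd 2 (pd 1 f) q = pd 1 (pd 2 f) q" "pd 3 (pd 1 f) q = pd 1 (pd 3 f) q"
    "pd 3 (pd 2 f) q = pd 2 (pd 3 f) q" if "kanalytic_at f q" for f
    using pd_commute[OF that] by blast+
  show ?thesis
    unfolding divergence_def sum_3 leaf_field_def vcross_def gradient_def vec_lambda_beta vector_3 m
      c[OF assms(1)] c[OF assms(2)]
    by (simp add: algebra_simps)
qed

lemma divergence_scale: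
  assumes "kanalytic_at s q" "vanalytic_at F q"
  shows "divergence (\<lambda>q. s q *s F q) q = vdot (gradient s q) (F q) + s q * divergence F q"
  unfolding divergence_def
  by (simp add: pd_mult assms vanalytic_at_nth sum.distrib vdot_def gradient_def sum_distrib_left)

lemma divergence_diff_scale:
  assumes "vanalytic_at F q" "vanalytic_at G q"
  shows "divergence (\<lambda>q. F q - c *s G q) q = divergence F q - c * divergence G q"
  unfolding divergence_def
  by (simp add: pd_diff pd_cmult kanalytic_at_mult kanalytic_at_const assms vanalytic_at_nth
      sum_subtractf sum_distrib_left)

lemma divergence_cong:
  assumes "eventually (\<lambda>q. F q = G q) (nhds p)"
  shows "divergence F p = divergence G p"
proof -
  have "pd i (\<lambda>q. F q $ i) p = pd i (\<lambda>q. G q $ i) p" for i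
    by (rule pd_cong, rule eventually_mono[OF assms]) simp
  then show ?thesis by (simp add: divergence_def)
qed

text \<open>
  For a form killed by \<open>w\<close> the Lie derivative along \<open>w\<close> is the contraction of its exterior
  derivative with \<open>w\<close>, and the latter is the divergence of the associated vector.
\<close>

lemma basic_form_parallel_closed:
  fixes \<eta> :: "'k::analytic_scalar ^ 3 \<Rightarrow> 'k ^ 3 ^ 3"
  assumes B: "open B" "q \<in> B" and \<eta>: "two_form_on B \<eta>" and w: "\<And>q. q \<in> B \<Longrightarrow> vanalytic_at w q"
    and i0: "\<And>q. q \<in> B \<Longrightarrow> interior_product w \<eta> q = 0" and L0: "lie_derivative w \<eta> q = 0" and nz: "w q \<noteq> 0"
  shows "\<exists>s. vec_of_form (\<eta> q) = s *s w q" "divergence (\<lambda>q. vec_of_form (\<eta> q)) q = 0"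
proof -
  have anti: "\<eta> x $ i $ j = - \<eta> x $ j $ i" if "x \<in> B" for x i j
    using \<eta> that unfolding two_form_on_def by blast
  have \<eta>an: "kanalytic_at (\<lambda>q. \<eta> q $ i $ j) q" for i j
    using \<eta> B(2) unfolding two_form_on_def kanalytic_on_def by blast
  have wan: "kanalytic_at (\<lambda>q. w q $ i) q" for i using w[OF B(2)] by (simp add: vanalytic_at_def)
  have ev: "eventually (\<lambda>x. x \<in> B) (nhds q)" by (rule eventually_nhds_in_open[OF B])
  have diag: "\<eta> x $ i $ i = 0" if "x \<in> B" for x i
  proof -
    have "\<eta> x $ i $ i + \<eta> x $ i $ i = 0" using anti[OF that, of i i] by (simp only: eq_neg_iff_add_eq_0)
    then have "(2::'k) * \<eta> x $ i $ i = 0" by (simp only: mult_2)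
    then show ?thesis by simp
  qed
  have ip: "(\<Sum>k\<in>UNIV. w x $ k * \<eta> x $ k $ j) = 0" if "x \<in> B" for x j
    using i0[OF that] by (simp add: interior_product_def vec_eq_iff)
  have "vcross (w q) (vec_of_form (\<eta> q)) = 0"
    using ip[OF B(2), of 1] ip[OF B(2), of 2] ip[OF B(2), of 3] diag[OF B(2)]
      anti[OF B(2), of 2 1] anti[OF B(2), of 3 2] anti[OF B(2), of 1 3]
    by (simp add: sum_3 vcross_def vec_of_form_def vec_eq_iff forall_3 algebra_simps)
  then show "\<exists>s. vec_of_form (\<eta> q) = s *s w q" using vcross_eq_0_parallel nz by blast
  define d where "d k i j = pd k (\<lambda>q. \<eta> q $ i $ j) q" for k i j
  define e where "e k i = pd k (\<lambda>q. w q $ i) q" for k i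
  have d_anti: "d k i j = - d k j i" for k i j
  proof -
    have "d k i j = pd k (\<lambda>q. - \<eta> q $ j $ i) q" unfolding d_def
      by (rule pd_cong, rule eventually_mono[OF ev]) (rule anti)
    then show ?thesis by (simp add: pd_minus \<eta>an d_def)
  qed
  have d_diag: "d k i i = 0" for k i
  proof -
    have "d k i i = pd k (\<lambda>q. 0) q" unfolding d_def
      by (rule pd_cong, rule eventually_mono[OF ev]) (rule diag)
    then show ?thesis by (simp add: pd_const)
  qed
  have dip: "(\<Sum>k\<in>UNIV. e m k * \<eta> q $ k $ j + w q $ k * d m k j) = 0" for m j
  proof -
    have "pd m (\<lambda>x. \<Sum>k\<in>UNIV. w x $ k * \<eta> x $ k $ j) q = pd m (\<lambda>x. 0) q"
      by (rule pd_cong, rule eventually_mono[OF ev]) (rule ip)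
    then show ?thesis
      by (simp add: pd_const pd_sum pd_mult kanalytic_at_mult wan \<eta>an d_def e_def)
  qed
  have L: "(\<Sum>k\<in>UNIV. w q $ k * d k i j + e i k * \<eta> q $ k $ j + e j k * \<eta> q $ i $ k) = 0" for i j
    using L0 by (simp add: lie_derivative_def vec_eq_iff d_def e_def)
  have div: "divergence (\<lambda>q. vec_of_form (\<eta> q)) q = d 1 2 3 + d 2 3 1 + d 3 1 2"
    by (simp add: divergence_def sum_3 vec_of_form_def d_def)
  have Lk: "(\<Sum>k\<in>UNIV. w q $ k * (d k i j - d i k j - d j i k)) = 0" for i j
  proof -
    have a: "\<eta> q $ i $ k = - \<eta> q $ k $ i" for k by (rule anti[OF B(2)])
    have "(\<Sum>k\<in>UNIV. w q $ k * (d k i j - d i k j - d j i k))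
       = (\<Sum>k\<in>UNIV. w q $ k * d k i j + e i k * \<eta> q $ k $ j + e j k * \<eta> q $ i $ k)
         - (\<Sum>k\<in>UNIV. e i k * \<eta> q $ k $ j + w q $ k * d i k j)
         + (\<Sum>k\<in>UNIV. e j k * \<eta> q $ k $ i + w q $ k * d j k i)"
      unfolding sum_subtractf[symmetric] sum.distrib[symmetric]
      by (rule sum.cong) (simp_all add: a d_anti[of j i] algebra_simps)
    then show ?thesis by (simp only: L dip diff_self add_0_left)
  qed
  have "w q $ 3 * divergence (\<lambda>q. vec_of_form (\<eta> q)) q = 0"
    using Lk[of 1 2] d_anti[of 2 1 3] d_anti[of 1 3 2] d_anti[of 1 2 1] d_anti[of 2 2 1]
    by (simp add: sum_3 div d_diag algebra_simps)
  moreover have "w q $ 1 * divergence (\<lambda>q. vec_of_form (\<eta> q)) q = 0"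
    using Lk[of 2 3] d_anti[of 3 2 1] d_anti[of 2 1 3]
    by (simp add: sum_3 div d_diag algebra_simps)
  moreover have "w q $ 2 * divergence (\<lambda>q. vec_of_form (\<eta> q)) q = 0"
    using Lk[of 3 1] d_anti[of 1 3 2] d_anti[of 3 2 1]
    by (simp add: sum_3 div d_diag algebra_simps)
  ultimately have "w q $ i * divergence (\<lambda>q. vec_of_form (\<eta> q)) q = 0" for i
    using exhaust_3[of i] by auto
  then show "divergence (\<lambda>q. vec_of_form (\<eta> q)) q = 0" using nz by (auto simp: vec_eq_iff)
qed

text \<open>Both contractions vanish because \<open>da(w) = db(w) = 0\<close> may be differentiated on an open set.\<close>

lemma wedge_is_basic:
  fixes a b :: "'k::analytic_scalar ^ 3 \<Rightarrow> 'k"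
  assumes B: "open B" "q \<in> B" and an: "kanalytic_at a q" "kanalytic_at b q" and w: "vanalytic_at w q"
    and ker: "\<And>q. q \<in> B \<Longrightarrow> differential a q (w q) = 0 \<and> differential b q (w q) = 0"
  shows "interior_product w (wedge_d a b) q = 0" "lie_derivative w (wedge_d a b) q = 0"
proof -
  have ev: "eventually (\<lambda>x. x \<in> B) (nhds q)" by (rule eventually_nhds_in_open[OF B])
  have k: "(\<Sum>k\<in>UNIV. pd k a q * w q $ k) = 0" "(\<Sum>k\<in>UNIV. pd k b q * w q $ k) = 0"
    using ker[OF B(2)] by (auto simp: differential_def)
  have ip: "(\<Sum>i\<in>UNIV. w q $ i * wedge_d a b q $ i $ j) = 0" for j
  proof -
    have "(\<Sum>i\<in>UNIV. w q $ i * wedge_d a b q $ i $ j)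
        = (\<Sum>k\<in>UNIV. pd k a q * w q $ k) * pd j b q - pd j a q * (\<Sum>k\<in>UNIV. pd k b q * w q $ k)"
      unfolding sum_distrib_left sum_distrib_right sum_subtractf[symmetric]
      by (rule sum.cong) (simp_all add: wedge_d_def algebra_simps)
    then show ?thesis by (simp add: k)
  qed
  then show "interior_product w (wedge_d a b) q = 0" by (simp add: interior_product_def vec_eq_iff)
  have dk: "(\<Sum>k\<in>UNIV. pd m (pd k f) q * w q $ k + pd k f q * pd m (\<lambda>q. w q $ k) q) = 0"
    if f: "kanalytic_at f q" "\<And>q. q \<in> B \<Longrightarrow> differential f q (w q) = 0" for f m
  proof -
    have "pd m (\<lambda>x. \<Sum>k\<in>UNIV. pd k f x * w x $ k) q = pd m (\<lambda>x. 0) q"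
      by (rule pd_cong, rule eventually_mono[OF ev]) (use f(2) in \<open>simp add: differential_def\<close>)
    then show ?thesis
      by (simp add: pd_const pd_sum pd_mult kanalytic_at_mult kanalytic_at_pd f(1) vanalytic_at_nth[OF w])
  qed
  have da: "(\<Sum>k\<in>UNIV. pd m (pd k a) q * w q $ k + pd k a q * pd m (\<lambda>q. w q $ k) q) = 0" for m
    by (rule dk[OF an(1)]) (use ker in blast)
  have db: "(\<Sum>k\<in>UNIV. pd m (pd k b) q * w q $ k + pd k b q * pd m (\<lambda>q. w q $ k) q) = 0" for m
    by (rule dk[OF an(2)]) (use ker in blast)
  have "(\<Sum>k\<in>UNIV. w q $ k * pd k (\<lambda>x. wedge_d a b x $ i $ j) q
     + pd i (\<lambda>x. w x $ k) q * wedge_d a b q $ k $ j + pd j (\<lambda>x. w x $ k) q * wedge_d a b q $ i $ k) = 0" for i j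
  proof -
    have pdw: "pd k (\<lambda>x. wedge_d a b x $ i $ j) q = pd k (pd i a) q * pd j b q + pd i a q * pd k (pd j b) q
        - (pd k (pd j a) q * pd i b q + pd j a q * pd k (pd i b) q)" for k
      by (simp add: wedge_d_def pd_diff pd_mult kanalytic_at_mult kanalytic_at_pd an)
    have c: "pd k (pd m f) q = pd m (pd k f) q" if "kanalytic_at f q" for k m f by (rule pd_commute[OF that])
    have "(\<Sum>k\<in>UNIV. w q $ k * pd k (\<lambda>x. wedge_d a b x $ i $ j) q
       + pd i (\<lambda>x. w x $ k) q * wedge_d a b q $ k $ j + pd j (\<lambda>x. w x $ k) q * wedge_d a b q $ i $ k)
      = (\<Sum>k\<in>UNIV. pd i (pd k a) q * w q $ k + pd k a q * pd i (\<lambda>q. w q $ k) q) * pd j b q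
        - pd j a q * (\<Sum>k\<in>UNIV. pd i (pd k b) q * w q $ k + pd k b q * pd i (\<lambda>q. w q $ k) q)
        - (\<Sum>k\<in>UNIV. pd j (pd k a) q * w q $ k + pd k a q * pd j (\<lambda>q. w q $ k) q) * pd i b q
        + pd i a q * (\<Sum>k\<in>UNIV. pd j (pd k b) q * w q $ k + pd k b q * pd j (\<lambda>q. w q $ k) q)"
      unfolding sum_distrib_left sum_distrib_right sum_subtractf[symmetric] sum.distrib[symmetric] pdw
        c[OF an(1), of _ i] c[OF an(1), of _ j] c[OF an(2), of _ i] c[OF an(2), of _ j]
      by (rule sum.cong) (simp_all add: wedge_d_def algebra_simps)
    then show ?thesis by (simp only: da db) simp
  qed
  then show "lie_derivative w (wedge_d a b) q = 0" by (simp add: lie_derivative_def vec_eq_iff)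
qed

section \<open>The rank of a 4-web\<close>

definition general_position :: "(4 \<Rightarrow> 'k::field ^ 3) \<Rightarrow> bool" where
  "general_position w \<longleftrightarrow> (\<forall>S. card S = 3 \<longrightarrow> lin_indep (*s) S w)"

lemma general_position_triple:
  fixes w :: "4 \<Rightarrow> 'k::field ^ 3"
  assumes "general_position w" "i \<noteq> j" "j \<noteq> l" "i \<noteq> l"
  shows "triple (w i) (w j) (w l) \<noteq> 0"
proof -
  have "card {i, j, l} = 3" using assms by simp
  then have "lin_indep (*s) {i, j, l} w" using assms(1) unfolding general_position_def by blast
  then show ?thesis using lin_indep_triple[OF assms(2-4)] by blast
qed

text \<open>
  If the four vectors sum to zero, a relation among three of them is a relation among the four,
  whose coefficients are then determined up to the addition of a common constant.
\<close>

lemma general_position_of_three: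
  fixes w :: "4 \<Rightarrow> 'k::field ^ 3"
  assumes z: "(\<Sum>l\<in>UNIV. w l) = 0" and S: "card S = 3" "lin_indep (*s) S w"
  shows "general_position w"
  unfolding general_position_def
proof (intro allI impI)
  fix T :: "4 set" assume T: "card T = 3"
  obtain m where m: "S = UNIV - {m}"
  proof -
    have "card (UNIV - S) = 1" using S(1) by (simp add: card_Diff_subset)
    then obtain m where "UNIV - S = {m}" by (auto simp: card_1_singleton_iff)
    then have "S = UNIV - {m}" by blast
    then show ?thesis by (rule that)
  qed
  show "lin_indep (*s) T w"
    unfolding lin_indep_def
  proof (intro allI impI)
    fix c assume "(\<Sum>i\<in>T. c i *s w i) = 0"
    define d where "d i = (if i \<in> T then c i else 0)" for i
    have d0: "(\<Sum>i\<in>UNIV. d i *s w i) = 0"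
    proof -
      have "(\<Sum>i\<in>UNIV. d i *s w i) = (\<Sum>i\<in>T. d i *s w i)"
        by (rule sum.mono_neutral_right) (auto simp: d_def)
      also have "\<dots> = (\<Sum>i\<in>T. c i *s w i)" by (rule sum.cong) (auto simp: d_def)
      finally show ?thesis using \<open>(\<Sum>i\<in>T. c i *s w i) = 0\<close> by simp
    qed
    have "(\<Sum>i\<in>UNIV. (d i - d m) *s w i) = (\<Sum>i\<in>UNIV. d i *s w i) - d m *s (\<Sum>i\<in>UNIV. w i)"
      by (simp add: vec_eq_iff sum_subtractf sum_distrib_left left_diff_distrib)
    then have "(\<Sum>i\<in>UNIV. (d i - d m) *s w i) = 0" using d0 z by simp
    moreover have "(\<Sum>i\<in>UNIV. (d i - d m) *s w i) = (\<Sum>i\<in>S. (d i - d m) *s w i)"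
      unfolding m by (rule sum.mono_neutral_right) auto
    ultimately have "(\<Sum>i\<in>S. (d i - d m) *s w i) = 0" by metis
    then have "\<forall>i\<in>S. d i - d m = 0"
      using S(2)[unfolded lin_indep_def, rule_format, of "\<lambda>i. d i - d m"] by blast
    then have all: "d i = d m" for i by (cases "i = m") (auto simp: m)
    have "T \<noteq> UNIV" using T by auto
    then obtain n where "n \<notin> T" by blast
    then have "d n = 0" by (simp add: d_def)
    then have "d i = 0" for i using all by metis
    then show "\<forall>i\<in>T. c i = 0" by (metis d_def)
  qed
qed

lemma vanalytic_at_isCont_nth: "vanalytic_at F q \<Longrightarrow> isCont (\<lambda>q. F q $ i) q"
  by (intro kanalytic_at_isCont vanalytic_at_nth)

text \<open>
  In general position the relation \<open>\<Sum>\<^sub>l E\<^sub>l = 0\<close> with \<open>E\<^sub>l\<close> along \<open>w\<^sub>l\<close> leaves a single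
  unknown function \<open>\<mu>\<close>, namely \<open>E\<^sub>l = \<mu> Y\<^sub>l\<close> with \<open>Y\<close> given by Cramer's rule. As the \<open>E\<^sub>l\<close> are
  free of divergence, the derivatives of \<open>\<mu>\<close> along the frame \<open>Y\<^sub>1, Y\<^sub>2, Y\<^sub>3\<close> are multiples of
  \<open>\<mu>\<close>. So \<open>\<mu>\<close> is determined by its value at one point: the rank is at most one.
\<close>

lemma relation_vanishes_near:
  fixes w E :: "4 \<Rightarrow> 'k::analytic_scalar ^ 3 \<Rightarrow> 'k ^ 3"
  assumes B: "open B" "p \<in> B" and w: "\<And>l q. q \<in> B \<Longrightarrow> vanalytic_at (w l) q"
    and E: "\<And>l q. q \<in> B \<Longrightarrow> vanalytic_at (E l) q"
    and gp: "\<And>q. q \<in> B \<Longrightarrow> general_position (\<lambda>l. w l q)"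
    and par: "\<And>l q. q \<in> B \<Longrightarrow> \<exists>s. E l q = s *s w l q"
    and div: "\<And>l q. q \<in> B \<Longrightarrow> divergence (E l) q = 0"
    and sum0: "\<And>q. q \<in> B \<Longrightarrow> (\<Sum>l\<in>UNIV. E l q) = 0"
    and E0: "E 4 p = 0"
  shows "eventually (\<lambda>q. \<forall>l. E l q = 0) (nhds p)"
proof -
  define D where "D q = triple (w 1 q) (w 2 q) (w 3 q)" for q
  define t1 where "t1 q = vdot (w 4 q) (vcross (w 2 q) (w 3 q))" for q
  define t2 where "t2 q = vdot (w 4 q) (vcross (w 3 q) (w 1 q))" for q
  define t3 where "t3 q = vdot (w 4 q) (vcross (w 1 q) (w 2 q))" for q
  define Y1 Y2 Y3 Y4 where "Y1 = (\<lambda>q. t1 q *s w 1 q)" and "Y2 = (\<lambda>q. t2 q *s w 2 q)"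
    and "Y3 = (\<lambda>q. t3 q *s w 3 q)" and "Y4 = (\<lambda>q. (- D q) *s w 4 q)"
  define \<mu> where "\<mu> q = triple (E 4 q) (w 1 q) (w 2 q) / triple (Y4 q) (w 1 q) (w 2 q)" for q
  have nz: "D q \<noteq> 0" "t1 q \<noteq> 0" "t2 q \<noteq> 0" "t3 q \<noteq> 0" "triple (w 4 q) (w 1 q) (w 2 q) \<noteq> 0" if "q \<in> B" for q
    using general_position_triple[OF gp[OF that], of 1 2 3] general_position_triple[OF gp[OF that], of 4 2 3]
      general_position_triple[OF gp[OF that], of 4 3 1] general_position_triple[OF gp[OF that], of 4 1 2]
    by (auto simp: D_def t1_def t2_def t3_def triple_def)
  have Y4nz: "triple (Y4 q) (w 1 q) (w 2 q) \<noteq> 0" if "q \<in> B" for q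
    using nz[OF that] unfolding Y4_def triple_linear by simp
  have an: "kanalytic_at D q" "kanalytic_at t1 q" "kanalytic_at t2 q" "kanalytic_at t3 q" if "q \<in> B" for q
    unfolding D_def[abs_def] t1_def[abs_def] t2_def[abs_def] t3_def[abs_def]
    by (intro kanalytic_at_triple kanalytic_at_vdot vanalytic_at_cross w[OF that])+
  have Yan: "vanalytic_at Y1 q" "vanalytic_at Y2 q" "vanalytic_at Y3 q" "vanalytic_at Y4 q" if "q \<in> B" for q
    unfolding Y1_def Y2_def Y3_def Y4_def
    by (intro vanalytic_at_scale kanalytic_at_minus an[OF that] w[OF that])+
  have \<mu>an: "kanalytic_at \<mu> q" if "q \<in> B" for q
    unfolding \<mu>_def[abs_def]
    by (intro kanalytic_at_divide kanalytic_at_triple E[OF that] w[OF that] Yan[OF that] Y4nz[OF that])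
  have rep: "E 1 q = \<mu> q *s Y1 q \<and> E 2 q = \<mu> q *s Y2 q \<and> E 3 q = \<mu> q *s Y3 q \<and> E 4 q = \<mu> q *s Y4 q"
    if q: "q \<in> B" for q
  proof -
    obtain s where s: "\<And>l. E l q = s l *s w l q" using par[OF q] by metis
    have m: "s 4 = - \<mu> q * D q"
      using nz[OF q] unfolding \<mu>_def Y4_def s triple_linear by simp
    have w4: "D q *s w 4 q = t1 q *s w 1 q + t2 q *s w 2 q + t3 q *s w 3 q"
      unfolding D_def t1_def t2_def t3_def by (rule expand_in_basis)
    have "(s 1 - \<mu> q * t1 q) *s w 1 q + (s 2 - \<mu> q * t2 q) *s w 2 q + (s 3 - \<mu> q * t3 q) *s w 3 q
        = (\<Sum>l\<in>UNIV. E l q) + \<mu> q *s (D q *s w 4 q - (t1 q *s w 1 q + t2 q *s w 2 q + t3 q *s w 3 q))"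
      unfolding sum_4 s m by (simp add: vec_eq_iff algebra_simps)
    also have "\<dots> = 0" by (simp add: sum0[OF q] w4)
    finally have z: "(s 1 - \<mu> q * t1 q) *s w 1 q + (s 2 - \<mu> q * t2 q) *s w 2 q + (s 3 - \<mu> q * t3 q) *s w 3 q = 0" .
    have "(s 1 - \<mu> q * t1 q) * D q = 0" "(s 2 - \<mu> q * t2 q) * D q = 0" "(s 3 - \<mu> q * t3 q) * D q = 0"
      using arg_cong[OF z, of "\<lambda>x. triple x (w 2 q) (w 3 q)"] arg_cong[OF z, of "\<lambda>x. triple (w 1 q) x (w 3 q)"]
        arg_cong[OF z, of "\<lambda>x. triple (w 1 q) (w 2 q) x"]
      unfolding triple_linear D_def by (simp_all add: triple_def vdot_linear vcross_linear)
    then have "s 1 = \<mu> q * t1 q" "s 2 = \<mu> q * t2 q" "s 3 = \<mu> q * t3 q" using nz(1)[OF q] by auto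
    then show ?thesis by (simp add: s m Y1_def Y2_def Y3_def Y4_def)
  qed
  define T where "T q = triple (Y1 q) (Y2 q) (Y3 q)" for q
  have Tnz: "T q \<noteq> 0" if "q \<in> B" for q
    using nz[OF that] unfolding T_def Y1_def Y2_def Y3_def triple_linear D_def by simp
  have Tan: "kanalytic_at T q" if "q \<in> B" for q
    unfolding T_def[abs_def] by (intro kanalytic_at_triple Yan that)
  define \<Theta> where "\<Theta> q = (- divergence Y1 q / T q) *s vcross (Y2 q) (Y3 q)
     + (- divergence Y2 q / T q) *s vcross (Y3 q) (Y1 q) + (- divergence Y3 q / T q) *s vcross (Y1 q) (Y2 q)" for q
  have \<Theta>an: "kanalytic_at (\<lambda>q. \<Theta> q $ i) q" if "q \<in> B" for i q
    unfolding \<Theta>_def[abs_def] vector_add_component vector_smult_component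
    by (intro kanalytic_at_add kanalytic_at_mult kanalytic_at_divide kanalytic_at_minus kanalytic_at_divergence
        Yan that Tan Tnz vanalytic_at_nth[OF vanalytic_at_cross])
  have grad: "gradient \<mu> q = \<mu> q *s \<Theta> q" if q: "q \<in> B" for q
  proof -
    have dY: "vdot (gradient \<mu> q) (Y q) = - \<mu> q * divergence Y q"
      if "vanalytic_at Y q" "\<And>x. x \<in> B \<Longrightarrow> E l x = \<mu> x *s Y x" for Y l
    proof -
      have "divergence (E l) q = divergence (\<lambda>x. \<mu> x *s Y x) q"
        by (rule divergence_cong, rule eventually_mono[OF eventually_nhds_in_open[OF B(1) q]]) (rule that(2))
      then show ?thesis using div[OF q] by (simp add: divergence_scale[OF \<mu>an[OF q] that(1)] eq_neg_iff_add_eq_0)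
    qed
    have "T q *s gradient \<mu> q = vdot (gradient \<mu> q) (Y1 q) *s vcross (Y2 q) (Y3 q)
       + vdot (gradient \<mu> q) (Y2 q) *s vcross (Y3 q) (Y1 q) + vdot (gradient \<mu> q) (Y3 q) *s vcross (Y1 q) (Y2 q)"
      unfolding T_def by (rule expand_in_dual_basis)
    also have "\<dots> = T q *s (\<mu> q *s \<Theta> q)"
      using dY[OF Yan(1)[OF q], of 1] dY[OF Yan(2)[OF q], of 2] dY[OF Yan(3)[OF q], of 3] rep Tnz[OF q]
      by (simp add: \<Theta>_def vec_eq_iff field_simps)
    finally have "(1 / T q) *s (T q *s gradient \<mu> q) = (1 / T q) *s (T q *s (\<mu> q *s \<Theta> q))" by simp
    then show ?thesis using Tnz[OF q] by simp
  qed
  obtain e where e: "0 < e" "cball p e \<subseteq> B" using B open_contains_cball by blast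
  have "\<exists>M. \<forall>q\<in>cball p e. norm (\<Theta> q $ i) \<le> M" for i
  proof -
    have "continuous_on (cball p e) (\<lambda>q. \<Theta> q $ i)"
      using e(2) \<Theta>an by (intro continuous_at_imp_continuous_on ballI kanalytic_at_isCont) auto
    then have "bounded ((\<lambda>q. \<Theta> q $ i) ` cball p e)"
      by (intro compact_imp_bounded compact_continuous_image compact_cball)
    then show ?thesis unfolding bounded_iff by blast
  qed
  then obtain M where M: "\<And>i q. q \<in> cball p e \<Longrightarrow> norm (\<Theta> q $ i) \<le> M i" by metis
  have "\<mu> p = 0" by (simp add: \<mu>_def E0) (simp add: triple_def vdot_linear)
  have "eventually (\<lambda>q. \<mu> q = 0) (nhds p)"
  proof (rule zero_near_zero[OF e(1), where M = "Max (range M)"])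
    fix q i assume q: "q \<in> cball p e"
    have "pd i \<mu> q = \<mu> q * \<Theta> q $ i"
      using grad[of q] q e(2) by (auto simp: gradient_def vec_eq_iff)
    moreover have "norm (\<Theta> q $ i) \<le> Max (range M)" 
      by (rule order_trans[OF M[OF q] Max_ge[OF finite_imageI[OF finite] rangeI]])
    ultimately show "norm (pd i \<mu> q) \<le> Max (range M) * norm (\<mu> q)"
      by (simp add: norm_mult mult.commute[of "norm (\<mu> q)"] mult_right_mono)
  qed (use \<mu>an e(2) \<open>\<mu> p = 0\<close> in auto)
  with eventually_nhds_in_open[OF B] show ?thesis
    by eventually_elim (use rep in \<open>auto simp: forall_4\<close>)
qed

section \<open>Potentials\<close>

lemma eventually_leaf_field_nz:
  assumes "kanalytic_at a p" "kanalytic_at b p" "leaf_field a b p $ i \<noteq> 0"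
  shows "eventually (\<lambda>q. leaf_field a b q $ i \<noteq> 0) (nhds p)"
proof -
  have "isCont (\<lambda>q. leaf_field a b q $ i) p"
    by (intro vanalytic_at_isCont_nth vanalytic_at_leaf_field assms)
  then have "((\<lambda>q. leaf_field a b q $ i) \<longlongrightarrow> leaf_field a b p $ i) (nhds p)"
    by (simp add: isCont_def tendsto_nhds_iff)
  then show ?thesis using assms(3) by (rule tendsto_imp_eventually_ne)
qed

text \<open>
  A closed basic form is \<open>s da \<and> dx\<close> with \<open>s\<close> constant along the leaves, hence a function
  of \<open>a\<close> and \<open>x\<close>; integrating it with respect to \<open>a\<close> for fixed \<open>x\<close> gives a primitive \<open>f\<close>
  with \<open>df \<and> dx = s da \<and> dx\<close>.
\<close>

lemma closed_form_potential:
  fixes a x :: "'k::analytic_scalar ^ 3 \<Rightarrow> 'k"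
  assumes an: "kanalytic_at a p" "kanalytic_at x p" and nz: "leaf_field a x p \<noteq> 0"
    and ev: "eventually (\<lambda>q. vanalytic_at E q \<and> (\<exists>s. E q = s *s leaf_field a x q) \<and> divergence E q = 0) (nhds p)"
  obtains f where "kanalytic_at f p" "eventually (\<lambda>q. leaf_field f x q = E q) (nhds p)"
proof -
  obtain i where i: "leaf_field a x p $ i \<noteq> 0" using nz by (auto simp: vec_eq_iff)
  define s where "s q = E q $ i / leaf_field a x q $ i" for q
  have "eventually (\<lambda>q. kanalytic_at a q \<and> kanalytic_at x q \<and> leaf_field a x q $ i \<noteq> 0 \<and>
     (vanalytic_at E q \<and> (\<exists>s. E q = s *s leaf_field a x q) \<and> divergence E q = 0)) (nhds p)"
    by (intro eventually_conj eventually_kanalytic_at an ev eventually_leaf_field_nz i)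
  then obtain N where N: "open N" "p \<in> N" and Np: "\<And>q. q \<in> N \<Longrightarrow> kanalytic_at a q \<and> kanalytic_at x q \<and>
     leaf_field a x q $ i \<noteq> 0 \<and> (vanalytic_at E q \<and> (\<exists>s. E q = s *s leaf_field a x q) \<and> divergence E q = 0)"
    unfolding eventually_nhds by blast
  have Es: "E q = s q *s leaf_field a x q" if q: "q \<in> N" for q
  proof -
    obtain t where "E q = t *s leaf_field a x q" using Np[OF q] by blast
    moreover from this have "s q = t" using Np[OF q] by (simp add: s_def)
    ultimately show ?thesis by simp
  qed
  have san: "kanalytic_at s q" if "q \<in> N" for q
    unfolding s_def[abs_def]
    by (intro kanalytic_at_divide vanalytic_at_nth vanalytic_at_leaf_field) (use Np[OF that] in auto)
  have ds: "vdot (gradient s q) (leaf_field a x q) = 0" if "q \<in> N" for q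
  proof -
    have "divergence E q = divergence (\<lambda>q. s q *s leaf_field a x q) q"
      by (rule divergence_cong, rule eventually_mono[OF eventually_nhds_in_open[OF N(1) that]]) (rule Es)
    then show ?thesis using Np[OF that]
      by (simp add: divergence_scale san[OF that] vanalytic_at_leaf_field divergence_leaf_field)
  qed
  obtain W m \<psi> r where box: "p \<in> W" "W \<subseteq> N" "0 < r"
    "analytic_chart W (\<lambda>q. vector [a q, x q, q $ m]) \<psi> (open_polydisc (vector [a p, x p, p $ m]) r)"
    by (rule flow_box[OF an nz N]) (rule that)
  define \<phi> where "\<phi> q = (vector [a q, x q, q $ m] :: 'k ^ 3)" for q
  have \<phi>12: "\<phi> q $ 1 = a q" "\<phi> q $ 2 = x q" "\<phi> q $ 3 = q $ m" for q by (simp_all add: \<phi>_def)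
  define P where "P = open_polydisc (\<phi> p) r"
  have P: "open P" by (simp add: P_def open_open_polydisc)
  have chart: "analytic_chart W \<phi> \<psi> P" using box(4) by (simp add: \<phi>_def[abs_def] P_def)
  have W: "open W" using chart unfolding analytic_chart_def by blast
  have inv: "\<psi> (\<phi> q) = q" "\<phi> q \<in> P" if "q \<in> W" for q using chart that unfolding analytic_chart_def by blast+
  have inv': "\<phi> (\<psi> y) = y" "\<psi> y \<in> W" if "y \<in> P" for y using chart that unfolding analytic_chart_def by blast+
  have \<psi>an: "kanalytic_map_on P \<psi>" using chart unfolding analytic_chart_def by blast
  have \<psi>an': "kanalytic_at (\<lambda>y. \<psi> y $ l) y" if "y \<in> P" for y l
    using \<psi>an that unfolding kanalytic_map_on_def kanalytic_on_def by blast
  define S where "S y = s (\<psi> y)" for y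
  have WN: "q \<in> N" if "q \<in> W" for q using box(2) that by blast
  have San: "kanalytic_at S y" if "y \<in> P" for y
    unfolding S_def[abs_def] by (rule kanalytic_at_compose[OF san[OF WN[OF inv'(2)[OF that]]] \<psi>an'[OF that]])
  have S3: "pd 3 S y = 0" if y: "y \<in> P" for y
  proof -
    define v where "v = (\<chi> l. pd 3 (\<lambda>y. \<psi> y $ l) y)"
    have N': "\<psi> y \<in> N" using WN inv'(2) y by blast
    have "vdot (gradient a (\<psi> y)) v = 0" "vdot (gradient x (\<psi> y)) v = 0"
      unfolding v_def
      using pd_inverse_coordinate[OF P y inv'(1) \<psi>an, of 1 a 3] pd_inverse_coordinate[OF P y inv'(1) \<psi>an, of 2 x 3]
        \<phi>12 Np[OF N'] by simp_all
    then obtain t where t: "v = t *s leaf_field a x (\<psi> y)"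
      using orthogonal_to_both_parallel[of "gradient a (\<psi> y)" v "gradient x (\<psi> y)"] Np[OF N']
      unfolding leaf_field_def by fastforce
    have "pd 3 S y = vdot (gradient s (\<psi> y)) v"
      unfolding S_def[abs_def] using pd_chain[OF san[OF N'] \<psi>an'[OF y], of 3]
      by (simp add: vdot_def gradient_def v_def)
    then show ?thesis using ds[OF N'] by (simp add: t vdot_linear)
  qed
  have pP: "\<phi> p \<in> P" using inv(2) box(1) by blast
  obtain R Pr where R: "0 < R" and Pr: "\<forall>q\<in>open_polydisc (\<phi> p) R. kanalytic_at Pr q \<and> pd 1 Pr q = S q"
    and Pr3: "\<forall>r\<le>R. \<forall>j. j \<noteq> 1 \<longrightarrow> (\<forall>q\<in>open_polydisc (\<phi> p) r. pd j S q = 0) \<longrightarrow>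
       (\<forall>q\<in>open_polydisc (\<phi> p) r. pd j Pr q = 0)"
    by (rule primitive[OF San[OF pP], of 1]) (rule that)
  define r' where "r' = min R r"
  define P' where "P' = open_polydisc (\<phi> p) r'"
  have P': "P' \<subseteq> P" "P' \<subseteq> open_polydisc (\<phi> p) R" "\<phi> p \<in> P'" "open P'"
    using R box(3) by (auto simp: P'_def P_def r'_def open_polydisc_mono open_polydisc_center open_open_polydisc
        intro!: open_polydisc_mono[THEN subsetD, of r'])
  have Pr3': "pd 3 Pr y = 0" if "y \<in> P'" for y
  proof -
    have "\<forall>q\<in>open_polydisc (\<phi> p) r'. pd 3 S q = 0" using P'(1) S3 by (auto simp: P'_def)
    moreover have "r' \<le> R" by (simp add: r'_def)
    moreover have "(3::3) \<noteq> 1" by simp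
    ultimately show ?thesis using Pr3 that unfolding P'_def by blast
  qed
  define f where "f q = Pr (\<phi> q)" for q
  define W' where "W' = W \<inter> \<phi> -` P'"
  have \<phi>an: "kanalytic_at (\<lambda>q. \<phi> q $ l) q" if "q \<in> W" for q l
    using chart that unfolding analytic_chart_def kanalytic_map_on_def kanalytic_on_def by blast
  have W': "open W'" unfolding W'_def
    by (rule continuous_open_preimage[OF _ W P'(4)])
       (intro continuous_at_imp_continuous_on ballI kanalytic_map_isCont \<phi>an)
  have pW': "p \<in> W'" using box(1) P' by (simp add: W'_def)
  have fan: "kanalytic_at f q" if "q \<in> W'" for q
    unfolding f_def[abs_def] by (rule kanalytic_at_compose[OF _ \<phi>an]) (use that P' Pr in \<open>auto simp: W'_def\<close>)
  have "leaf_field f x q = E q" if q: "q \<in> W'" for q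
  proof -
    have qW: "q \<in> W" "\<phi> q \<in> P'" using q by (auto simp: W'_def)
    have Prq: "kanalytic_at Pr (\<phi> q)" "pd 1 Pr (\<phi> q) = s q"
      using Pr P' qW inv(1)[OF qW(1)] by (auto simp: S_def)
    have "pd l f q = s q * pd l a q + pd 2 Pr (\<phi> q) * pd l x q" for l
      unfolding f_def[abs_def] using pd_chain[where \<phi> = \<phi>, OF Prq(1) \<phi>an[OF qW(1)], of l]
      by (simp add: sum_3 \<phi>12 Prq Pr3'[OF qW(2)])
    then have "gradient f q = s q *s gradient a q + pd 2 Pr (\<phi> q) *s gradient x q"
      by (simp add: gradient_def vec_eq_iff)
    then show ?thesis using Es[OF WN[OF qW(1)]] by (simp add: leaf_field_def vcross_linear)
  qed
  then have "eventually (\<lambda>q. leaf_field f x q = E q) (nhds p)"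
    using eventually_nhds_in_open[OF W' pW'] by (auto elim: eventually_mono)
  then show ?thesis using that fan[OF pW'] by blast
qed

text \<open>
  Three successive primitives. Each one removes a component and, by its normalization,
  does not bring back those removed before.
\<close>

lemma poincare:
  fixes \<alpha> :: "3 \<Rightarrow> 'k::analytic_scalar ^ 3 \<Rightarrow> 'k"
  assumes r: "0 < r" and an: "\<And>i q. q \<in> open_polydisc p r \<Longrightarrow> kanalytic_at (\<alpha> i) q"
    and closed: "\<And>i j q. q \<in> open_polydisc p r \<Longrightarrow> pd i (\<alpha> j) q = pd j (\<alpha> i) q"
  obtains R Q where "0 < R" "R \<le> r" "\<And>q. q \<in> open_polydisc p R \<Longrightarrow> kanalytic_at Q q"
    "\<And>i q. q \<in> open_polydisc p R \<Longrightarrow> pd i Q q = \<alpha> i q"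
proof -
  have step: "\<exists>R Q. 0 < R \<and> R \<le> r \<and> (\<forall>q\<in>open_polydisc p R. kanalytic_at Q q \<and> pd i Q q = \<beta> i q \<and>
      (\<forall>j\<in>J. pd j Q q = 0))"
    if r: "0 < r" and an: "\<And>i q. q \<in> open_polydisc p r \<Longrightarrow> kanalytic_at (\<beta> i) q"
      and closed: "\<And>i j q. q \<in> open_polydisc p r \<Longrightarrow> pd i (\<beta> j) q = pd j (\<beta> i) q"
      and J: "i \<notin> J" "\<And>j q. j \<in> J \<Longrightarrow> q \<in> open_polydisc p r \<Longrightarrow> \<beta> j q = 0" for \<beta> and r and i :: 3 and J
  proof -
    obtain R P where R: "0 < R" and P: "\<forall>q\<in>open_polydisc p R. kanalytic_at P q \<and> pd i P q = \<beta> i q"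
      and PJ: "\<forall>r\<le>R. \<forall>j. j \<noteq> i \<longrightarrow> (\<forall>q\<in>open_polydisc p r. pd j (\<beta> i) q = 0) \<longrightarrow>
       (\<forall>q\<in>open_polydisc p r. pd j P q = 0)"
      by (rule primitive[OF an[OF open_polydisc_center[OF r], of i], of i]) (rule that)
    define R' where "R' = min R r"
    have sub: "open_polydisc p R' \<subseteq> open_polydisc p R" "open_polydisc p R' \<subseteq> open_polydisc p r"
      by (rule open_polydisc_mono, simp add: R'_def)+
    have PJ0: "\<forall>q\<in>open_polydisc p R'. pd j P q = 0" if j: "j \<in> J" for j
    proof -
      have "pd j (\<beta> i) q = 0" if "q \<in> open_polydisc p R'" for q
      proof -
        have q: "q \<in> open_polydisc p r" using that sub by blast
        have "pd i (\<beta> j) q = pd i (\<lambda>q. 0) q"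
          by (rule pd_cong, rule eventually_mono[OF eventually_nhds_in_open[OF open_open_polydisc q]]) (rule J(2)[OF j])
        then show ?thesis using closed[OF q, of i j] by (simp add: pd_const)
      qed
      moreover have "R' \<le> R" "j \<noteq> i" using j J(1) by (auto simp: R'_def)
      ultimately show ?thesis using PJ by blast
    qed
    have "0 < R'" "R' \<le> r" using R r by (auto simp: R'_def)
    moreover have "\<forall>q\<in>open_polydisc p R'. kanalytic_at P q \<and> pd i P q = \<beta> i q \<and> (\<forall>j\<in>J. pd j P q = 0)"
      using P PJ0 sub by blast
    ultimately show ?thesis by blast
  qed
  have sub: "\<exists>\<beta>'. (\<forall>i. \<forall>q\<in>open_polydisc p R. \<beta>' i q = \<beta> i q - pd i Q q \<and> kanalytic_at (\<beta>' i) q) \<and>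
      (\<forall>i j. \<forall>q\<in>open_polydisc p R. pd i (\<beta>' j) q = pd j (\<beta>' i) q)"
    if an: "\<And>i q. q \<in> open_polydisc p R \<Longrightarrow> kanalytic_at (\<beta> i) q"
      and closed: "\<And>i j q. q \<in> open_polydisc p R \<Longrightarrow> pd i (\<beta> j) q = pd j (\<beta> i) q"
      and Q: "\<And>q. q \<in> open_polydisc p R \<Longrightarrow> kanalytic_at Q q" for \<beta> :: "3 \<Rightarrow> 'k ^ 3 \<Rightarrow> 'k" and R Q
  proof (intro exI[of _ "\<lambda>i q. \<beta> i q - pd i Q q"] conjI allI ballI)
    fix i j q assume q: "q \<in> open_polydisc p R"
    show "kanalytic_at (\<lambda>q. \<beta> i q - pd i Q q) q"
      by (intro kanalytic_at_diff kanalytic_at_pd an[OF q] Q[OF q])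
    show "pd i (\<lambda>q. \<beta> j q - pd j Q q) q = pd j (\<lambda>q. \<beta> i q - pd i Q q) q"
      using closed[OF q, of i j] pd_commute[OF Q[OF q], of i j]
      by (simp add: pd_diff an[OF q] Q[OF q] kanalytic_at_pd)
  qed simp
  obtain R1 Q1 where "0 < R1" "R1 \<le> r" and "\<forall>q\<in>open_polydisc p R1. kanalytic_at Q1 q \<and> pd 1 Q1 q = \<alpha> 1 q"
    using step[of r \<alpha> 1 "{}", OF r an closed] by auto
  note 1 = this(1,2) this(3)[rule_format]
  have s1: "open_polydisc p R1 \<subseteq> open_polydisc p r" by (rule open_polydisc_mono[OF 1(2)])
  have "\<exists>\<beta>'. (\<forall>i. \<forall>q\<in>open_polydisc p R1. \<beta>' i q = \<alpha> i q - pd i Q1 q \<and> kanalytic_at (\<beta>' i) q) \<and>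
      (\<forall>i j. \<forall>q\<in>open_polydisc p R1. pd i (\<beta>' j) q = pd j (\<beta>' i) q)"
    by (rule sub) (use an closed 1(3) s1 in blast)+
  then obtain \<beta> where \<beta>': "\<forall>i. \<forall>q\<in>open_polydisc p R1. \<beta> i q = \<alpha> i q - pd i Q1 q \<and> kanalytic_at (\<beta> i) q"
      "\<forall>i j. \<forall>q\<in>open_polydisc p R1. pd i (\<beta> j) q = pd j (\<beta> i) q" by blast
  note \<beta> = \<beta>'[rule_format]
  have "\<beta> 1 q = 0" if "q \<in> open_polydisc p R1" for q using \<beta>(1)[OF that, of 1] 1(3)[OF that] by simp
  then obtain R2 Q2 where "0 < R2" "R2 \<le> R1" and "\<forall>q\<in>open_polydisc p R2.
      kanalytic_at Q2 q \<and> pd 2 Q2 q = \<beta> 2 q \<and> pd 1 Q2 q = 0"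
    using step[of R1 \<beta> 2 "{1}", OF 1(1) _ \<beta>(2)] \<beta>(1) by auto
  note 2 = this(1,2) this(3)[rule_format]
  have s2: "open_polydisc p R2 \<subseteq> open_polydisc p R1" by (rule open_polydisc_mono[OF 2(2)])
  have "\<exists>\<beta>'. (\<forall>i. \<forall>q\<in>open_polydisc p R2. \<beta>' i q = \<beta> i q - pd i Q2 q \<and> kanalytic_at (\<beta>' i) q) \<and>
      (\<forall>i j. \<forall>q\<in>open_polydisc p R2. pd i (\<beta>' j) q = pd j (\<beta>' i) q)"
    by (rule sub) (use \<beta> 2(3) s2 in blast)+
  then obtain \<gamma> where \<gamma>': "\<forall>i. \<forall>q\<in>open_polydisc p R2. \<gamma> i q = \<beta> i q - pd i Q2 q \<and> kanalytic_at (\<gamma> i) q"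
      "\<forall>i j. \<forall>q\<in>open_polydisc p R2. pd i (\<gamma> j) q = pd j (\<gamma> i) q" by blast
  note \<gamma> = \<gamma>'[rule_format]
  have "\<gamma> 1 q = 0 \<and> \<gamma> 2 q = 0" if "q \<in> open_polydisc p R2" for q
    using \<gamma>(1)[OF that, of 1] \<gamma>(1)[OF that, of 2] 2(3)[OF that] \<open>\<And>q. q \<in> open_polydisc p R1 \<Longrightarrow> \<beta> 1 q = 0\<close> that s2
    by auto
  then obtain R3 Q3 where "0 < R3" "R3 \<le> R2" and "\<forall>q\<in>open_polydisc p R3.
      kanalytic_at Q3 q \<and> pd 3 Q3 q = \<gamma> 3 q \<and> pd 1 Q3 q = 0 \<and> pd 2 Q3 q = 0"
    using step[of R2 \<gamma> 3 "{1, 2}", OF 2(1) _ \<gamma>(2)] \<gamma>(1) by auto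
  note 3 = this(1,2) this(3)[rule_format]
  have s3: "open_polydisc p R3 \<subseteq> open_polydisc p R2" by (rule open_polydisc_mono[OF 3(2)])
  show ?thesis
  proof (rule that[of R3 "\<lambda>q. Q1 q + Q2 q + Q3 q"])
    show "0 < R3" "R3 \<le> r" using 1 2 3 by auto
    fix q assume q: "q \<in> open_polydisc p R3"
    have q2: "q \<in> open_polydisc p R2" and q1: "q \<in> open_polydisc p R1" using q s2 s3 by auto
    show "kanalytic_at (\<lambda>q. Q1 q + Q2 q + Q3 q) q"
      using 1(3)[OF q1] 2(3)[OF q2] 3(3)[OF q] by (intro kanalytic_at_add) auto
    have "pd i (\<lambda>q. Q1 q + Q2 q + Q3 q) q = pd i Q1 q + pd i Q2 q + pd i Q3 q" for i
      using 1(3)[OF q1] 2(3)[OF q2] 3(3)[OF q] by (simp add: pd_add kanalytic_at_add)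
    then show "pd i (\<lambda>q. Q1 q + Q2 q + Q3 q) q = \<alpha> i q" for i
      using exhaust_3[of i] 1(3)[OF q1] 2(3)[OF q2] 3(3)[OF q] \<beta>(1)[OF q1, of i] \<gamma>(1)[OF q2, of i] by auto
  qed
qed

section \<open>Flat webs in coordinates\<close>

text \<open>
  Pull-back of 2-forms in terms of their vectors: the cofactor matrix of the derivative of \<open>\<theta>\<close>,
  whose rows are the gradients \<open>g\<close>.
\<close>

definition pull_field :: "('k::analytic_scalar ^ 3 \<Rightarrow> 'k ^ 3) \<Rightarrow> 'k ^ 3 \<Rightarrow> 'k ^ 3 \<Rightarrow> 'k ^ 3" where
  "pull_field \<theta> q w =
     (let g = \<lambda>i. gradient (\<lambda>q. \<theta> q $ i) q
      in w $ 1 *s vcross (g 2) (g 3) + w $ 2 *s vcross (g 3) (g 1) + w $ 3 *s vcross (g 1) (g 2))"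

lemma leaf_field_compose:
  assumes "kanalytic_at a (\<theta> q)" "kanalytic_at b (\<theta> q)" "\<And>i. kanalytic_at (\<lambda>q. \<theta> q $ i) q"
  shows "leaf_field (\<lambda>q. a (\<theta> q)) (\<lambda>q. b (\<theta> q)) q = pull_field \<theta> q (leaf_field a b (\<theta> q))"
proof -
  define g where "g i = gradient (\<lambda>q. \<theta> q $ i) q" for i
  have c: "gradient (\<lambda>q. f (\<theta> q)) q = pd 1 f (\<theta> q) *s g 1 + pd 2 f (\<theta> q) *s g 2 + pd 3 f (\<theta> q) *s g 3"
    if "kanalytic_at f (\<theta> q)" for f
    using pd_chain[OF that assms(3)] by (simp add: gradient_def vec_eq_iff sum_3 g_def)
  show ?thesis
    unfolding leaf_field_def c[OF assms(1)] c[OF assms(2)] pull_field_def g_def[symmetric] Let_def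
    by (simp add: gradient_def vcross_def vec_eq_iff forall_3 algebra_simps)
qed

lemma pull_field_linear:
  "pull_field \<theta> q (u + v) = pull_field \<theta> q u + pull_field \<theta> q v"
  "pull_field \<theta> q (c *s u) = c *s pull_field \<theta> q u" "pull_field \<theta> q 0 = 0"
  by (simp_all add: pull_field_def Let_def vec_eq_iff algebra_simps)

lemma pull_field_sum: "pull_field \<theta> q (\<Sum>i\<in>I. w i) = (\<Sum>i\<in>I. pull_field \<theta> q (w i))"
  by (induction I rule: infinite_finite_induct) (auto simp: pull_field_linear)

lemma inverse_gradients_independent:
  fixes \<theta> \<theta>' :: "'k::analytic_scalar ^ 3 \<Rightarrow> 'k ^ 3"
  assumes "\<And>i. kanalytic_at (\<lambda>q. \<theta> q $ i) q" "\<And>i. kanalytic_at (\<lambda>q. \<theta>' q $ i) (\<theta> q)"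
    and "eventually (\<lambda>q. \<theta>' (\<theta> q) = q) (nhds q)"
  shows "triple (gradient (\<lambda>q. \<theta> q $ 1) q) (gradient (\<lambda>q. \<theta> q $ 2) q) (gradient (\<lambda>q. \<theta> q $ 3) q) \<noteq> 0"
proof -
  have "jacobian \<theta>' (\<theta> q) ** jacobian \<theta> q = jacobian (\<lambda>q. \<theta>' (\<theta> q)) q"
    by (rule jacobian_compose[symmetric]) (rule assms)+
  also have "\<dots> = mat 1" using jacobian_cong[OF assms(3)] by (simp add: jacobian_ident)
  finally have "invertible (jacobian \<theta> q)" using invertible_left_inverse by blast
  then have "det (jacobian \<theta> q) \<noteq> 0" by (simp add: invertible_det_nz)
  moreover have "det (jacobian \<theta> q) =
      triple (gradient (\<lambda>q. \<theta> q $ 1) q) (gradient (\<lambda>q. \<theta> q $ 2) q) (gradient (\<lambda>q. \<theta> q $ 3) q)"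
    by (simp add: det_3 jacobian_def gradient_def vec3_simps)
  ultimately show ?thesis by simp
qed

lemma pull_field_injective:
  assumes t: "triple (gradient (\<lambda>q. \<theta> q $ 1) q) (gradient (\<lambda>q. \<theta> q $ 2) q) (gradient (\<lambda>q. \<theta> q $ 3) q) \<noteq> 0"
    and z: "pull_field \<theta> q w = 0"
  shows "w = 0"
proof -
  define g where "g i = gradient (\<lambda>q. \<theta> q $ i) q" for i
  have z: "w $ 1 *s vcross (g 2) (g 3) + w $ 2 *s vcross (g 3) (g 1) + w $ 3 *s vcross (g 1) (g 2) = 0"
    using z by (simp add: pull_field_def g_def Let_def)
  have "w $ 1 * triple (g 1) (g 2) (g 3) = 0" "w $ 2 * triple (g 1) (g 2) (g 3) = 0"
    "w $ 3 * triple (g 1) (g 2) (g 3) = 0"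
    using arg_cong[OF z, of "vdot (g 1)"] arg_cong[OF z, of "vdot (g 2)"] arg_cong[OF z, of "vdot (g 3)"]
    by (simp_all add: vec3_simps)
  then show ?thesis using t by (simp add: g_def vec_eq_iff forall_3)
qed

lemma general_position_pull:
  assumes gp: "general_position w"
    and t: "triple (gradient (\<lambda>q. \<theta> q $ 1) q) (gradient (\<lambda>q. \<theta> q $ 2) q) (gradient (\<lambda>q. \<theta> q $ 3) q) \<noteq> 0"
  shows "general_position (\<lambda>l. pull_field \<theta> q (w l))"
  unfolding general_position_def lin_indep_def
proof (intro allI impI)
  fix S :: "4 set" and c assume S: "card S = 3" and "(\<Sum>i\<in>S. c i *s pull_field \<theta> q (w i)) = 0"
  then have "pull_field \<theta> q (\<Sum>i\<in>S. c i *s w i) = 0" by (simp add: pull_field_sum pull_field_linear)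
  then have "(\<Sum>i\<in>S. c i *s w i) = 0" by (rule pull_field_injective[OF t])
  then show "\<forall>i\<in>S. c i = 0" using gp S unfolding general_position_def lin_indep_def by blast
qed

lemma general_position_scale:
  assumes gp: "general_position w" and s: "\<And>l. v l = s l *s w l" "\<And>l. s l \<noteq> 0"
  shows "general_position v"
  unfolding general_position_def lin_indep_def
proof (intro allI impI ballI)
  fix S :: "4 set" and c i assume S: "card S = 3" and z: "(\<Sum>i\<in>S. c i *s v i) = 0" and i: "i \<in> S"
  have "(\<Sum>i\<in>S. (c i * s i) *s w i) = 0" using z by (simp add: s(1) vector_smult_assoc)
  then have "\<forall>i\<in>S. c i * s i = 0"
    using gp[unfolded general_position_def lin_indep_def, rule_format, OF S, of "\<lambda>i. c i * s i"] by blast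
  then show "c i = 0" using i s(2) by simp
qed

lemma general_position_nz:
  assumes gp: "general_position w"
  shows "w l \<noteq> 0"
proof -
  define S where "S = UNIV - {l + 1}"
  have "card S = 3" "l \<in> S" by (simp_all add: S_def card_Diff_singleton)
  then have "lin_indep (*s) S w" using gp unfolding general_position_def by blast
  then have *: "(\<Sum>i\<in>S. (if i = l then 1 else 0) *s w i) = 0 \<longrightarrow> (\<forall>i\<in>S. (if i = l then 1 else 0) = (0::'a))"
    unfolding lin_indep_def by (rule spec)
  show ?thesis
  proof
    assume "w l = 0"
    then have "(\<Sum>i\<in>S. (if i = l then 1 else 0) *s w i) = 0" by (intro sum.neutral) auto
    then show False using * \<open>l \<in> S\<close> by fastforce
  qed
qed

text \<open>
  The leaf field is itself tangent to the foliation, and it suffices to test the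
  conditions for a basic form on this one nowhere vanishing field.
\<close>

lemma abelian_relation_fields:
  fixes a b :: "4 \<Rightarrow> 'k::analytic_scalar ^ 3 \<Rightarrow> 'k"
  assumes ab: "\<And>l. leaf_functions B (a l) (b l)"
    and lc: "\<And>l. restrict_leaves (\<L> l) B = level_curves B (a l) (b l)"
    and rel: "abelian_relation N \<L> \<eta>" and BN: "B \<subseteq> N" and q: "q \<in> B"
  defines "E \<equiv> \<lambda>l q. vec_of_form (\<eta> l q)"
  shows "vanalytic_at (E l) q" "\<exists>s. E l q = s *s leaf_field (a l) (b l) q" "divergence (E l) q = 0"
    "(\<Sum>l\<in>UNIV. E l q) = 0"
proof -
  have B: "open B" using leaf_functions_at(4)[OF ab] .
  have tf: "two_form_on N (\<eta> l)" and bf: "basic_form N (\<L> l) (\<eta> l)" for l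
    using rel unfolding abelian_relation_def by auto
  have tfB: "two_form_on B (\<eta> l)" for l
    using tf[of l] BN unfolding two_form_on_def kanalytic_on_def by blast
  have wan: "vanalytic_at (leaf_field (a l) (b l)) q" if "q \<in> B" for l q
    by (intro vanalytic_at_leaf_field leaf_functions_at(1,2)[OF ab that])
  have basic: "basic_functions B (a l) (b l) (restrict_leaves (\<L> l) B)" for l
    unfolding lc using leaf_functions_basic[OF B] ab by blast
  have "leaf_field (a l) (b l) q \<in> tangent_space (\<L> l) q" if "q \<in> B" for l q
    unfolding tangent_space_leaf_field[OF basic B that]
    by (simp add: differential_vdot leaf_field_def vdot_vcross)
  then have tang: "tangent_field B (\<L> l) (leaf_field (a l) (b l))" for l
    unfolding tangent_field_def kanalytic_map_on_def kanalytic_on_def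
    using wan unfolding vanalytic_at_def by blast
  have il: "interior_product (leaf_field (a l) (b l)) (\<eta> l) q = 0 \<and> lie_derivative (leaf_field (a l) (b l)) (\<eta> l) q = 0"
    if "q \<in> B" for l q
    using bf[of l] tang B BN that unfolding basic_form_def by blast
  note closed = basic_form_parallel_closed[OF B q tfB[of l] wan, of l]
  show "\<exists>s. E l q = s *s leaf_field (a l) (b l) q"
    unfolding E_def by (rule closed(1)) (use il q leaf_functions_at(3)[OF ab] in auto)
  show "divergence (E l) q = 0"
    unfolding E_def by (rule closed(2)) (use il q leaf_functions_at(3)[OF ab] in auto)
  show "vanalytic_at (E l) q"
    using tfB[of l] q unfolding vanalytic_at_def forall_3 E_def
    by (auto simp: vec_of_form_def two_form_on_def kanalytic_on_def)
  have "(\<Sum>l\<in>UNIV. \<eta> l q) = 0" using rel BN q unfolding abelian_relation_def by blast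
  then show "(\<Sum>l\<in>UNIV. E l q) = 0"
    unfolding E_def vec_of_form_sum[symmetric] by (simp add: vec_of_form_linear)
qed

lemma form_sum_antisym:
  assumes "\<And>l. l \<in> S \<Longrightarrow> \<forall>i j. \<eta> l $ i $ j = - \<eta> l $ j $ i"
  shows "(\<Sum>l\<in>S. \<eta> l :: 'k::analytic_scalar ^ 3 ^ 3) $ i $ j = - (\<Sum>l\<in>S. \<eta> l) $ j $ i"
proof -
  have "(\<Sum>l\<in>S. \<eta> l $ i $ j) = (\<Sum>l\<in>S. - \<eta> l $ j $ i)" by (rule sum.cong[OF refl]) (use assms in blast)
  then show ?thesis by (simp add: sum_negf)
qed

lemma wedges_abelian_relation:
  fixes a b :: "4 \<Rightarrow> 'k::analytic_scalar ^ 3 \<Rightarrow> 'k"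
  assumes ab: "\<And>l. leaf_functions N (a l) (b l)"
    and lc: "\<And>l. restrict_leaves (\<L> l) N = level_curves N (a l) (b l)"
    and sum0: "\<And>q. q \<in> N \<Longrightarrow> (\<Sum>l\<in>UNIV. leaf_field (a l) (b l) q) = 0"
  shows "abelian_relation N \<L> (\<lambda>l. wedge_d (a l) (b l))"
  unfolding abelian_relation_def
proof (intro conjI allI ballI)
  have N: "open N" using leaf_functions_at(4)[OF ab] .
  have basic: "basic_functions N (a l) (b l) (restrict_leaves (\<L> l) N)" for l
    unfolding lc using leaf_functions_basic[OF N] ab by blast
  fix l
  show "two_form_on N (wedge_d (a l) (b l))"
    unfolding two_form_on_def kanalytic_on_def
  proof (intro conjI allI ballI)
    fix i j q assume q: "q \<in> N"
    show "kanalytic_at (\<lambda>q. wedge_d (a l) (b l) q $ i $ j) q"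
      unfolding wedge_d_def vec_lambda_beta
      by (intro kanalytic_at_diff kanalytic_at_mult kanalytic_at_pd leaf_functions_at(1,2)[OF ab q])
  qed (rule wedge_d_antisym)
  show "basic_form N (\<L> l) (wedge_d (a l) (b l))"
    unfolding basic_form_def
  proof (intro allI impI ballI)
    fix N' w q assume N': "open N' \<and> N' \<subseteq> N \<and> tangent_field N' (\<L> l) w" and q: "q \<in> N'"
    have qN: "q \<in> N" using N' q by blast
    have w: "vanalytic_at w q"
      using N' q unfolding tangent_field_def kanalytic_map_on_def kanalytic_on_def vanalytic_at_def by blast
    have ker: "differential (a l) x (w x) = 0 \<and> differential (b l) x (w x) = 0" if "x \<in> N'" for x
    proof -
      have "w x \<in> tangent_space (\<L> l) x" "x \<in> N" using N' that unfolding tangent_field_def by auto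
      then show ?thesis using tangent_space_leaf_field[OF basic N] by blast
    qed
    show "interior_product w (wedge_d (a l) (b l)) q = 0 \<and> lie_derivative w (wedge_d (a l) (b l)) q = 0"
      using wedge_is_basic[OF _ q leaf_functions_at(1,2)[OF ab qN] w ker] N' by blast
  qed
next
  fix q assume q: "q \<in> N"
  have "(\<Sum>l\<in>UNIV. wedge_d (a l) (b l) q) $ i $ j = - (\<Sum>l\<in>UNIV. wedge_d (a l) (b l) q) $ j $ i" for i j
    by (rule form_sum_antisym) (simp add: wedge_d_def)
  from antisym_form_eq_0[OF this] show "(\<Sum>l\<in>UNIV. wedge_d (a l) (b l) q) = 0"
    using sum0[OF q] by (simp add: vec_of_form_sum vec_of_wedge)
qed

text \<open>After subtraction of the multiple that agrees with \<open>\<eta>\<close> at \<open>p\<close>, a relation vanishing at \<open>p\<close> remains.\<close>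

lemma relation_multiple:
  fixes a b :: "4 \<Rightarrow> 'k::analytic_scalar ^ 3 \<Rightarrow> 'k"
  assumes ab: "\<And>l. leaf_functions N (a l) (b l)"
    and lc: "\<And>l. restrict_leaves (\<L> l) N = level_curves N (a l) (b l)"
    and gp: "\<And>q. q \<in> N \<Longrightarrow> general_position (\<lambda>l. leaf_field (a l) (b l) q)"
    and sum0: "\<And>q. q \<in> N \<Longrightarrow> (\<Sum>l\<in>UNIV. leaf_field (a l) (b l) q) = 0"
    and p: "p \<in> N" and \<eta>: "\<eta> \<in> abelian_relations_near \<L> p"
  shows "\<exists>k. eventually (\<lambda>q. \<forall>l. (\<forall>i j. \<eta> l q $ i $ j = - \<eta> l q $ j $ i) \<and>
           vec_of_form (\<eta> l q) = k *s leaf_field (a l) (b l) q) (nhds p)"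
proof -
  obtain N1 where N1: "open N1" "p \<in> N1" "abelian_relation N1 \<L> \<eta>"
    using \<eta> unfolding abelian_relations_near_def by blast
  define B where "B = N \<inter> N1"
  have N: "open N" using leaf_functions_at(4)[OF ab] .
  have B: "open B" "p \<in> B" "B \<subseteq> N" "B \<subseteq> N1" using N N1 p by (auto simp: B_def)
  have abB: "leaf_functions B (a l) (b l)" for l by (rule leaf_functions_subset[OF ab B(1,3)])
  have lcB: "restrict_leaves (\<L> l) B = level_curves B (a l) (b l)" for l
    using restrict_leaves_twice[OF B(3), of "\<L> l"] restrict_level_curves[OF ab B(1,3)] lc by simp
  define w where "w l = leaf_field (a l) (b l)" for l
  define E where "E = (\<lambda>l q. vec_of_form (\<eta> l q))"
  have E: "vanalytic_at (E l) q" "\<exists>s. E l q = s *s w l q" "divergence (E l) q = 0" "(\<Sum>l\<in>UNIV. E l q) = 0"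
    if "q \<in> B" for l q
    using abelian_relation_fields[OF abB lcB N1(3) B(4) that] unfolding E_def w_def by blast+
  obtain k where k: "E 4 p = k *s w 4 p" using E(2)[OF B(2), of 4] by blast
  have wan: "vanalytic_at (w l) q" if "q \<in> B" for l q
    unfolding w_def by (intro vanalytic_at_leaf_field leaf_functions_at(1,2)[OF abB that])
  have wdiv: "divergence (w l) q = 0" if "q \<in> B" for l q
    unfolding w_def by (intro divergence_leaf_field leaf_functions_at(1,2)[OF abB that])
  define E' where "E' l = (\<lambda>q. E l q - k *s w l q)" for l
  have E40: "E' 4 p = 0" unfolding E'_def k by (rule right_minus_eq[THEN iffD2]) (rule refl)
  have "eventually (\<lambda>q. \<forall>l. E' l q = 0) (nhds p)"
  proof (rule relation_vanishes_near[OF B(1,2) wan])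
    fix l q assume q: "q \<in> B"
    show "vanalytic_at (E' l) q"
      unfolding E'_def by (intro vanalytic_at_diff vanalytic_at_scale kanalytic_at_const wan[OF q] E(1)[OF q])
    show "general_position (\<lambda>l. w l q)" using gp q B(3) by (auto simp: w_def)
    obtain s where "E l q = s *s w l q" using E(2)[OF q, of l] by blast
    then have "E' l q = (s - k) *s w l q" by (simp add: E'_def vec_eq_iff algebra_simps)
    then show "\<exists>s. E' l q = s *s w l q" by blast
    show "divergence (E' l) q = 0"
      unfolding E'_def using E(3)[OF q] wdiv[OF q]
      by (simp add: divergence_diff_scale[OF E(1)[OF q] wan[OF q]])
    have "(\<Sum>l\<in>UNIV. E' l q) = (\<Sum>l\<in>UNIV. E l q) - k *s (\<Sum>l\<in>UNIV. w l q)"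
      by (simp add: E'_def vec_eq_iff sum_subtractf sum_distrib_left)
    then show "(\<Sum>l\<in>UNIV. E' l q) = 0" using E(4)[OF q] sum0 q B(3) by (auto simp: w_def)
  qed (assumption | rule E40)+
  moreover have "eventually (\<lambda>q. q \<in> B) (nhds p)" by (rule eventually_nhds_in_open[OF B(1,2)])
  ultimately have "eventually (\<lambda>q. \<forall>l. (\<forall>i j. \<eta> l q $ i $ j = - \<eta> l q $ j $ i) \<and>
           vec_of_form (\<eta> l q) = k *s leaf_field (a l) (b l) q) (nhds p)"
  proof eventually_elim
    case (elim q)
    have "vec_of_form (\<eta> l q) = k *s leaf_field (a l) (b l) q" for l
      using elim(1) by (simp add: E'_def E_def w_def)
    moreover have "\<forall>i j. \<eta> l q $ i $ j = - \<eta> l q $ j $ i" for l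
      using N1(3) elim(2) B(4) unfolding abelian_relation_def two_form_on_def by blast
    ultimately show ?case by blast
  qed
  then show ?thesis by blast
qed

lemma web_rank_one:
  fixes a b :: "4 \<Rightarrow> 'k::analytic_scalar ^ 3 \<Rightarrow> 'k"
  assumes ab: "\<And>l. leaf_functions N (a l) (b l)"
    and lc: "\<And>l. restrict_leaves (\<L> l) N = level_curves N (a l) (b l)"
    and gp: "\<And>q. q \<in> N \<Longrightarrow> general_position (\<lambda>l. leaf_field (a l) (b l) q)"
    and sum0: "\<And>q. q \<in> N \<Longrightarrow> (\<Sum>l\<in>UNIV. leaf_field (a l) (b l) q) = 0"
    and p: "p \<in> N"
  shows "web_rank \<L> p = 1"
proof -
  define indep where "indep r \<longleftrightarrow> (\<exists>\<eta> :: nat \<Rightarrow> 4 \<Rightarrow> 'k ^ 3 \<Rightarrow> 'k ^ 3 ^ 3.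
       (\<forall>i<r. \<eta> i \<in> abelian_relations_near \<L> p) \<and>
       (\<forall>c. (\<forall>\<^sub>F q in nhds p. \<forall>l. (\<Sum>i<r. form_scale (c i) (\<eta> i l q)) = 0) \<longrightarrow> (\<forall>i<r. c i = 0)))" for r :: nat
  have N: "open N" using leaf_functions_at(4)[OF ab] .
  have 1: "indep 1"
    unfolding indep_def
  proof (intro exI conjI allI impI)
    fix i :: nat
    show "(\<lambda>i l. wedge_d (a l) (b l)) i \<in> abelian_relations_near \<L> p"
      unfolding abelian_relations_near_def using N p wedges_abelian_relation[OF ab lc sum0] by blast
  next
    fix c :: "nat \<Rightarrow> 'k" and i :: nat
    assume c: "\<forall>\<^sub>F q in nhds p. \<forall>l. (\<Sum>i<1. form_scale (c i) (wedge_d (a l) (b l) q)) = 0" and i: "i < 1"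
    have "\<forall>l. (\<Sum>i<1. form_scale (c i) (wedge_d (a l) (b l) p)) = 0"
      by (rule eventually_nhds_x_imp_x[OF c])
    then have "form_scale (c 0) (wedge_d (a 1) (b 1) p) = 0" by simp
    then have "vec_of_form (form_scale (c 0) (wedge_d (a 1) (b 1) p)) = 0" by (simp add: vec_of_form_linear)
    then have "c 0 *s leaf_field (a 1) (b 1) p = 0" by (simp add: vec_of_form_linear vec_of_wedge)
    then show "c i = 0" using leaf_functions_at(3)[OF ab p, of 1] i by (simp add: vec_zero_scale)
  qed
  have le: "r \<le> 1" if r: "indep r" for r
  proof (rule ccontr)
    assume "\<not> r \<le> 1"
    then have r2: "2 \<le> r" by simp
    obtain \<eta> :: "nat \<Rightarrow> 4 \<Rightarrow> 'k ^ 3 \<Rightarrow> 'k ^ 3 ^ 3" where \<eta>: "\<forall>i<r. \<eta> i \<in> abelian_relations_near \<L> p"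
      and ind: "\<forall>c. (\<forall>\<^sub>F q in nhds p. \<forall>l. (\<Sum>i<r. form_scale (c i) (\<eta> i l q)) = 0) \<longrightarrow> (\<forall>i<r. c i = 0)"
      using r unfolding indep_def by blast
    have "\<eta> 0 \<in> abelian_relations_near \<L> p" "\<eta> 1 \<in> abelian_relations_near \<L> p" using \<eta> r2 by auto
    then obtain k0 k1 where
      k0: "\<forall>\<^sub>F q in nhds p. \<forall>l. (\<forall>i j. \<eta> 0 l q $ i $ j = - \<eta> 0 l q $ j $ i) \<and>
           vec_of_form (\<eta> 0 l q) = k0 *s leaf_field (a l) (b l) q" and
      k1: "\<forall>\<^sub>F q in nhds p. \<forall>l. (\<forall>i j. \<eta> 1 l q $ i $ j = - \<eta> 1 l q $ j $ i) \<and>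
           vec_of_form (\<eta> 1 l q) = k1 *s leaf_field (a l) (b l) q"
      using relation_multiple[OF ab lc gp sum0 p] by meson
    \<comment> \<open>A nontrivial combination of two multiples of the same relation that is zero, also if both are zero.\<close>
    define d0 d1 where "d0 = (if k0 = 0 \<and> k1 = 0 then 1 else k1)" and "d1 = (if k0 = 0 \<and> k1 = 0 then 0 else - k0)"
    have d: "d0 * k0 + d1 * k1 = 0" "d0 \<noteq> 0 \<or> d1 \<noteq> 0" by (auto simp: d0_def d1_def)
    define c where "c i = (if i = 0 then d0 else if i = 1 then d1 else 0)" for i :: nat
    have "\<forall>\<^sub>F q in nhds p. \<forall>l. (\<Sum>i<r. form_scale (c i) (\<eta> i l q)) = 0"
      using k0 k1
    proof eventually_elim
      case (elim q)
      show ?case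
      proof
        fix l
        have "(\<Sum>i<r. form_scale (c i) (\<eta> i l q)) = (\<Sum>i\<in>{0, 1}. form_scale (c i) (\<eta> i l q))"
          by (rule sum.mono_neutral_right) (use r2 in \<open>auto simp: c_def form_scale_def vec_eq_iff\<close>)
        also have "\<dots> = form_scale d0 (\<eta> 0 l q) + form_scale d1 (\<eta> 1 l q)" by (simp add: c_def)
        also have "\<dots> = 0"
        proof (rule antisym_form_eq_0[THEN iffD2])
          fix i j
          have "\<eta> 0 l q $ i $ j = - \<eta> 0 l q $ j $ i" "\<eta> 1 l q $ i $ j = - \<eta> 1 l q $ j $ i"
            using elim by blast+
          then show "(form_scale d0 (\<eta> 0 l q) + form_scale d1 (\<eta> 1 l q)) $ i $ j
              = - (form_scale d0 (\<eta> 0 l q) + form_scale d1 (\<eta> 1 l q)) $ j $ i"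
            by (simp only: form_scale_def vec_lambda_beta vector_add_component) simp
        next
          have "vec_of_form (form_scale d0 (\<eta> 0 l q) + form_scale d1 (\<eta> 1 l q))
              = (d0 * k0 + d1 * k1) *s leaf_field (a l) (b l) q"
            using elim by (simp add: vec_of_form_linear vec_eq_iff algebra_simps)
          then show "vec_of_form (form_scale d0 (\<eta> 0 l q) + form_scale d1 (\<eta> 1 l q)) = 0" by (simp add: d(1))
        qed
        finally show "(\<Sum>i<r. form_scale (c i) (\<eta> i l q)) = 0" .
      qed
    qed
    then have "\<forall>i<r. c i = 0" using ind by blast
    then have "c 0 = 0" "c 1 = 0" using r2 by auto
    then show False using d(2) by (simp add: c_def)
  qed
  have eq: "web_rank \<L> p = Sup {enat r | r. indep r}" unfolding web_rank_def indep_def ..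
  show ?thesis
  proof (rule antisym)
    show "web_rank \<L> p \<le> 1"
      unfolding eq by (rule Sup_least) (use le in \<open>auto simp: one_enat_def\<close>)
    have "enat 1 \<in> {enat r | r. indep r}" using 1 by blast
    then show "1 \<le> web_rank \<L> p" unfolding eq one_enat_def by (rule Sup_upper)
  qed
qed

lemma kanalytic_map_on_subset: "kanalytic_map_on N \<phi> \<Longrightarrow> N' \<subseteq> N \<Longrightarrow> kanalytic_map_on N' \<phi>"
  unfolding kanalytic_map_on_def kanalytic_on_def by blast

lemma analytic_chart_restrict:
  assumes c: "analytic_chart W \<phi> \<psi> P" and P': "open P'" "P' \<subseteq> P"
  shows "analytic_chart (W \<inter> \<phi> -` P') \<phi> \<psi> P'"
proof -
  have W: "open W" "kanalytic_map_on W \<phi>" and P: "kanalytic_map_on P \<psi>"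
    and inv: "\<forall>q\<in>W. \<psi> (\<phi> q) = q" "\<forall>y\<in>P. \<phi> (\<psi> y) = y \<and> \<psi> y \<in> W"
    using c unfolding analytic_chart_def by blast+
  have "open (W \<inter> \<phi> -` P')"
    by (rule continuous_open_preimage[OF kanalytic_map_continuous[OF W(2)] W(1) P'(1)])
  moreover have "\<phi> ` (W \<inter> \<phi> -` P') = P'"
  proof (intro equalityI subsetI)
    fix y assume "y \<in> P'"
    then have "\<phi> (\<psi> y) = y" "\<psi> y \<in> W" using inv P'(2) by blast+
    moreover have "\<psi> y \<in> \<phi> -` P'" unfolding vimage_def using \<open>\<phi> (\<psi> y) = y\<close> \<open>y \<in> P'\<close> by simp
    ultimately have "y = \<phi> (\<psi> y)" "\<psi> y \<in> W \<inter> \<phi> -` P'" by simp_all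
    then show "y \<in> \<phi> ` (W \<inter> \<phi> -` P')" by (rule image_eqI)
  qed auto
  moreover have "kanalytic_map_on (W \<inter> \<phi> -` P') \<phi>" "kanalytic_map_on P' \<psi>"
    using kanalytic_map_on_subset[OF W(2)] kanalytic_map_on_subset[OF P P'(2)] by blast+
  moreover have "\<forall>q\<in>W \<inter> \<phi> -` P'. \<psi> (\<phi> q) = q" "\<forall>y\<in>P'. \<phi> (\<psi> y) = y \<and> \<psi> y \<in> W \<inter> \<phi> -` P'"
    using inv P'(2) by auto
  ultimately show ?thesis unfolding analytic_chart_def by blast
qed

lemma analytic_chart_homeomorphism:
  assumes "analytic_chart W \<phi> \<psi> P"
  shows "homeomorphism W P \<phi> \<psi>"
proof -
  have "\<psi> ` P = W" using assms unfolding analytic_chart_def by force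
  then show ?thesis
    using assms kanalytic_map_continuous[of W \<phi>] kanalytic_map_continuous[of P \<psi>]
    unfolding homeomorphism_def analytic_chart_def by blast
qed

text \<open>
  The covector \<open>g\<close> annihilates the leaf direction, hence is a combination of \<open>da\<close> and \<open>db\<close> at \<open>p\<close>;
  the same combination of \<open>a\<close> and \<open>b\<close>, with constant coefficients, is the function sought. One of
  \<open>a\<close>, \<open>b\<close> complements it.
\<close>

lemma adapted_basic_functions:
  fixes a b :: "'k::analytic_scalar ^ 3 \<Rightarrow> 'k"
  assumes ab: "leaf_functions B a b" and p: "p \<in> B"
    and g: "vdot g (leaf_field a b p) = 0" "g \<noteq> 0"
  shows "\<exists>c x k. k \<noteq> 0 \<and> kanalytic_on B c \<and> kanalytic_on B x \<and> gradient x p = g \<and>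
           (\<forall>q\<in>B. leaf_field c x q = k *s leaf_field a b q)"
proof -
  obtain \<alpha> \<beta> where g_eq: "g = \<alpha> *s gradient a p + \<beta> *s gradient b p"
    using orthogonal_to_cross_in_span[of g "gradient a p" "gradient b p"] g(1) leaf_functions_at(3)[OF ab p]
    unfolding leaf_field_def by blast
  define x where "x q = \<alpha> * a q + \<beta> * b q" for q
  have an: "kanalytic_at a q" "kanalytic_at b q" if "q \<in> B" for q using leaf_functions_at(1,2)[OF ab that] .
  have xan: "kanalytic_at x q" if "q \<in> B" for q
    unfolding x_def[abs_def] by (intro kanalytic_at_add kanalytic_at_mult kanalytic_at_const an[OF that])
  have gx: "gradient x q = \<alpha> *s gradient a q + \<beta> *s gradient b q" if "q \<in> B" for q
    unfolding x_def[abs_def] using an[OF that]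
    by (simp add: gradient_def vec_eq_iff pd_add pd_cmult kanalytic_at_mult kanalytic_at_const)
  have "\<exists>c k. k \<noteq> 0 \<and> kanalytic_on B c \<and> (\<forall>q\<in>B. leaf_field c x q = k *s leaf_field a b q)"
  proof (cases "\<beta> = 0")
    case False
    then show ?thesis
      using an by (intro exI[of _ a] exI[of _ \<beta>])
        (auto simp: kanalytic_on_def leaf_field_def gx vcross_linear)
  next
    case True
    then have "\<alpha> \<noteq> 0" using g(2) g_eq by auto
    then show ?thesis
      using an True by (intro exI[of _ b] exI[of _ "- \<alpha>"])
        (auto simp: kanalytic_on_def leaf_field_def gx vcross_linear vcross_antisym[of "gradient b _" "gradient a _"])
  qed
  then show ?thesis using xan gx[OF p] g_eq unfolding kanalytic_on_def by metis
qed

lemma gradient_coordinate_function: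
  assumes "open P" "y \<in> P" "\<And>y. y \<in> P \<Longrightarrow> f y = y $ i"
  shows "gradient f y = axis i 1"
proof -
  have "pd j f y = pd j (\<lambda>y. y $ i) y" for j
    by (rule pd_cong, rule eventually_mono[OF eventually_nhds_in_open[OF assms(1,2)]]) (rule assms(3))
  then have "gradient f y = gradient (\<lambda>y. y $ i) y" by (simp add: gradient_def)
  then show ?thesis by (simp add: gradient_coord)
qed

lemma leaf_field_cong:
  assumes "open P" "y \<in> P" "\<And>y. y \<in> P \<Longrightarrow> f y = f' y" "\<And>y. y \<in> P \<Longrightarrow> g y = g' y"
  shows "leaf_field f g y = leaf_field f' g' y"
proof -
  have "pd j f y = pd j f' y" "pd j g y = pd j g' y" for j
    by (rule pd_cong, rule eventually_mono[OF eventually_nhds_in_open[OF assms(1,2)]], rule assms, assumption)+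
  then show ?thesis by (simp add: leaf_field_def gradient_def)
qed

lemma level_curves_cong:
  assumes "\<And>q. q \<in> N \<Longrightarrow> a q = a' q" "\<And>q. q \<in> N \<Longrightarrow> b q = b' q"
  shows "level_curves N a b = level_curves N a' b'"
proof -
  have "{q \<in> N. a q = c \<and> b q = d} = {q \<in> N. a' q = c \<and> b' q = d}" for c d using assms by auto
  then show ?thesis by (simp add: level_curves_def)
qed

lemma quv_second_simps:
  "quv_second v 1 = (\<lambda>q. q $ 1)" "quv_second v 2 = (\<lambda>q. q $ 2)" "quv_second v 3 = (\<lambda>q. q $ 3)" "quv_second v 4 = v"
  by (simp_all add: quv_second_def fun_eq_iff)

lemma quv_first_simps:
  "quv_first Q u v 1 = (\<lambda>q. pd 1 Q q - u q * pd 1 v q)" "quv_first Q u v 2 = (\<lambda>q. pd 2 Q q - u q * pd 2 v q)"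
  "quv_first Q u v 3 = (\<lambda>q. pd 3 Q q - u q * pd 3 v q)" "quv_first Q u v 4 = u"
  by (simp_all add: quv_first_def fun_eq_iff)

text \<open>
  Given a nowhere vanishing relation, \<open>x, y, z\<close> are chosen among the basic functions of the
  first three foliations with differentials at \<open>p\<close> proportional to the dual basis. The components of the
  relation are then \<open>df \<and> dx, dg \<and> dy, dh \<and> dz, du \<and> dv\<close>, and their sum being zero makes
  \<open>f dx + g dy + h dz + u dv\<close> closed, hence equal to some \<open>dQ\<close>.
\<close>

lemma flat_normal_form:
  fixes a b :: "4 \<Rightarrow> 'k::analytic_scalar ^ 3 \<Rightarrow> 'k"
  assumes p: "p \<in> B" and ab: "\<And>l. leaf_functions B (a l) (b l)"
    and gp: "\<And>q. q \<in> B \<Longrightarrow> general_position (\<lambda>l. leaf_field (a l) (b l) q)"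
    and E: "\<And>l q. q \<in> B \<Longrightarrow> vanalytic_at (E l) q"
    and par: "\<And>l q. q \<in> B \<Longrightarrow> \<exists>s. E l q = s *s leaf_field (a l) (b l) q"
    and div: "\<And>l q. q \<in> B \<Longrightarrow> divergence (E l) q = 0"
    and sum0: "\<And>q. q \<in> B \<Longrightarrow> (\<Sum>l\<in>UNIV. E l q) = 0"
    and E4: "E 4 p \<noteq> 0"
  obtains W \<phi> \<psi> V Q u v where "p \<in> W" "W \<subseteq> B" "analytic_chart W \<phi> \<psi> V" "quv_data V Q u v"
    "\<forall>l. level_curves W (a l) (b l) = level_curves W (quv_first Q u v l \<circ> \<phi>) (quv_second v l \<circ> \<phi>)"
proof -
  define w where "w l = leaf_field (a l) (b l)" for l
  have B: "open B" using leaf_functions_at(4)[OF ab] .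
  note gp = gp[folded w_def] and par = par[folded w_def]
  have Enz: "E l p \<noteq> 0" for l
  proof -
    obtain s where s: "\<And>l. E l p = s l *s w l p" using par[OF p] by metis
    have s4: "s 4 \<noteq> 0" using E4 s by auto
    have "s l \<noteq> 0"
    proof
      assume sl: "s l = 0"
      have "(\<Sum>m\<in>UNIV - {l}. s m *s w m p) = (\<Sum>m\<in>UNIV. s m *s w m p)"
        by (rule sum.mono_neutral_left) (use sl in auto)
      also have "\<dots> = 0" using sum0[OF p] by (simp add: s)
      finally have "(\<Sum>m\<in>UNIV - {l}. s m *s w m p) = 0" .
      moreover have "card (UNIV - {l}) = 3" by (simp add: card_Diff_singleton)
      ultimately have "\<forall>m\<in>UNIV - {l}. s m = 0"
        using gp[OF p] unfolding general_position_def lin_indep_def by blast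
      then show False using s4 sl by (cases "l = 4") auto
    qed
    then show ?thesis using general_position_nz[OF gp[OF p], of l] by (simp add: s vec_zero_scale)
  qed
  have t: "triple (w 1 p) (w 2 p) (w 3 p) \<noteq> 0" by (rule general_position_triple[OF gp[OF p]]) simp_all
  \<comment> \<open>\<open>w\<^sub>1 \<times> w\<^sub>2\<close> annihilates \<open>w\<^sub>1\<close>, hence is a differential of a basic function of the first foliation.\<close>
  define G :: "4 \<Rightarrow> 'k ^ 3" where "G l = (if l = 1 then vcross (w 1 p) (w 2 p) else
     if l = 2 then vcross (w 2 p) (w 3 p) else if l = 3 then vcross (w 3 p) (w 1 p) else gradient (b 4) p)" for l
  have tG: "triple (G 1) (G 2) (G 3) \<noteq> 0" using t by (simp add: G_def triple_dual_basis)
  have "\<exists>c x k. k \<noteq> 0 \<and> kanalytic_on B c \<and> kanalytic_on B x \<and> gradient x p = G l \<and>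
           (\<forall>q\<in>B. leaf_field c x q = k *s leaf_field (a l) (b l) q)" for l
  proof (rule adapted_basic_functions[OF ab p])
    show "vdot (G l) (leaf_field (a l) (b l) p) = 0"
    proof -
      have c: "vdot (vcross y z) y = 0" "vdot (vcross y z) z = 0" for y z :: "'k ^ 3" by (simp_all add: vec3_simps)
      have "vdot (gradient (b 4) p) (w 4 p) = 0" unfolding w_def leaf_field_def by (rule vdot_vcross(2))
      then have "vdot (G l) (w l p) = 0" using exhaust_4[of l] by (auto simp: G_def c)
      then show ?thesis by (simp add: w_def)
    qed
    show "G l \<noteq> 0"
    proof
      assume G0: "G l = 0"
      have "l \<noteq> 1" "l \<noteq> 2" "l \<noteq> 3"
        using tG G0 by (auto simp: triple_def vdot_linear vcross_linear)
      then have "gradient (b 4) p = 0" using G0 by (simp add: G_def)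
      then show False using leaf_functions_at(3)[OF ab[of 4] p] by (simp add: leaf_field_def vcross_linear)
    qed
  qed
  then obtain c x k where kc: "\<And>l. k l \<noteq> 0" "\<And>l. kanalytic_on B (c l)" "\<And>l. kanalytic_on B (x l)"
    "\<And>l. gradient (x l) p = G l" "\<And>l q. q \<in> B \<Longrightarrow> leaf_field (c l) (x l) q = k l *s w l q"
    unfolding w_def by metis
  have xan: "kanalytic_at (x l) q" and can: "kanalytic_at (c l) q" if "q \<in> B" for l q
    using kc(2,3) that unfolding kanalytic_on_def by blast+
  have "\<exists>f. kanalytic_at f p \<and> eventually (\<lambda>q. leaf_field f (x l) q = E l q) (nhds p)" for l
  proof -
    have "leaf_field (c l) (x l) p \<noteq> 0"
      using kc(1,5) p general_position_nz[OF gp[OF p], of l] by (simp add: vec_zero_scale)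
    moreover have "eventually (\<lambda>q. vanalytic_at (E l) q \<and> (\<exists>s. E l q = s *s leaf_field (c l) (x l) q)
        \<and> divergence (E l) q = 0) (nhds p)"
    proof (rule eventually_mono[OF eventually_nhds_in_open[OF B p]])
      fix q assume q: "q \<in> B"
      obtain s where "E l q = s *s w l q" using par[OF q] by blast
      then have "E l q = (s / k l) *s leaf_field (c l) (x l) q"
        using kc(1)[of l] kc(5)[OF q, of l] by (simp add: vec_eq_iff)
      then show "vanalytic_at (E l) q \<and> (\<exists>s. E l q = s *s leaf_field (c l) (x l) q) \<and> divergence (E l) q = 0"
        using E[OF q] div[OF q] by blast
    qed
    ultimately obtain f where "kanalytic_at f p" "eventually (\<lambda>q. leaf_field f (x l) q = E l q) (nhds p)"
      by (rule closed_form_potential[OF can[OF p] xan[OF p]])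
    then show ?thesis by blast
  qed
  then obtain f where f: "\<And>l. kanalytic_at (f l) p"
    "\<And>l. eventually (\<lambda>q. leaf_field (f l) (x l) q = E l q) (nhds p)" by metis
  have Eev: "eventually (\<lambda>q. E l q \<noteq> 0) (nhds p)" for l
  proof -
    obtain i where i: "E l p $ i \<noteq> 0" using Enz[of l] by (auto simp: vec_eq_iff)
    have "((\<lambda>q. E l q $ i) \<longlongrightarrow> E l p $ i) (nhds p)"
      using vanalytic_at_isCont_nth[OF E[OF p], of l i] by (simp add: isCont_def tendsto_nhds_iff)
    then have "eventually (\<lambda>q. E l q $ i \<noteq> 0) (nhds p)" using i by (rule tendsto_imp_eventually_ne)
    then show ?thesis by eventually_elim auto
  qed
  have "eventually (\<lambda>q. q \<in> B \<and> (\<forall>l. kanalytic_at (f l) q) \<and> (\<forall>l. leaf_field (f l) (x l) q = E l q)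
     \<and> (\<forall>l. E l q \<noteq> 0)) (nhds p)"
    by (intro eventually_conj eventually_nhds_in_open[OF B p] eventually_all_finite_type eventually_kanalytic_at f Eev)
  then obtain N where N: "open N" "p \<in> N" and Nq: "\<And>q. q \<in> N \<Longrightarrow> q \<in> B \<and> (\<forall>l. kanalytic_at (f l) q) \<and>
      (\<forall>l. leaf_field (f l) (x l) q = E l q) \<and> (\<forall>l. E l q \<noteq> 0)"
    unfolding eventually_nhds by blast
  have gpE: "general_position (\<lambda>l. E l q)" if q: "q \<in> N" for q
  proof -
    obtain s where s: "\<And>l. E l q = s l *s w l q" using par Nq[OF q] by metis
    have "s l \<noteq> 0" for l using Nq[OF q] s[of l] by auto
    then show ?thesis using general_position_scale[OF gp, of q "\<lambda>l. E l q" s] Nq[OF q] s by blast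
  qed
  have tx: "triple (gradient (x 1) p) (gradient (x 2) p) (gradient (x 3) p) \<noteq> 0" using tG by (simp add: kc(4))
  obtain W \<psi> r where chart: "p \<in> W" "W \<subseteq> N" "0 < r"
    "analytic_chart W (\<lambda>q. vector [x 1 q, x 2 q, x 3 q]) \<psi> (open_polydisc (vector [x 1 p, x 2 p, x 3 p]) r)"
    by (rule local_coordinates[OF xan[OF p] xan[OF p] xan[OF p] tx N]) (rule that)
  define \<phi> where "\<phi> q = (vector [x 1 q, x 2 q, x 3 q] :: 'k ^ 3)" for q
  define P where "P = open_polydisc (\<phi> p) r"
  have P: "open P" by (simp add: P_def open_open_polydisc)
  have ch: "analytic_chart W \<phi> \<psi> P" using chart(4) by (simp add: \<phi>_def[abs_def] P_def)
  have W: "open W" using ch unfolding analytic_chart_def by blast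
  have inv: "\<psi> (\<phi> q) = q" "\<phi> q \<in> P" if "q \<in> W" for q using ch that unfolding analytic_chart_def by blast+
  have inv': "\<phi> (\<psi> y) = y" "\<psi> y \<in> W" if "y \<in> P" for y using ch that unfolding analytic_chart_def by blast+
  have \<psi>an: "kanalytic_at (\<lambda>y. \<psi> y $ l) y" if "y \<in> P" for y l
    using ch that unfolding analytic_chart_def kanalytic_map_on_def kanalytic_on_def by blast
  have \<phi>an: "kanalytic_at (\<lambda>q. \<phi> q $ l) q" if "q \<in> W" for q l
    using ch that unfolding analytic_chart_def kanalytic_map_on_def kanalytic_on_def by blast
  have WN: "\<psi> y \<in> N" "\<psi> y \<in> B" if "y \<in> P" for y using inv'(2)[OF that] chart(2) Nq by blast+
  define F X where "F l y = f l (\<psi> y)" and "X l y = x l (\<psi> y)" for l y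
  have Fan: "kanalytic_at (F l) y" and Xan: "kanalytic_at (X l) y" if "y \<in> P" for l y
    unfolding F_def[abs_def] X_def[abs_def]
    by (rule kanalytic_at_compose[OF _ \<psi>an[OF that]], use Nq WN[OF that] xan in blast)+
  have X: "X 1 y = y $ 1" "X 2 y = y $ 2" "X 3 y = y $ 3" if "y \<in> P" for y
    using arg_cong[OF inv'(1)[OF that], of "\<lambda>z. z $ 1"] arg_cong[OF inv'(1)[OF that], of "\<lambda>z. z $ 2"]
      arg_cong[OF inv'(1)[OF that], of "\<lambda>z. z $ 3"] by (simp_all add: \<phi>_def X_def)
  have FX: "leaf_field (F l) (X l) y = pull_field \<psi> y (E l (\<psi> y))" if "y \<in> P" for l y
    unfolding F_def[abs_def] X_def[abs_def]
    using leaf_field_compose[of "f l" \<psi> y "x l", OF _ _ \<psi>an[OF that]] Nq[OF WN(1)[OF that]] xan[OF WN(2)[OF that]]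
    by simp
  have ind: "triple (gradient (\<lambda>y. \<psi> y $ 1) y) (gradient (\<lambda>y. \<psi> y $ 2) y) (gradient (\<lambda>y. \<psi> y $ 3) y) \<noteq> 0"
    if "y \<in> P" for y
    by (rule inverse_gradients_independent[where \<theta>' = \<phi>, OF \<psi>an[OF that] \<phi>an[OF inv'(2)[OF that]]])
       (rule eventually_mono[OF eventually_nhds_in_open[OF P that]], rule inv'(1))
  have gpFX: "general_position (\<lambda>l. leaf_field (F l) (X l) y)" if "y \<in> P" for y
    using general_position_pull[OF gpE[OF WN(1)[OF that]] ind[OF that]] by (simp add: FX[OF that])
  have sumFX: "(\<Sum>l\<in>UNIV. leaf_field (F l) (X l) y) = 0" if "y \<in> P" for y
    using sum0[OF WN(2)[OF that]] by (simp add: FX[OF that] pull_field_sum[symmetric] pull_field_linear)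
  define u v where "u = F 4" and "v = X 4"
  define sel :: "3 \<Rightarrow> 4" where "sel i = (if i = 1 then 1 else if i = 2 then 2 else 3)" for i
  define \<alpha> where "\<alpha> i y = F (sel i) y + u y * pd i v y" for i y
  have \<alpha>an: "kanalytic_at (\<alpha> i) y" if "y \<in> P" for i y
    unfolding \<alpha>_def[abs_def] u_def v_def
    by (intro kanalytic_at_add kanalytic_at_mult kanalytic_at_pd Fan[OF that] Xan[OF that])
  have \<alpha>pd: "pd j (\<alpha> i) y = pd j (F (sel i)) y + pd j u y * pd i v y + u y * pd j (pd i v) y" if "y \<in> P" for i j y
    unfolding \<alpha>_def[abs_def] u_def v_def using Fan[OF that] Xan[OF that]
    by (simp add: pd_add pd_mult kanalytic_at_mult kanalytic_at_pd)
  have closed: "pd i (\<alpha> j) y = pd j (\<alpha> i) y" if y: "y \<in> P" for i j y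
  proof -
    have gX: "gradient (X 1) y = axis 1 1" "gradient (X 2) y = axis 2 1" "gradient (X 3) y = axis 3 1"
      by (rule gradient_coordinate_function[OF P y]; rule X; assumption)+
    have "vcross (gradient (F 1) y) (axis 1 1) + vcross (gradient (F 2) y) (axis 2 1)
        + vcross (gradient (F 3) y) (axis 3 1) + vcross (gradient u y) (gradient v y) = 0"
      using sumFX[OF y] by (simp add: sum_4 leaf_field_def gX u_def v_def)
    then have e: "pd 2 (F 3) y - pd 3 (F 2) y + (pd 2 u y * pd 3 v y - pd 3 u y * pd 2 v y) = 0"
      "pd 3 (F 1) y - pd 1 (F 3) y + (pd 3 u y * pd 1 v y - pd 1 u y * pd 3 v y) = 0"
      "pd 1 (F 2) y - pd 2 (F 1) y + (pd 1 u y * pd 2 v y - pd 2 u y * pd 1 v y) = 0"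
      by (auto simp: vcross_def axis_def gradient_def vec_eq_iff forall_3 algebra_simps)
    have c: "pd k (pd m v) y = pd m (pd k v) y" for k m
      unfolding v_def by (rule pd_commute[OF Xan[OF y]])
    have "pd 2 (\<alpha> 3) y - pd 3 (\<alpha> 2) y = 0" "pd 3 (\<alpha> 1) y - pd 1 (\<alpha> 3) y = 0" "pd 1 (\<alpha> 2) y - pd 2 (\<alpha> 1) y = 0"
      unfolding \<alpha>pd[OF y] sel_def using e c[of 2 3] c[of 3 1] c[of 1 2] by (simp_all add: algebra_simps)
    then show ?thesis using exhaust_3[of i] exhaust_3[of j] by auto
  qed
  obtain R Q where R: "0 < R" "R \<le> r" and Qan: "\<And>y. y \<in> open_polydisc (\<phi> p) R \<Longrightarrow> kanalytic_at Q y"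
    and Qpd: "\<And>i y. y \<in> open_polydisc (\<phi> p) R \<Longrightarrow> pd i Q y = \<alpha> i y"
    using poincare[of r "\<phi> p" \<alpha>, OF chart(3) \<alpha>an closed] unfolding P_def by metis
  define V where "V = open_polydisc (\<phi> p) R"
  have V: "open V" "V \<subseteq> P" "\<phi> p \<in> V"
    using R by (auto simp: V_def P_def open_open_polydisc open_polydisc_center intro: open_polydisc_mono[THEN subsetD])
  have first: "quv_first Q u v l y = F l y" if "y \<in> V" for l y
    using exhaust_4[of l] Qpd that by (auto simp: quv_first_simps V_def \<alpha>_def sel_def u_def)
  have second: "quv_second v l y = X l y" if "y \<in> V" for l y
    using exhaust_4[of l] X V(2) that by (auto simp: quv_second_simps v_def)
  have lf: "leaf_field (quv_first Q u v l) (quv_second v l) y = leaf_field (F l) (X l) y" if "y \<in> V" for l y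
    by (rule leaf_field_cong[OF V(1) that first second])
  have data: "quv_data V Q u v"
    unfolding quv_data_def kanalytic_on_def
  proof (intro conjI ballI V(1))
    fix y assume y: "y \<in> V"
    show "kanalytic_at Q y" using Qan y by (simp add: V_def)
    show "kanalytic_at u y" "kanalytic_at v y" using y V(2) Fan Xan by (auto simp: u_def v_def)
    have "card {1, 2, 3 :: 4} = 3" by simp
    moreover have "lin_indep form_scale {1, 2, 3} (\<lambda>l. wedge_d (quv_first Q u v l) (quv_second v l) y)"
      unfolding lin_indep_wedges lf[OF y] using gpFX y V(2) \<open>card {1, 2, 3 :: 4} = 3\<close>
      unfolding general_position_def by blast
    ultimately show "\<exists>S. card S = 3 \<and> lin_indep form_scale S (\<lambda>l. wedge_d (quv_first Q u v l) (quv_second v l) y)"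
      by blast
  qed
  define W' where "W' = W \<inter> \<phi> -` V"
  have ch': "analytic_chart W' \<phi> \<psi> V" unfolding W'_def by (rule analytic_chart_restrict[OF ch V(1,2)])
  have W': "open W'" "p \<in> W'" "W' \<subseteq> N" "W' \<subseteq> B"
    using ch' chart(1,2) V(3) Nq unfolding analytic_chart_def by (auto simp: W'_def)
  have curves: "level_curves W' (a l) (b l) = level_curves W' (quv_first Q u v l \<circ> \<phi>) (quv_second v l \<circ> \<phi>)" for l
  proof -
    have "level_curves W' (quv_first Q u v l \<circ> \<phi>) (quv_second v l \<circ> \<phi>) = level_curves W' (f l) (x l)"
      by (rule level_curves_cong) (auto simp: W'_def first second F_def X_def inv)
    moreover have "leaf_functions W' (f l) (x l)"
      unfolding leaf_functions_def kanalytic_on_def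
    proof (intro conjI ballI W'(1))
      fix q assume "q \<in> W'"
      then have q: "q \<in> N" "q \<in> B" using W' by auto
      show "kanalytic_at (f l) q" "kanalytic_at (x l) q" using Nq[OF q(1)] xan[OF q(2)] by blast+
      show "leaf_field (f l) (x l) q \<noteq> 0" using Nq[OF q(1)] by simp
    qed
    moreover have "\<exists>s. leaf_field (f l) (x l) q = s *s leaf_field (a l) (b l) q" if "q \<in> W'" for q
      using Nq[of q] that W' par[of q l] by (auto simp: w_def)
    ultimately show ?thesis
      using level_curves_same_kernel[OF leaf_functions_subset[OF ab[of l] W'(1,4)], of "f l" "x l"] by simp
  qed
  show ?thesis using that[OF W'(2,4) ch' data] curves by blast
qed

text \<open>The exterior derivative of \<open>f dx + g dy + h dz + u dv = dQ\<close>, zero by the symmetry of second derivatives.\<close>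

lemma quv_relation:
  fixes Q u v :: "'k::analytic_scalar ^ 3 \<Rightarrow> 'k"
  assumes an: "kanalytic_at Q q" "kanalytic_at u q" "kanalytic_at v q"
  shows "(\<Sum>l\<in>UNIV. leaf_field (quv_first Q u v l) (quv_second v l) q) = 0"
proof -
  have g: "gradient (\<lambda>q. pd i Q q - u q * pd i v q) q $ j
      = pd j (pd i Q) q - (pd j u q * pd i v q + u q * pd j (pd i v) q)" for i j
    unfolding gradient_def vec_lambda_beta
    by (simp add: pd_diff pd_mult kanalytic_at_mult kanalytic_at_pd an)
  have c: "pd 2 (pd 1 f) q = pd 1 (pd 2 f) q" "pd 3 (pd 1 f) q = pd 1 (pd 3 f) q"
    "pd 3 (pd 2 f) q = pd 2 (pd 3 f) q" if "kanalytic_at f q" for f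
    using pd_commute[OF that] by blast+
  have a: "axis (1::3) (1::'k) $ 1 = 1" "axis (1::3) (1::'k) $ 2 = 0" "axis (1::3) (1::'k) $ 3 = 0"
    "axis (2::3) (1::'k) $ 1 = 0" "axis (2::3) (1::'k) $ 2 = 1" "axis (2::3) (1::'k) $ 3 = 0"
    "axis (3::3) (1::'k) $ 1 = 0" "axis (3::3) (1::'k) $ 2 = 0" "axis (3::3) (1::'k) $ 3 = 1"
    by (simp_all add: axis_def)
  have uv: "gradient u q $ j = pd j u q" "gradient v q $ j = pd j v q" for j by (simp_all add: gradient_def)
  show ?thesis
    unfolding sum_4 quv_first_simps quv_second_simps leaf_field_def gradient_coord vec_eq_iff forall_3
      vcross_def vector_add_component vector_3 g a uv c[OF an(1)] c[OF an(3)] zero_index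
    by (simp add: algebra_simps)
qed

lemma quv_leaf_functions:
  fixes Q u v :: "'k::analytic_scalar ^ 3 \<Rightarrow> 'k"
  assumes d: "quv_data V Q u v"
  shows "leaf_functions V (quv_first Q u v l) (quv_second v l)"
    "q \<in> V \<Longrightarrow> general_position (\<lambda>l. leaf_field (quv_first Q u v l) (quv_second v l) q)"
    "q \<in> V \<Longrightarrow> (\<Sum>l\<in>UNIV. leaf_field (quv_first Q u v l) (quv_second v l) q) = 0"
proof -
  have an: "kanalytic_at Q q" "kanalytic_at u q" "kanalytic_at v q" if "q \<in> V" for q
    using d that by (simp_all add: quv_data_def kanalytic_on_def)
  show sum0: "(\<Sum>l\<in>UNIV. leaf_field (quv_first Q u v l) (quv_second v l) q) = 0" if "q \<in> V" for q
    by (rule quv_relation[OF an[OF that]])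
  show gp: "general_position (\<lambda>l. leaf_field (quv_first Q u v l) (quv_second v l) q)" if q: "q \<in> V" for q
  proof -
    have "\<exists>S. card S = 3 \<and> lin_indep form_scale S (\<lambda>l. wedge_d (quv_first Q u v l) (quv_second v l) q)"
      using d q by (simp add: quv_data_def)
    then obtain S where S: "card S = 3"
      "lin_indep form_scale S (\<lambda>l. wedge_d (quv_first Q u v l) (quv_second v l) q)" by auto
    show ?thesis
      by (rule general_position_of_three[OF sum0[OF q] S(1)]) (use S(2) in \<open>simp only: lin_indep_wedges\<close>)
  qed
  have fan: "kanalytic_at (quv_first Q u v l) q" if "q \<in> V" for q
    unfolding quv_first_def using an[OF that]
    by (simp add: kanalytic_at_diff kanalytic_at_mult kanalytic_at_pd)
  have san: "kanalytic_at (quv_second v l) q" if "q \<in> V" for q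
    unfolding quv_second_def using an[OF that] by (simp add: kanalytic_at_coord)
  have "open V" using d unfolding quv_data_def by blast
  then show "leaf_functions V (quv_first Q u v l) (quv_second v l)"
    unfolding leaf_functions_def kanalytic_on_def
    using fan san general_position_nz[OF gp] by blast
qed

section \<open>Webs on a manifold\<close>

lemma partition_on_level_curves: "partition_on N (level_curves N a b)"
proof (rule partition_onI)
  have "\<Union>(level_curves N a b) = (\<Union>c d. \<Union>(components {q \<in> N. a q = c \<and> b q = d}))"
    unfolding level_curves_def by blast
  then have "\<Union>(level_curves N a b) = (\<Union>c d. {q \<in> N. a q = c \<and> b q = d})"
    by simp
  then show "\<Union>(level_curves N a b) = N" by auto
  show "{} \<notin> level_curves N a b"
    using in_components_nonempty unfolding level_curves_def by blast
  fix X Y assume X: "X \<in> level_curves N a b" and Y: "Y \<in> level_curves N a b" and ne: "X \<noteq> Y"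
  obtain c d where c: "X \<in> components {q \<in> N. a q = c \<and> b q = d}" using X unfolding level_curves_def by blast
  obtain c' d' where c': "Y \<in> components {q \<in> N. a q = c' \<and> b q = d'}" using Y unfolding level_curves_def by blast
  show "disjnt X Y"
  proof (cases "c = c' \<and> d = d'")
    case True
    then show ?thesis using components_nonoverlap[of X _ Y] c c' ne unfolding disjnt_def by metis
  next
    case False
    then show ?thesis using in_components_subset[OF c] in_components_subset[OF c'] unfolding disjnt_def by blast
  qed
qed

locale analytic_atlas =
  fixes M :: "'m::t2_space set" and A :: "('m, 'k::analytic_scalar) atlas"
  assumes manifold: "analytic_manifold M A"
begin

lemma chart:
  assumes "(D, \<kappa>) \<in> A"
  shows "open D" "open (\<kappa> ` D)" "homeomorphism D (\<kappa> ` D) \<kappa> (inv_into D \<kappa>)"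
  using manifold assms unfolding analytic_manifold_def by fast+

lemma chart_inv:
  assumes "(D, \<kappa>) \<in> A"
  shows "q \<in> D \<Longrightarrow> inv_into D \<kappa> (\<kappa> q) = q" "y \<in> \<kappa> ` D \<Longrightarrow> \<kappa> (inv_into D \<kappa> y) = y \<and> inv_into D \<kappa> y \<in> D"
  using chart(3)[OF assms] unfolding homeomorphism_def by blast+

lemma chart_image_open:
  assumes "(D, \<kappa>) \<in> A" "open X" "X \<subseteq> D"
  shows "open (\<kappa> ` X)"
proof -
  have "\<kappa> ` X = \<kappa> ` D \<inter> inv_into D \<kappa> -` X"
    using assms(3) chart_inv[OF assms(1)] by force
  moreover have "open (\<kappa> ` D \<inter> inv_into D \<kappa> -` X)"
    using chart(3)[OF assms(1)] chart(2)[OF assms(1)] assms(2)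
    unfolding homeomorphism_def by (intro continuous_open_preimage) auto
  ultimately show ?thesis by simp
qed

lemma chart_preimage_open:
  assumes "(D, \<kappa>) \<in> A" "open X" "X \<subseteq> \<kappa> ` D"
  shows "open (inv_into D \<kappa> ` X)"
proof -
  have "inv_into D \<kappa> ` X = D \<inter> \<kappa> -` X"
    using assms(3) chart_inv[OF assms(1)] by force
  moreover have "open (D \<inter> \<kappa> -` X)"
    using chart(3)[OF assms(1)] chart(1)[OF assms(1)] assms(2)
    unfolding homeomorphism_def by (intro continuous_open_preimage) auto
  ultimately show ?thesis by simp
qed

lemma transition_analytic:
  assumes "(D, \<kappa>) \<in> A" "(E, \<tau>) \<in> A" "y \<in> \<kappa> ` (D \<inter> E)"
  shows "kanalytic_at (\<lambda>y. (\<tau> (inv_into D \<kappa> y)) $ i) y"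
proof -
  have "kanalytic_map_on (\<kappa> ` (D \<inter> E)) (\<tau> \<circ> inv_into D \<kappa>)"
    using manifold assms(1,2) unfolding analytic_manifold_def by fast
  then show ?thesis using assms(3) unfolding kanalytic_map_on_def kanalytic_on_def o_def by blast
qed

lemma transition_homeomorphism:
  assumes "(D, \<kappa>) \<in> A" "(E, \<tau>) \<in> A"
  shows "homeomorphism (\<kappa> ` (D \<inter> E)) (\<tau> ` (D \<inter> E)) (\<tau> \<circ> inv_into D \<kappa>) (\<kappa> \<circ> inv_into E \<tau>)"
proof -
  have "homeomorphism (D \<inter> E) (\<kappa> ` (D \<inter> E)) \<kappa> (inv_into D \<kappa>)"
    "homeomorphism (D \<inter> E) (\<tau> ` (D \<inter> E)) \<tau> (inv_into E \<tau>)"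
    using homeomorphism_restrict[OF chart(3)[OF assms(1)]] homeomorphism_restrict[OF chart(3)[OF assms(2)]] by blast+
  then show ?thesis using homeomorphism_compose homeomorphism_symD by blast
qed

text \<open>
  Leaves of the overlap are path components of leaves, and the transition map, a homeomorphism
  of the overlap, carries level sets to level sets.
\<close>

lemma level_curves_in_chart:
  assumes D: "(D, \<kappa>) \<in> A" and E: "(E, \<tau>) \<in> A" and fg: "leaf_functions (\<kappa> ` D) f g"
  shows "chart_leaves E \<tau> (level_curves D (f \<circ> \<kappa>) (g \<circ> \<kappa>))
      = level_curves (\<tau> ` (D \<inter> E)) (\<lambda>y. f (\<kappa> (inv_into E \<tau> y))) (\<lambda>y. g (\<kappa> (inv_into E \<tau> y)))"
proof -
  define k where "k = inv_into D \<kappa>"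
  define N where "N = \<kappa> ` (D \<inter> E)"
  define \<L> where "\<L> = level_curves D (f \<circ> \<kappa>) (g \<circ> \<kappa>)"
  have hk: "homeomorphism (\<kappa> ` D) D k \<kappa>" unfolding k_def by (rule homeomorphism_symD[OF chart(3)[OF D]])
  have N: "open N" "N \<subseteq> \<kappa> ` D" unfolding N_def using chart_image_open[OF D] chart(1)[OF D] chart(1)[OF E] by auto
  have kN: "k ` N = D \<inter> E" unfolding N_def k_def image_image using chart_inv(1)[OF D] by force
  have self: "restrict_leaves (level_curves (\<kappa> ` D) f g) (\<kappa> ` D) = level_curves (\<kappa> ` D) f g"
    by (rule restrict_level_curves[OF fg chart(2)[OF D] order_refl])
  have L: "\<L> = (\<lambda>L. k ` L) ` restrict_leaves (level_curves (\<kappa> ` D) f g) (\<kappa> ` D)"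
    unfolding self \<L>_def
    by (rule level_curves_image[OF hk, symmetric]) (use chart_inv(2)[OF D] in \<open>auto simp: k_def\<close>)
  have "L \<subseteq> D" if "L \<in> \<L>" for L
    using that in_components_subset unfolding \<L>_def level_curves_def by fastforce
  then have "L \<inter> E = L \<inter> (D \<inter> E)" if "L \<in> \<L>" for L using that by blast
  then have "restrict_leaves \<L> E = restrict_leaves \<L> (D \<inter> E)"
    unfolding restrict_leaves_def by (metis (no_types, lifting))
  also have "\<dots> = (\<lambda>L. k ` L) ` restrict_leaves (level_curves (\<kappa> ` D) f g) N"
    using restrict_leaves_image[OF hk N(2), of "level_curves (\<kappa> ` D) f g"] unfolding L[symmetric] kN .
  also have "\<dots> = (\<lambda>L. k ` L) ` level_curves N f g"
    by (simp only: restrict_level_curves[OF fg N])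
  finally have "chart_leaves E \<tau> \<L> = (\<lambda>L. (\<tau> \<circ> k) ` L) ` level_curves N f g"
    unfolding chart_leaves_def by (simp add: image_image image_comp)
  also have "\<dots> = level_curves (\<tau> ` (D \<inter> E)) (\<lambda>y. f (\<kappa> (inv_into E \<tau> y))) (\<lambda>y. g (\<kappa> (inv_into E \<tau> y)))"
  proof (rule level_curves_image)
    show "homeomorphism N (\<tau> ` (D \<inter> E)) (\<tau> \<circ> k) (\<kappa> \<circ> inv_into E \<tau>)"
      unfolding N_def k_def by (rule transition_homeomorphism[OF D E])
    fix q assume "q \<in> N"
    then have "q = \<kappa> (inv_into E \<tau> ((\<tau> \<circ> k) q))"
      unfolding N_def k_def using chart_inv(1)[OF D] chart_inv(1)[OF E] by auto
    then show "f q = f (\<kappa> (inv_into E \<tau> ((\<tau> \<circ> k) q)))" "g q = g (\<kappa> (inv_into E \<tau> ((\<tau> \<circ> k) q)))" by auto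
  qed
  finally show ?thesis unfolding \<L>_def .
qed

lemma quv_web_in_chart:
  assumes D: "(D, \<kappa>) \<in> A" and E: "(E, \<tau>) \<in> A" and data: "quv_data (\<kappa> ` D) Q u v"
  defines "a \<equiv> \<lambda>l y. quv_first Q u v l (\<kappa> (inv_into E \<tau> y))" and "b \<equiv> \<lambda>l y. quv_second v l (\<kappa> (inv_into E \<tau> y))"
  shows "chart_leaves E \<tau> (quv_web D \<kappa> Q u v l) = level_curves (\<tau> ` (D \<inter> E)) (a l) (b l)"
    "leaf_functions (\<tau> ` (D \<inter> E)) (a l) (b l)"
    "restrict_leaves (chart_leaves E \<tau> (quv_web D \<kappa> Q u v l)) (\<tau> ` (D \<inter> E)) = level_curves (\<tau> ` (D \<inter> E)) (a l) (b l)"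
    "y \<in> \<tau> ` (D \<inter> E) \<Longrightarrow> general_position (\<lambda>l. leaf_field (a l) (b l) y)"
    "y \<in> \<tau> ` (D \<inter> E) \<Longrightarrow> (\<Sum>l\<in>UNIV. leaf_field (a l) (b l) y) = 0"
proof -
  define N where "N = \<tau> ` (D \<inter> E)"
  define \<theta> where "\<theta> y = \<kappa> (inv_into E \<tau> y)" for y
  define \<theta>' where "\<theta>' y = \<tau> (inv_into D \<kappa> y)" for y
  note lf = quv_leaf_functions[OF data]
  have N: "open N" unfolding N_def using chart_image_open[OF E] chart(1)[OF D] chart(1)[OF E] by blast
  have \<theta>D: "\<theta> y \<in> \<kappa> ` (D \<inter> E)" and \<theta>\<theta>': "\<theta>' (\<theta> y) = y" if "y \<in> N" for y
    using that chart_inv(1)[OF D] chart_inv(1)[OF E] unfolding N_def \<theta>_def \<theta>'_def by auto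
  have \<theta>an: "kanalytic_at (\<lambda>y. \<theta> y $ i) y" if "y \<in> N" for y i
    unfolding \<theta>_def using transition_analytic[OF E D, of y i] that by (simp add: N_def Int_commute)
  have \<theta>'an: "kanalytic_at (\<lambda>y. \<theta>' y $ i) (\<theta> y)" if "y \<in> N" for y i
    unfolding \<theta>'_def by (rule transition_analytic[OF D E \<theta>D[OF that]])
  have \<theta>V: "\<theta> y \<in> \<kappa> ` D" if "y \<in> N" for y using \<theta>D[OF that] by blast
  have ind: "triple (gradient (\<lambda>y. \<theta> y $ 1) y) (gradient (\<lambda>y. \<theta> y $ 2) y) (gradient (\<lambda>y. \<theta> y $ 3) y) \<noteq> 0"
    if "y \<in> N" for y
    by (rule inverse_gradients_independent[where \<theta>' = \<theta>', OF \<theta>an[OF that] \<theta>'an[OF that]])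
       (rule eventually_mono[OF eventually_nhds_in_open[OF N that]], rule \<theta>\<theta>')
  have ab: "a l = (\<lambda>y. quv_first Q u v l (\<theta> y))" "b l = (\<lambda>y. quv_second v l (\<theta> y))" for l
    by (simp_all add: a_def b_def \<theta>_def)
  have pull: "leaf_field (a l) (b l) y = pull_field \<theta> y (leaf_field (quv_first Q u v l) (quv_second v l) (\<theta> y))"
    if "y \<in> N" for l y
    unfolding ab by (rule leaf_field_compose[OF leaf_functions_at(1,2)[OF lf(1) \<theta>V[OF that]] \<theta>an[OF that]])
  show gp: "general_position (\<lambda>l. leaf_field (a l) (b l) y)" if "y \<in> \<tau> ` (D \<inter> E)" for y
    using general_position_pull[OF lf(2)[OF \<theta>V] ind, of y y] that pull[of y] by (simp add: N_def)
  show "(\<Sum>l\<in>UNIV. leaf_field (a l) (b l) y) = 0" if "y \<in> \<tau> ` (D \<inter> E)"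
    using lf(3)[OF \<theta>V] that pull[of y] by (simp add: N_def pull_field_sum[symmetric] pull_field_linear)
  have an: "kanalytic_at (a l) y" "kanalytic_at (b l) y" if "y \<in> N" for y
    unfolding ab by (rule kanalytic_at_compose[OF leaf_functions_at(1)[OF lf(1) \<theta>V[OF that]] \<theta>an[OF that]],
        rule kanalytic_at_compose[OF leaf_functions_at(2)[OF lf(1) \<theta>V[OF that]] \<theta>an[OF that]])
  show lfE: "leaf_functions (\<tau> ` (D \<inter> E)) (a l) (b l)"
    unfolding N_def[symmetric] leaf_functions_def kanalytic_on_def
  proof (intro conjI ballI N)
    fix y assume y: "y \<in> N"
    show "kanalytic_at (a l) y" "kanalytic_at (b l) y" using an[OF y] .
    have "y \<in> \<tau> ` (D \<inter> E)" using y by (simp add: N_def)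
    then show "leaf_field (a l) (b l) y \<noteq> 0" using general_position_nz[OF gp] by blast
  qed
  show curves: "chart_leaves E \<tau> (quv_web D \<kappa> Q u v l) = level_curves (\<tau> ` (D \<inter> E)) (a l) (b l)"
    unfolding quv_web_def a_def b_def by (rule level_curves_in_chart[OF D E lf(1)])
  show "restrict_leaves (chart_leaves E \<tau> (quv_web D \<kappa> Q u v l)) (\<tau> ` (D \<inter> E)) = level_curves (\<tau> ` (D \<inter> E)) (a l) (b l)"
    unfolding curves by (rule restrict_level_curves[OF lfE N[unfolded N_def] order_refl])
qed

lemma quv_web_flat:
  assumes D: "(D, \<kappa>) \<in> A" and data: "quv_data (\<kappa> ` D) Q u v" and p: "p \<in> D"
  shows "flat_at A (quv_web D \<kappa> Q u v) p"
  unfolding flat_at_def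
proof safe
  fix E \<tau> assume E: "(E, \<tau>) \<in> A" and pE: "p \<in> E"
  note W = quv_web_in_chart[OF D E data]
  show "web_rank (\<lambda>l. chart_leaves E \<tau> (quv_web D \<kappa> Q u v l)) (\<tau> p) = 1"
    by (rule web_rank_one[OF W(2,3,4,5)]) (use p pE in auto)
qed

lemma quv_web_foliation:
  assumes D: "(D, \<kappa>) \<in> A" and data: "quv_data (\<kappa> ` D) Q u v"
  shows "foliation_on A D (quv_web D \<kappa> Q u v l)"
  unfolding foliation_on_def
proof (intro conjI)
  show "open D" by (rule chart(1)[OF D])
  show "partition_on D (quv_web D \<kappa> Q u v l)" unfolding quv_web_def by (rule partition_on_level_curves)
  have lf: "leaf_functions (\<kappa> ` D) (quv_first Q u v l) (quv_second v l)" by (rule quv_leaf_functions(1)[OF data])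
  have hk: "homeomorphism (\<kappa> ` D) D (inv_into D \<kappa>) \<kappa>" by (rule homeomorphism_symD[OF chart(3)[OF D]])
  have "quv_web D \<kappa> Q u v l = (\<lambda>L. inv_into D \<kappa> ` L) ` level_curves (\<kappa> ` D) (quv_first Q u v l) (quv_second v l)"
    unfolding quv_web_def by (rule level_curves_image[OF hk, symmetric]) (use chart_inv(2)[OF D] in auto)
  moreover have "path_connected (inv_into D \<kappa> ` L)"
    if "L \<in> level_curves (\<kappa> ` D) (quv_first Q u v l) (quv_second v l)" for L
  proof -
    have "path_connected L" using that unfolding level_curves_path_components[OF lf] by auto
    have "L \<subseteq> \<kappa> ` D" using that in_components_subset unfolding level_curves_def by fastforce
    moreover have "continuous_on (\<kappa> ` D) (inv_into D \<kappa>)" using hk by (simp add: homeomorphism_def)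
    ultimately have "continuous_on L (inv_into D \<kappa>)" by (rule continuous_on_subset[rotated])
    then show ?thesis by (rule path_connected_continuous_image) (rule \<open>path_connected L\<close>)
  qed
  ultimately show "\<forall>L\<in>quv_web D \<kappa> Q u v l. path_connected L" by auto
  show "\<forall>(E, \<tau>)\<in>A. \<forall>p\<in>E \<inter> D. \<exists>N a b. open N \<and> \<tau> p \<in> N \<and> N \<subseteq> \<tau> ` (E \<inter> D) \<and>
        basic_functions N a b (restrict_leaves (chart_leaves E \<tau> (quv_web D \<kappa> Q u v l)) N)"
  proof safe
    fix E \<tau> p assume E: "(E, \<tau>) \<in> A" and p: "p \<in> E" "p \<in> D"
    note W = quv_web_in_chart[OF D E data]
    have N: "open (\<tau> ` (D \<inter> E))" by (rule leaf_functions_at(4)[OF W(2)])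
    have "basic_functions (\<tau> ` (D \<inter> E)) (\<lambda>y. quv_first Q u v l (\<kappa> (inv_into E \<tau> y))) (\<lambda>y. quv_second v l (\<kappa> (inv_into E \<tau> y)))
       (restrict_leaves (chart_leaves E \<tau> (quv_web D \<kappa> Q u v l)) (\<tau> ` (D \<inter> E)))"
      unfolding leaf_functions_basic[OF N] by (intro conjI W(2,3))
    then show "\<exists>N a b. open N \<and> \<tau> p \<in> N \<and> N \<subseteq> \<tau> ` (E \<inter> D) \<and>
        basic_functions N a b (restrict_leaves (chart_leaves E \<tau> (quv_web D \<kappa> Q u v l)) N)"
    proof (intro exI conjI)
      show "\<tau> p \<in> \<tau> ` (D \<inter> E)" "\<tau> ` (D \<inter> E) \<subseteq> \<tau> ` (E \<inter> D)" using p by auto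
    qed (rule N)
  qed
qed

lemma quv_web_four_web:
  assumes D: "(D, \<kappa>) \<in> A" and data: "quv_data (\<kappa> ` D) Q u v"
  shows "four_web_on A D (quv_web D \<kappa> Q u v)"
  unfolding four_web_on_def
proof (intro conjI allI)
  show "foliation_on A D (quv_web D \<kappa> Q u v l)" for l by (rule quv_web_foliation[OF D data])
  show "\<forall>(E, \<tau>)\<in>A. \<forall>p\<in>E \<inter> D. \<forall>V.
        (\<forall>l. tangent_space (chart_leaves E \<tau> (quv_web D \<kappa> Q u v l)) (\<tau> p) = vec.span {V l}) \<longrightarrow>
        (\<forall>S. card S = 3 \<longrightarrow> lin_indep (*s) S V)"
  proof safe
    fix E \<tau> p and V :: "4 \<Rightarrow> 'k ^ 3" and S :: "4 set"
    assume E: "(E, \<tau>) \<in> A" and p: "p \<in> E" "p \<in> D" and S: "card S = 3"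
      and V: "\<forall>l. tangent_space (chart_leaves E \<tau> (quv_web D \<kappa> Q u v l)) (\<tau> p) = vec.span {V l}"
    note W = quv_web_in_chart[OF D E data]
    define w where "w l = leaf_field (\<lambda>y. quv_first Q u v l (\<kappa> (inv_into E \<tau> y))) (\<lambda>y. quv_second v l (\<kappa> (inv_into E \<tau> y))) (\<tau> p)" for l
    have N: "open (\<tau> ` (D \<inter> E))" "\<tau> p \<in> \<tau> ` (D \<inter> E)" using leaf_functions_at(4)[OF W(2)] p by auto
    have gp: "general_position w" unfolding w_def by (rule W(4)[OF N(2)])
    have "vec.span {V l} = vec.span {w l}" for l
    proof -
      have "tangent_space (chart_leaves E \<tau> (quv_web D \<kappa> Q u v l)) (\<tau> p) = vec.span {w l}"
        unfolding w_def by (rule tangent_space_span[OF _ N]) (unfold leaf_functions_basic[OF N(1)], intro conjI W(2,3))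
      then show ?thesis using V by simp
    qed
    then have "V l \<in> vec.span {w l}" "w l \<in> vec.span {V l}" for l
      by (metis vec.span_base singletonI)+
    then have "\<exists>s. V l = s *s w l" "\<exists>t. w l = t *s V l" for l
      by (auto simp: vec.span_singleton)
    then obtain s t where st: "\<And>l. V l = s l *s w l" "\<And>l. w l = t l *s V l" by metis
    have "s l \<noteq> 0" for l
      using st(1)[of l] st(2)[of l] general_position_nz[OF gp, of l] by (auto simp: vec_zero_scale)
    then have "general_position V" using general_position_scale[OF gp, of V s] st(1) by blast
    then show "lin_indep (*s) S V" using S unfolding general_position_def by blast
  qed
qed

lemma quv_web_basic_functions:
  assumes D: "(D, \<kappa>) \<in> A" and data: "quv_data (\<kappa> ` D) Q u v"
  shows "basic_functions (\<kappa> ` D) (quv_first Q u v l) (quv_second v l) (chart_leaves D \<kappa> (quv_web D \<kappa> Q u v l))"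
proof -
  have "chart_leaves D \<kappa> (quv_web D \<kappa> Q u v l) = level_curves (\<kappa> ` D) (quv_first Q u v l) (quv_second v l)"
    unfolding quv_web_in_chart(1)[OF D D data] Int_absorb
    by (rule level_curves_cong) (use chart_inv(2)[OF D] in auto)
  then show ?thesis using leaf_functions_basic[OF chart(2)[OF D]] quv_leaf_functions(1)[OF data] by blast
qed

text \<open>
  Rank one supplies an abelian relation whose germ is not zero. By \<open>relation_vanishes_near\<close> it cannot
  vanish at the point itself.
\<close>

lemma flat_web_in_chart:
  assumes D: "(D, \<kappa>) \<in> A" and p: "p \<in> D" "p \<in> U" and web: "four_web_on A U F" and flat: "flat_at A F p"
  obtains B a b E where "\<kappa> p \<in> B" "B \<subseteq> \<kappa> ` (D \<inter> U)" "\<forall>l. leaf_functions B (a l) (b l)"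
    "\<forall>l. restrict_leaves (chart_leaves D \<kappa> (F l)) B = level_curves B (a l) (b l)"
    "\<forall>q\<in>B. general_position (\<lambda>l. leaf_field (a l) (b l) q)"
    "\<forall>q\<in>B. (\<forall>l. vanalytic_at (E l) q \<and> (\<exists>s. E l q = s *s leaf_field (a l) (b l) q) \<and> divergence (E l) q = 0)
       \<and> (\<Sum>l\<in>UNIV. E l q) = 0" "E 4 (\<kappa> p) \<noteq> 0"
proof -
  define \<L> where "\<L> l = chart_leaves D \<kappa> (F l)" for l
  have fol: "foliation_on A U (F l)" for l using web unfolding four_web_on_def by blast
  have pDU: "p \<in> D \<inter> U" using p by blast
  have "\<exists>N a b. open N \<and> \<kappa> p \<in> N \<and> N \<subseteq> \<kappa> ` (D \<inter> U) \<and> basic_functions N a b (restrict_leaves (\<L> l) N)" for l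
  proof -
    have "\<forall>(D, \<kappa>)\<in>A. \<forall>p\<in>D \<inter> U. \<exists>N a b. open N \<and> \<kappa> p \<in> N \<and> N \<subseteq> \<kappa> ` (D \<inter> U) \<and>
        basic_functions N a b (restrict_leaves (chart_leaves D \<kappa> (F l)) N)"
      using fol[of l] unfolding foliation_on_def by blast
    from bspec[OF this D] pDU show ?thesis unfolding \<L>_def by simp
  qed
  then obtain N a b where N: "\<And>l. open (N l) \<and> \<kappa> p \<in> N l \<and> N l \<subseteq> \<kappa> ` (D \<inter> U) \<and>
      basic_functions (N l) (a l) (b l) (restrict_leaves (\<L> l) (N l))" by metis
  have rank: "web_rank \<L> (\<kappa> p) = 1"
  proof -
    have "\<forall>(D, \<kappa>)\<in>A. p \<in> D \<longrightarrow> web_rank (\<lambda>l. chart_leaves D \<kappa> (F l)) (\<kappa> p) = 1"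
      using flat unfolding flat_at_def .
    from bspec[OF this D] p(1) show ?thesis unfolding \<L>_def[abs_def] by simp
  qed
  obtain \<eta> where \<eta>: "\<eta> \<in> abelian_relations_near \<L> (\<kappa> p)" and
    nz: "\<not> (\<forall>\<^sub>F q in nhds (\<kappa> p). \<forall>l. \<eta> l q = 0)"
  proof -
    define R where "R = {enat r | r. \<exists>\<eta> :: nat \<Rightarrow> 4 \<Rightarrow> 'k ^ 3 \<Rightarrow> 'k ^ 3 ^ 3.
       (\<forall>i<r. \<eta> i \<in> abelian_relations_near \<L> (\<kappa> p)) \<and>
       (\<forall>c. (\<forall>\<^sub>F q in nhds (\<kappa> p). \<forall>l. (\<Sum>i<r. form_scale (c i) (\<eta> i l q)) = 0) \<longrightarrow> (\<forall>i<r. c i = 0))}"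
    have "Sup R = 1" using rank unfolding web_rank_def R_def .
    then have "0 < Sup R" by simp
    then obtain x where "x \<in> R" "0 < x" unfolding less_Sup_iff by blast
    then obtain r and \<eta> :: "nat \<Rightarrow> 4 \<Rightarrow> 'k ^ 3 \<Rightarrow> 'k ^ 3 ^ 3" where r: "0 < r"
      and \<eta>: "\<forall>i<r. \<eta> i \<in> abelian_relations_near \<L> (\<kappa> p)" and
      ind: "\<forall>c. (\<forall>\<^sub>F q in nhds (\<kappa> p). \<forall>l. (\<Sum>i<r. form_scale (c i) (\<eta> i l q)) = 0) \<longrightarrow> (\<forall>i<r. c i = 0)"
      unfolding R_def by (auto simp: zero_enat_def)
    have "\<not> (\<forall>\<^sub>F q in nhds (\<kappa> p). \<forall>l. \<eta> 0 l q = 0)"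
    proof
      assume ev: "\<forall>\<^sub>F q in nhds (\<kappa> p). \<forall>l. \<eta> 0 l q = 0"
      define c :: "nat \<Rightarrow> 'k" where "c i = (if i = 0 then 1 else 0)" for i
      have "\<forall>\<^sub>F q in nhds (\<kappa> p). \<forall>l. (\<Sum>i<r. form_scale (c i) (\<eta> i l q)) = 0"
      proof (rule eventually_mono[OF ev], rule allI, rule sum.neutral, rule ballI)
        fix q l i assume "\<forall>l. \<eta> 0 l q = 0"
        then show "form_scale (c i) (\<eta> i l q) = 0" by (cases "i = 0") (simp_all add: c_def form_scale_def vec_eq_iff)
      qed
      then have "c 0 = 0" using ind r by blast
      then show False by (simp add: c_def)
    qed
    then show ?thesis using that \<eta> r by blast
  qed
  obtain N1 where N1: "open N1" "\<kappa> p \<in> N1" "abelian_relation N1 \<L> \<eta>"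
    using \<eta> unfolding abelian_relations_near_def by blast
  define B where "B = N 1 \<inter> N 2 \<inter> N 3 \<inter> N 4 \<inter> N1"
  have "open B" unfolding B_def by (intro open_Int N1(1)) (simp_all add: N)
  moreover have "\<kappa> p \<in> B" using N N1(2) by (simp add: B_def)
  moreover have "B \<subseteq> N1" "B \<subseteq> \<kappa> ` (D \<inter> U)" using N[of 1] by (auto simp: B_def)
  ultimately have B: "open B" "\<kappa> p \<in> B" "B \<subseteq> N1" "B \<subseteq> \<kappa> ` (D \<inter> U)" by blast+
  have BN: "B \<subseteq> N l" for l using exhaust_4[of l] by (auto simp: B_def)
  have lfN: "leaf_functions (N l) (a l) (b l)" "restrict_leaves (\<L> l) (N l) = level_curves (N l) (a l) (b l)" for l
    using N[of l] leaf_functions_basic by blast+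
  have lf: "leaf_functions B (a l) (b l)" for l by (rule leaf_functions_subset[OF lfN(1) B(1) BN])
  have lc: "restrict_leaves (\<L> l) B = level_curves B (a l) (b l)" for l
    using restrict_leaves_twice[OF BN, of "\<L> l" l] restrict_level_curves[OF lfN(1) B(1) BN, of l]
    by (simp only: lfN(2))
  have gp: "general_position (\<lambda>l. leaf_field (a l) (b l) q)" if q: "q \<in> B" for q
  proof -
    obtain p' where p': "p' \<in> D \<inter> U" "q = \<kappa> p'" using q B(4) by blast
    have "\<forall>(D, \<kappa>)\<in>A. \<forall>p\<in>D \<inter> U. \<forall>V.
        (\<forall>l. tangent_space (chart_leaves D \<kappa> (F l)) (\<kappa> p) = vec.span {V l}) \<longrightarrow>
        (\<forall>S. card S = 3 \<longrightarrow> lin_indep (*s) S V)"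
      using web unfolding four_web_on_def by (rule conjunct2)
    from bspec[OF this D] p'(1) have
      "(\<forall>l. tangent_space (\<L> l) (\<kappa> p') = vec.span {leaf_field (a l) (b l) q}) \<longrightarrow>
       general_position (\<lambda>l. leaf_field (a l) (b l) q)"
      unfolding \<L>_def general_position_def by simp
    moreover have "tangent_space (\<L> l) (\<kappa> p') = vec.span {leaf_field (a l) (b l) q}" for l
      unfolding p'(2) by (rule tangent_space_span[OF _ B(1)])
        (use q p'(2) in \<open>simp_all add: leaf_functions_basic[OF B(1)] lc lf\<close>)
    ultimately show ?thesis by blast
  qed
  define E where "E = (\<lambda>l q. vec_of_form (\<eta> l q))"
  have E: "vanalytic_at (E l) q" "\<exists>s. E l q = s *s leaf_field (a l) (b l) q" "divergence (E l) q = 0"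
    "(\<Sum>l\<in>UNIV. E l q) = 0" if "q \<in> B" for l q
    using abelian_relation_fields[OF lf lc N1(3) B(3) that] unfolding E_def by blast+
  have "E 4 (\<kappa> p) \<noteq> 0"
  proof
    assume E0: "E 4 (\<kappa> p) = 0"
    have wan: "vanalytic_at (leaf_field (a l) (b l)) q" if "q \<in> B" for l q
      by (intro vanalytic_at_leaf_field leaf_functions_at(1,2)[OF lf that])
    have "\<forall>\<^sub>F q in nhds (\<kappa> p). \<forall>l. E l q = 0"
      by (rule relation_vanishes_near[OF B(1,2) wan E(1) gp E(2) E(3) E(4) E0]) assumption+
    moreover have "\<forall>\<^sub>F q in nhds (\<kappa> p). q \<in> B" by (rule eventually_nhds_in_open[OF B(1,2)])
    ultimately have "\<forall>\<^sub>F q in nhds (\<kappa> p). \<forall>l. \<eta> l q = 0"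
    proof eventually_elim
      case (elim q)
      have "\<eta> l q $ i $ j = - \<eta> l q $ j $ i" for l i j
        using N1(3) elim(2) B(3) unfolding abelian_relation_def two_form_on_def by blast
      from antisym_form_eq_0[OF this] show ?case using elim(1) by (simp add: E_def)
    qed
    then show False using nz by blast
  qed
  moreover have "\<forall>q\<in>B. (\<forall>l. vanalytic_at (E l) q \<and> (\<exists>s. E l q = s *s leaf_field (a l) (b l) q) \<and> divergence (E l) q = 0)
       \<and> (\<Sum>l\<in>UNIV. E l q) = 0"
    using E by (intro ballI conjI allI)
  moreover have "\<forall>q\<in>B. general_position (\<lambda>l. leaf_field (a l) (b l) q)" using gp by (intro ballI)
  moreover have "\<forall>l. restrict_leaves (chart_leaves D \<kappa> (F l)) B = level_curves B (a l) (b l)"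
    using lc unfolding \<L>_def by (intro allI)
  moreover have "\<forall>l. leaf_functions B (a l) (b l)" using lf by (intro allI)
  ultimately show ?thesis using that[OF B(2,4)] by blast
qed

lemma flat_web_isomorphic_quv:
  assumes p: "p \<in> U" and UM: "U \<subseteq> M" and web: "four_web_on A U F" and flat: "flat_at A F p"
  shows "\<exists>V Q u v p'. quv_data V Q u v \<and> p' \<in> V \<and>
           web_germs_isomorphic A U F p {(V, \<lambda>q. q)} V (quv_web V (\<lambda>q. q) Q u v) p'"
proof -
  have "p \<in> (\<Union>(D, \<kappa>)\<in>A. D)" using p UM manifold unfolding analytic_manifold_def by blast
  then obtain D \<kappa> where D: "(D, \<kappa>) \<in> A" and pD: "p \<in> D" by auto
  obtain B a b E where B: "\<kappa> p \<in> B" "B \<subseteq> \<kappa> ` (D \<inter> U)" and lf: "\<forall>l. leaf_functions B (a l) (b l)" and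
    lc: "\<forall>l. restrict_leaves (chart_leaves D \<kappa> (F l)) B = level_curves B (a l) (b l)" and
    gp: "\<forall>q\<in>B. general_position (\<lambda>l. leaf_field (a l) (b l) q)" and
    E: "\<forall>q\<in>B. (\<forall>l. vanalytic_at (E l) q \<and> (\<exists>s. E l q = s *s leaf_field (a l) (b l) q) \<and> divergence (E l) q = 0)
       \<and> (\<Sum>l\<in>UNIV. E l q) = 0" and E4: "E 4 (\<kappa> p) \<noteq> 0"
    by (rule flat_web_in_chart[OF D pD p web flat]) (rule that)
  have lf: "leaf_functions B (a l) (b l)" for l using lf by blast
  have gp': "general_position (\<lambda>l. leaf_field (a l) (b l) q)" if "q \<in> B" for q using gp that by blast
  have E1: "vanalytic_at (E l) q" and E2: "\<exists>s. E l q = s *s leaf_field (a l) (b l) q"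
    and E3: "divergence (E l) q = 0" and E5: "(\<Sum>l\<in>UNIV. E l q) = 0" if "q \<in> B" for l q
    using E[rule_format, OF that] by blast+
  obtain W0 \<phi> \<psi> V Q u v where W0: "\<kappa> p \<in> W0" "W0 \<subseteq> B" and ch: "analytic_chart W0 \<phi> \<psi> V"
    and data: "quv_data V Q u v"
    and curves: "\<forall>l. level_curves W0 (a l) (b l) = level_curves W0 (quv_first Q u v l \<circ> \<phi>) (quv_second v l \<circ> \<phi>)"
    by (rule flat_normal_form[where a = a and b = b and E = E, OF B(1) lf gp' E1 E2 E3 E5 E4]) (assumption | rule that)+
  define k where "k = inv_into D \<kappa>"
  define W where "W = k ` W0"
  define \<Phi> where "\<Phi> = \<phi> \<circ> \<kappa>"
  define \<Psi> where "\<Psi> = k \<circ> \<psi>"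
  have WD: "W0 \<subseteq> \<kappa> ` D" "W0 \<subseteq> \<kappa> ` (D \<inter> U)" using W0 B(2) by blast+
  have W0o: "open W0" and V: "open V" using ch data unfolding analytic_chart_def quv_data_def by blast+
  have inv: "k (\<kappa> q) = q" if "q \<in> D" for q unfolding k_def by (rule chart_inv(1)[OF D that])
  have W: "open W" "p \<in> W" "W \<subseteq> D" "W \<subseteq> U" "\<kappa> ` W = W0"
  proof -
    show "open W" unfolding W_def k_def by (rule chart_preimage_open[OF D W0o WD(1)])
    show "p \<in> W" unfolding W_def using W0(1) inv[OF pD] by force
    show "W \<subseteq> D" "W \<subseteq> U" unfolding W_def using WD inv by force+
    show "\<kappa> ` W = W0" unfolding W_def image_image k_def using chart_inv(2)[OF D] WD(1) by force
  qed
  have h\<kappa>: "homeomorphism W W0 \<kappa> k"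
    using homeomorphism_restrict[OF chart(3)[OF D] W(3)] unfolding W(5) k_def .
  have h\<phi>: "homeomorphism W0 V \<phi> \<psi>" by (rule analytic_chart_homeomorphism[OF ch])
  have h\<Phi>: "homeomorphism W V \<Phi> \<Psi>" unfolding \<Phi>_def \<Psi>_def by (rule homeomorphism_compose[OF h\<kappa> h\<phi>])
  have \<Phi>W: "\<Phi> ` W = V" "\<Psi> ` V = W" using h\<Phi> by (simp_all add: homeomorphism_def)
  have \<Psi>\<Phi>: "\<Psi> (\<Phi> q) = q" if "q \<in> W" for q using h\<Phi> that by (simp add: homeomorphism_def)
  have \<Phi>\<Psi>: "\<Phi> (\<Psi> y) = y" "\<Psi> y \<in> W" if "y \<in> V" for y using h\<Phi> that unfolding homeomorphism_def by blast+
  have inj: "inj_on \<Phi> W" by (rule inj_on_inverseI[of _ \<Psi>]) (rule \<Psi>\<Phi>)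
  have invW: "inv_into W \<Phi> y = \<Psi> y" if "y \<in> V" for y
    using inv_into_f_f[OF inj \<Phi>\<Psi>(2)[OF that]] \<Phi>\<Psi>(1)[OF that] by simp
  have invV: "inv_into V (\<lambda>q. q) y = y" if "y \<in> V" for y
    using that by (simp add: f_inv_into_f[where f = "\<lambda>q. q", simplified])
  have hom: "homeomorphism W V \<Phi> (inv_into W \<Phi>)"
    by (rule homeomorphism_cong[OF h\<Phi> refl refl]) (simp_all add: invW)
  have bi: "bianalytic_on A {(V, \<lambda>q. q)} W \<Phi>"
    unfolding bianalytic_on_def
  proof (intro conjI)
    show "homeomorphism W (\<Phi> ` W) \<Phi> (inv_into W \<Phi>)" using hom by (simp only: \<Phi>W)
    have "kanalytic_map_on (\<tau> ` {q \<in> W \<inter> E. \<Phi> q \<in> V}) ((\<lambda>q. q) \<circ> \<Phi> \<circ> inv_into E \<tau>) \<and>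
      kanalytic_map_on ((\<lambda>q. q) ` \<Phi> ` {q \<in> W \<inter> E. \<Phi> q \<in> V}) (\<tau> \<circ> inv_into W \<Phi> \<circ> inv_into V (\<lambda>q. q))"
      if T: "(E, \<tau>) \<in> A" for E \<tau>
    proof
      show "kanalytic_map_on (\<tau> ` {q \<in> W \<inter> E. \<Phi> q \<in> V}) ((\<lambda>q. q) \<circ> \<Phi> \<circ> inv_into E \<tau>)"
        unfolding kanalytic_map_on_def kanalytic_on_def
      proof (intro allI ballI)
        fix i y assume "y \<in> \<tau> ` {q \<in> W \<inter> E. \<Phi> q \<in> V}"
        then obtain q where q: "q \<in> W" "q \<in> E" "y = \<tau> q" by blast
        have y: "y \<in> \<tau> ` (E \<inter> D)" using q W(3) by blast
        have e: "\<kappa> (inv_into E \<tau> y) \<in> W0" using q W(5) chart_inv(1)[OF T q(2)] by auto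
        have "kanalytic_at (\<lambda>z. \<phi> z $ i) (\<kappa> (inv_into E \<tau> y))"
          using ch e unfolding analytic_chart_def kanalytic_map_on_def kanalytic_on_def by blast
        from kanalytic_at_compose[where \<phi> = "\<lambda>y. \<kappa> (inv_into E \<tau> y)", OF this transition_analytic[OF T D y]]
        show "kanalytic_at (\<lambda>y. ((\<lambda>q. q) \<circ> \<Phi> \<circ> inv_into E \<tau>) y $ i) y" by (simp add: \<Phi>_def)
      qed
      show "kanalytic_map_on ((\<lambda>q. q) ` \<Phi> ` {q \<in> W \<inter> E. \<Phi> q \<in> V}) (\<tau> \<circ> inv_into W \<Phi> \<circ> inv_into V (\<lambda>q. q))"
        unfolding kanalytic_map_on_def kanalytic_on_def
      proof (intro allI ballI)
        fix i y assume "y \<in> (\<lambda>q. q) ` \<Phi> ` {q \<in> W \<inter> E. \<Phi> q \<in> V}"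
        then obtain q where q: "q \<in> W" "q \<in> E" "\<Phi> q = y" "y \<in> V" by auto
        have \<psi>y: "\<psi> y = \<kappa> q"
          using q h\<phi> W(5) unfolding homeomorphism_def \<Phi>_def by auto
        have an: "kanalytic_at (\<lambda>y. \<psi> y $ l) y" for l
          using ch q(4) unfolding analytic_chart_def kanalytic_map_on_def kanalytic_on_def by blast
        have "\<psi> y \<in> \<kappa> ` (D \<inter> E)" unfolding \<psi>y using q W(3) by blast
        from kanalytic_at_compose[where \<phi> = \<psi>, OF transition_analytic[OF D T this] an]
        have "kanalytic_at (\<lambda>y. \<tau> (k (\<psi> y)) $ i) y" unfolding k_def .
        then show "kanalytic_at (\<lambda>y. (\<tau> \<circ> inv_into W \<Phi> \<circ> inv_into V (\<lambda>q. q)) y $ i) y"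
        proof (rule kanalytic_at_cong)
          show "\<forall>\<^sub>F y in nhds y. \<tau> (k (\<psi> y)) $ i = (\<tau> \<circ> inv_into W \<Phi> \<circ> inv_into V (\<lambda>q. q)) y $ i"
            by (rule eventually_mono[OF eventually_nhds_in_open[OF V q(4)]]) (simp add: invV invW \<Psi>_def)
        qed
      qed
    qed
    then show "\<forall>(E, \<tau>)\<in>A. \<forall>(E', \<tau>')\<in>{(V, \<lambda>q. q)}.
        kanalytic_map_on (\<tau> ` {q \<in> W \<inter> E. \<Phi> q \<in> E'}) (\<tau>' \<circ> \<Phi> \<circ> inv_into E \<tau>) \<and>
        kanalytic_map_on (\<tau>' ` \<Phi> ` {q \<in> W \<inter> E. \<Phi> q \<in> E'}) (\<tau> \<circ> inv_into W \<Phi> \<circ> inv_into E' \<tau>')"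
      by blast
  qed
  have leaves: "(\<lambda>L. \<Phi> ` L) ` restrict_leaves (F l) W = restrict_leaves (quv_web V (\<lambda>q. q) Q u v l) V" for l
  proof -
    have "(\<lambda>L. \<Phi> ` L) ` restrict_leaves (F l) W = (\<lambda>L. \<phi> ` L) ` ((\<lambda>L. \<kappa> ` L) ` restrict_leaves (F l) W)"
      by (simp add: \<Phi>_def image_image image_comp)
    also have "(\<lambda>L. \<kappa> ` L) ` restrict_leaves (F l) W = restrict_leaves (chart_leaves D \<kappa> (F l)) W0"
      using restrict_leaves_image[OF chart(3)[OF D] W(3), of "F l"] unfolding W(5) chart_leaves_def by simp
    also have "\<dots> = restrict_leaves (restrict_leaves (chart_leaves D \<kappa> (F l)) B) W0"
      by (rule restrict_leaves_twice[OF W0(2), symmetric])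
    also have "\<dots> = level_curves W0 (a l) (b l)"
      using lc restrict_level_curves[OF lf W0o W0(2)] by simp
    also have "\<dots> = level_curves W0 (quv_first Q u v l \<circ> \<phi>) (quv_second v l \<circ> \<phi>)" using curves by blast
    also have "(\<lambda>L. \<phi> ` L) ` \<dots> = level_curves V (quv_first Q u v l) (quv_second v l)"
      by (rule level_curves_image[OF h\<phi>]) simp_all
    also have "\<dots> = restrict_leaves (level_curves V (quv_first Q u v l) (quv_second v l)) V"
      by (rule restrict_level_curves[OF quv_leaf_functions(1)[OF data] V order_refl, symmetric])
    also have "\<dots> = restrict_leaves (quv_web V (\<lambda>q. q) Q u v l) V" by (simp add: quv_web_def o_def)
    finally show ?thesis .
  qed
  have "web_germs_isomorphic A U F p {(V, \<lambda>q. q)} V (quv_web V (\<lambda>q. q) Q u v) (\<Phi> p)"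
    unfolding web_germs_isomorphic_def
  proof (intro exI conjI allI)
    show "open W" "p \<in> W" "W \<subseteq> U" by (fact W)+
    show "open (\<Phi> ` W)" "\<Phi> ` W \<subseteq> V" using V by (simp_all add: \<Phi>W)
    show "bianalytic_on A {(V, \<lambda>q. q)} W \<Phi>" by (rule bi)
    show "(\<lambda>L. \<Phi> ` L) ` restrict_leaves (F l) W = restrict_leaves (quv_web V (\<lambda>q. q) Q u v l) (\<Phi> ` W)" for l
      unfolding \<Phi>W by (rule leaves)
  qed (rule refl)
  moreover have "\<Phi> p \<in> V" using \<Phi>W W(2) by blast
  ultimately show ?thesis using data by blast
qed

end

theorem mainTheorem2:
  fixes M :: "'m::t2_space set"
    and A :: "('m, 'k::analytic_scalar) atlas"
  assumes "analytic_manifold M A"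
  shows
    "(\<forall>D \<kappa> Q u v. (D, \<kappa>) \<in> A \<and> quv_data (\<kappa> ` D) Q u v \<longrightarrow>
        (\<forall>l. basic_functions (\<kappa> ` D) (quv_first Q u v l) (quv_second v l)
               (chart_leaves D \<kappa> (quv_web D \<kappa> Q u v l))) \<and>
        four_web_on A D (quv_web D \<kappa> Q u v) \<and>
        (\<forall>p\<in>D. flat_at A (quv_web D \<kappa> Q u v) p))
     \<and>
     (\<forall>U F p. U \<subseteq> M \<and> p \<in> U \<and> four_web_on A U F \<and> flat_at A F p \<longrightarrow>
        (\<exists>V Q u v p'. quv_data V Q u v \<and> p' \<in> V \<and>
           web_germs_isomorphic A U F p {(V, \<lambda>q. q)} V (quv_web V (\<lambda>q. q) Q u v) p'))"
proof -
  interpret analytic_atlas M A by standard (rule assms)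
  show ?thesis
  proof (intro conjI allI impI)
    fix D \<kappa> Q u v l
    assume "(D, \<kappa>) \<in> A \<and> quv_data (\<kappa> ` D) Q u v"
    then show "basic_functions (\<kappa> ` D) (quv_first Q u v l) (quv_second v l) (chart_leaves D \<kappa> (quv_web D \<kappa> Q u v l))"
      using quv_web_basic_functions by blast
  next
    fix D \<kappa> Q u v
    assume "(D, \<kappa>) \<in> A \<and> quv_data (\<kappa> ` D) Q u v"
    then show "four_web_on A D (quv_web D \<kappa> Q u v)" using quv_web_four_web by blast
  next
    fix D \<kappa> Q u v
    assume "(D, \<kappa>) \<in> A \<and> quv_data (\<kappa> ` D) Q u v"
    then show "\<forall>p\<in>D. flat_at A (quv_web D \<kappa> Q u v) p" using quv_web_flat by blast
  next
    fix U F p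
    assume "U \<subseteq> M \<and> p \<in> U \<and> four_web_on A U F \<and> flat_at A F p"
    then show "\<exists>V Q u v p'. quv_data V Q u v \<and> p' \<in> V \<and>
           web_germs_isomorphic A U F p {(V, \<lambda>q. q)} V (quv_web V (\<lambda>q. q) Q u v) p'"
      by (intro flat_web_isomorphic_quv) simp_all
  qed
qed

end
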